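(* Let $\Omega\subset\mathbb R$ be a bounded measurable spectral set with Lebesgue measure $|\Omega|=1$, and let $\Lambda$ be a spectrum of $\Omega$ with $0\in\Lambda$. Then $\Lambda\subset\mathbb Q$.
   Context: A bounded measurable set $\Omega\subset\mathbb R$ of positive Lebesgue measure is called a spectral set if there exists a countable set $\Lambda\subset\mathbb R$ such that the family of exponentials $\{e_\lambda(x)=e^{2\pi i\lambda x}:\lambda\in\Lambda\}$ forms an orthogonal basis of $L^2(\Omega)$ (a complete family of pairwise orthogonal functions). In this case $\Lambda$ is called a spectrum of $\Omega$. *)

theory Defs
  imports "HOL-Analysis.Analysis"
begin

definition expo :: "real \<Rightarrow> real \<Rightarrow> complex" where
  "expo l x = exp (2 * of_real pi * \<i> * of_real l * of_real x)"

text \<open>Functions representing elements of \<open>L\<^sup>2(\<Omega>)\<close>. Equality almost everywhere is not quotiented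
  out: the notions below depend on the values of a function only through integrals over \<open>\<Omega>\<close>.\<close>

definition L2_fun :: "real set \<Rightarrow> (real \<Rightarrow> complex) \<Rightarrow> bool" where
  "L2_fun \<Omega> f \<longleftrightarrow>
     f \<in> borel_measurable (lebesgue_on \<Omega>) \<and>
     integrable (lebesgue_on \<Omega>) (\<lambda>x. (cmod (f x))\<^sup>2)"

definition L2_inner :: "real set \<Rightarrow> (real \<Rightarrow> complex) \<Rightarrow> (real \<Rightarrow> complex) \<Rightarrow> complex" where
  "L2_inner \<Omega> f g = (LINT x|lebesgue_on \<Omega>. f x * cnj (g x))"

definition L2_norm :: "real set \<Rightarrow> (real \<Rightarrow> complex) \<Rightarrow> real" where
  "L2_norm \<Omega> f = sqrt (LINT x|lebesgue_on \<Omega>. (cmod (f x))\<^sup>2)"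

text \<open>Completeness of the exponentials: their finite linear combinations are dense in
  \<open>L\<^sup>2(\<Omega>)\<close>.\<close>

definition complete_exponentials :: "real set \<Rightarrow> real set \<Rightarrow> bool" where
  "complete_exponentials \<Omega> \<Lambda> \<longleftrightarrow>
     (\<forall>f. L2_fun \<Omega> f \<longrightarrow>
       (\<forall>\<epsilon>>0. \<exists>F c. finite F \<and> F \<subseteq> \<Lambda> \<and>
          L2_norm \<Omega> (\<lambda>x. f x - (\<Sum>l\<in>F. c l * expo l x)) < \<epsilon>))"

definition orthogonal_exponentials :: "real set \<Rightarrow> real set \<Rightarrow> bool" where
  "orthogonal_exponentials \<Omega> \<Lambda> \<longleftrightarrow>
     (\<forall>l\<in>\<Lambda>. \<forall>m\<in>\<Lambda>. l \<noteq> m \<longrightarrow> L2_inner \<Omega> (expo l) (expo m) = 0)"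

definition is_spectrum :: "real set \<Rightarrow> real set \<Rightarrow> bool" where
  "is_spectrum \<Omega> \<Lambda> \<longleftrightarrow>
     countable \<Lambda> \<and> orthogonal_exponentials \<Omega> \<Lambda> \<and> complete_exponentials \<Omega> \<Lambda>"

definition spectral_set :: "real set \<Rightarrow> bool" where
  "spectral_set \<Omega> \<longleftrightarrow>
     bounded \<Omega> \<and> \<Omega> \<in> sets lebesgue \<and> emeasure lebesgue \<Omega> > 0 \<and> (\<exists>\<Lambda>. is_spectrum \<Omega> \<Lambda>)"

end

theory Submission
  imports Defs "HOL-Complex_Analysis.Complex_Analysis" "HOL-Computational_Algebra.Fundamental_Theorem_Algebra"
begin

text \<open>Let \<open>U\<close> be the Fourier transform of \<open>\<Omega>\<close>. Its zeros are discrete, so a spectrum has only finitely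
  many possible patterns in a window of given length. A lower bound for exponential sums with
  one-sided frequencies, together with a large sieve estimate, shows that a long enough window
  determines the whole spectrum; by the pigeonhole principle the spectrum has a period \<open>p\<close>.

  Fourier uniqueness on \<open>(0, 1/p)\<close> localizes orthogonality to almost every fibre
  \<open>\<Omega> \<inter> (x + \<int>/p)\<close>: it has exactly \<open>p\<close> points, and writing them as \<open>x + a/p\<close> with \<open>a \<in> A\<close>, the
  numbers \<open>z\<^sub>l = exp (2\<pi>il/p)\<close> satisfy \<open>\<Sum>a\<in>A. (z\<^sub>l/z\<^sub>m)\<^sup>a = 0\<close> for \<open>l\<close>, \<open>m\<close> in distinct residue classes
  modulo \<open>p\<close>. Bessel's inequality gives at least \<open>p\<close> classes. As many as \<open>card A\<close> nonzero
  complex numbers with these relations must have equal moduli. The relations being algebraic,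
  they persist under every field embedding, so all conjugates of \<open>z\<^sub>l\<close> have modulus 1, and by
  Kronecker's theorem \<open>z\<^sub>l\<close> is a root of unity.\<close>

section \<open>Orthogonal powers have equal moduli\<close>

text \<open>A window of fixed length suffices because the lower bound is uniform. Let
  \<open>y\<close> be the first point where two spectra differ. The expansion of
  \<open>expo y\<close> in the basis that misses \<open>y\<close>, divided by \<open>expo y\<close>,
  leaves \<open>1\<close> plus a sum over positive frequencies that is small in mean square on
  \<Omega>. Such a sum is bounded and holomorphic in the upper half plane; if it is small on a set
  of positive measure of the real line, it is small at interior points too, but at \<i> the term
  \<open>1\<close> dominates. The bound may depend only on \<Omega> and on the gap between
  frequencies, since the window is chosen before the spectra.

  The algebraic obstacle is that field embeddings respect neither moduli nor complex conjugation. On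
  the unit circle the relations express orthogonality of the rows of powers, and conjugation is
  inversion there. An embedding preserves only the relations between quotients, so unit modulus has
  to be won back from these alone; the decisive input is that there are at least as many numbers as
  exponents.\<close>

text \<open>The kernel is a positive combination of all-ones blocks:
  \<open>\<phi> (min (r j) (r k))\<close> adds up the increments of \<phi> over the levels of
  \<open>r\<close> below both arguments, and each increment contributes a multiple of the squared
  modulus of the sum of \<open>c\<close> over the indices at or above its level. Total zero thus
  kills every block sum, in particular the one of the top level. The induction peels off the lowest
  level by passing from \<phi> to \<open>\<phi> x - \<phi> m\<close>.\<close>

lemma min_kernel_nonneg:
  fixes r :: "'a \<Rightarrow> real" and c :: "'a \<Rightarrow> complex" and \<phi> :: "real \<Rightarrow> real"
  assumes "finite S" and "S \<noteq> {}"
    and mono: "\<And>j k. j \<in> S \<Longrightarrow> k \<in> S \<Longrightarrow> r j < r k \<Longrightarrow> \<phi> (r j) < \<phi> (r k)"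
    and pos: "\<And>j. j \<in> S \<Longrightarrow> 0 < \<phi> (r j)"
  shows "\<exists>q\<ge>0. (\<Sum>j\<in>S. \<Sum>k\<in>S. of_real (\<phi> (min (r j) (r k))) * (c j * cnj (c k))) = complex_of_real q
    \<and> (q = 0 \<longrightarrow> (\<Sum>j\<in>{j\<in>S. r j = Max (r ` S)}. c j) = 0)"
  using assms
proof (induction "card S" arbitrary: S \<phi> rule: less_induct)
  case less
  define m where "m = Min (r ` S)"
  define S' where "S' = {j\<in>S. m < r j}"
  have m_le: "m \<le> r j" if "j \<in> S" for j
    using that less.prems(1) by (simp add: m_def)
  obtain i where i: "i \<in> S" "r i = m"
  proof -
    have "m \<in> r ` S" unfolding m_def using less.prems(1,2) by (intro Min_in) auto
    then show thesis using that by auto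
  qed
  define \<psi> where "\<psi> = (\<lambda>x. \<phi> x - \<phi> m)"
  have fin': "finite S'" "S' \<subseteq> S" using less.prems(1) by (auto simp: S'_def)
  have card': "card S' < card S"
    using i less.prems(1) by (intro psubset_card_mono) (auto simp: S'_def)
  let ?K = "\<lambda>f S. (\<Sum>j\<in>S. \<Sum>k\<in>S. of_real (f (min (r j) (r k))) * (c j * cnj (c k)))"
  have "?K \<phi> S = (\<Sum>j\<in>S. \<Sum>k\<in>S. of_real (\<phi> m) * (c j * cnj (c k))) + ?K \<psi> S"
    unfolding sum.distrib[symmetric] by (intro sum.cong refl) (simp add: \<psi>_def algebra_simps)
  also have "(\<Sum>j\<in>S. \<Sum>k\<in>S. of_real (\<phi> m) * (c j * cnj (c k))) = of_real (\<phi> m) * ((\<Sum>j\<in>S. c j) * cnj (\<Sum>j\<in>S. c j))"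
    unfolding cnj_sum sum_product by (simp add: sum_distrib_left)
  also have "\<dots> = of_real (\<phi> m * (cmod (\<Sum>j\<in>S. c j))\<^sup>2)"
    by (simp only: of_real_mult complex_norm_square)
  also have "?K \<psi> S = ?K \<psi> S'"
  proof -
    have z: "\<psi> (min (r j) (r k)) = 0" if "j \<in> S" "k \<in> S" "j \<notin> S' \<or> k \<notin> S'" for j k
      using that m_le[of j] m_le[of k] by (auto simp: S'_def \<psi>_def min_def not_less)
    have "?K \<psi> S = (\<Sum>j\<in>S. \<Sum>k\<in>S'. of_real (\<psi> (min (r j) (r k))) * (c j * cnj (c k)))"
      using z by (intro sum.cong refl sum.mono_neutral_right less.prems(1) fin') auto
    also have "\<dots> = ?K \<psi> S'"
      using z fin' by (intro sum.mono_neutral_right less.prems(1) fin' ballI sum.neutral) (auto simp: subset_eq)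
    finally show ?thesis .
  qed
  finally have eq: "?K \<phi> S = of_real (\<phi> m * (cmod (\<Sum>j\<in>S. c j))\<^sup>2) + ?K \<psi> S'" .
  have pm: "0 < \<phi> m" using less.prems(4)[OF i(1)] i(2) by simp
  show ?case
  proof (cases "S' = {}")
    case True
    then have "r j = m" if "j \<in> S" for j
      using that m_le[OF that] by (auto simp: S'_def)
    then have "r ` S = {m}" using less.prems(2) by auto
    then have "{j \<in> S. r j = Max (r ` S)} = S" using \<open>\<And>j. j \<in> S \<Longrightarrow> r j = m\<close> by auto
    then show ?thesis
      using eq True pm by (intro exI[of _ "\<phi> m * (cmod (\<Sum>j\<in>S. c j))\<^sup>2"]) auto
  next
    case False
    have "\<exists>q\<ge>0. ?K \<psi> S' = complex_of_real q \<and> (q = 0 \<longrightarrow> (\<Sum>j\<in>{j\<in>S'. r j = Max (r ` S')}. c j) = 0)"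
    proof (rule less.hyps[OF card' _ False])
      show "\<psi> (r j) < \<psi> (r k)" if "j \<in> S'" "k \<in> S'" "r j < r k" for j k
        using that less.prems(3)[of j k] fin'(2) by (auto simp: \<psi>_def)
      show "0 < \<psi> (r j)" if "j \<in> S'" for j
        using that less.prems(3)[of i j] i by (auto simp: \<psi>_def S'_def)
    qed (use fin' in auto)
    then obtain q where q: "q \<ge> 0" "?K \<psi> S' = complex_of_real q"
      "q = 0 \<longrightarrow> (\<Sum>j\<in>{j\<in>S'. r j = Max (r ` S')}. c j) = 0" by blast
    have mx: "Max (r ` S') \<in> r ` S'" using fin' False by (intro Max_in) auto
    have "Max (r ` S) = Max (r ` S')"
    proof (rule Max_eqI)
      obtain j where "j \<in> S'" "r j = Max (r ` S')" using mx by force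
      then show "Max (r ` S') \<in> r ` S" using fin' by (metis image_eqI subsetD)
      fix y assume "y \<in> r ` S"
      then obtain k where k: "k \<in> S" "y = r k" by auto
      have "m < Max (r ` S')" using \<open>j \<in> S'\<close> \<open>r j = _\<close> by (auto simp: S'_def)
      then show "y \<le> Max (r ` S')" using k fin' by (cases "k \<in> S'") (auto simp: S'_def)
    qed (use less.prems in auto)
    moreover from this have "{j\<in>S. r j = Max (r ` S)} = {j\<in>S'. r j = Max (r ` S')}"
    proof -
      obtain j where "j \<in> S'" "r j = Max (r ` S')" using mx by force
      then have "m < Max (r ` S')" by (auto simp: S'_def)
      then show ?thesis using \<open>Max (r ` S) = _\<close> by (auto simp: S'_def)
    qed
    ultimately show ?thesis
      using eq q pm
      by (intro exI[of _ "\<phi> m * (cmod (\<Sum>j\<in>S. c j))\<^sup>2 + q"]) (auto simp: add_nonneg_eq_0_iff)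
  qed
qed

text \<open>With \<open>c\<^sub>j = (cnj w\<^sub>j)\<^sup>-\<^sup>a\<close> the kernel \<open>min(\<bar>w\<^sub>j\<bar>, \<bar>w\<^sub>k\<bar>)\<^sup>2\<^sup>a c\<^sub>j (cnj c\<^sub>k)\<close> equals \<open>(w\<^sub>j / w\<^sub>k)\<^sup>a\<close> or the conjugate of
  \<open>(w\<^sub>k / w\<^sub>j)\<^sup>a\<close>, whichever quotient has modulus at most 1. Its sum over \<open>a \<in> A\<close> is therefore
  diagonal with total \<open>card J * card A\<close>, while the term \<open>a = 0\<close> alone contributes \<open>(card J)\<^sup>2\<close>.
  So all other terms vanish, and equality in the previous lemma applies.\<close>

lemma equal_moduli:
  fixes w :: "'a \<Rightarrow> complex" and A :: "nat set"
  assumes "finite J" "finite A" "0 \<in> A" and card: "card A \<le> card J"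
    and nz: "\<And>j. j \<in> J \<Longrightarrow> w j \<noteq> 0"
    and orth: "\<And>j k. j \<in> J \<Longrightarrow> k \<in> J \<Longrightarrow> j \<noteq> k \<Longrightarrow> (\<Sum>a\<in>A. (w j / w k) ^ a) = 0"
    and "j \<in> J" "k \<in> J"
  shows "cmod (w j) = cmod (w k)"
proof -
  define r where "r = (\<lambda>j. cmod (w j))"
  define c where "c = (\<lambda>a j. inverse (cnj (w j)) ^ a)"
  define Q where "Q = (\<lambda>a. \<Sum>j\<in>J. \<Sum>k\<in>J. complex_of_real ((min (r j) (r k)) ^ (2 * a)) * (c a j * cnj (c a k)))"
  define T where "T = {j\<in>J. r j = Max (r ` J)}"
  have rp: "0 < r j" if "j \<in> J" for j using nz[OF that] by (simp add: r_def)
  have finJ: "J \<noteq> {}" using assms by auto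
  have entry: "(\<Sum>a\<in>A. complex_of_real ((min (r j) (r k)) ^ (2 * a)) * (c a j * cnj (c a k)))
      = (if j = k then of_nat (card A) else 0)" if jk: "j \<in> J" "k \<in> J" for j k
  proof -
    have sq: "complex_of_real (r i ^ (2 * a)) = w i ^ a * cnj (w i) ^ a" for i a
      using complex_norm_square[of "w i"] by (simp add: r_def power_mult power_mult_distrib)
    then have sq': "complex_of_real (r i ^ (a * 2)) = w i ^ a * cnj (w i) ^ a" for i a
      by (simp add: mult.commute)
    have t1: "complex_of_real ((min (r j) (r k)) ^ (2 * a)) * (c a j * cnj (c a k)) = (w j / w k) ^ a"
      if "r j \<le> r k" for a
      using that nz jk
      by (simp add: c_def min_def sq sq' field_simps del: of_real_power)
    have t2: "complex_of_real ((min (r j) (r k)) ^ (2 * a)) * (c a j * cnj (c a k)) = cnj ((w k / w j) ^ a)"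
      if "r k \<le> r j" for a
      using that nz jk
      by (cases "r j = r k") (auto simp add: c_def min_def sq sq' field_simps simp del: of_real_power)
    show ?thesis
    proof (cases "r j \<le> r k")
      case True
      then show ?thesis using t1[OF True] orth[OF jk] nz jk by auto
    next
      case False
      have "(\<Sum>a\<in>A. complex_of_real ((min (r j) (r k)) ^ (2 * a)) * (c a j * cnj (c a k)))
          = (\<Sum>a\<in>A. cnj ((w k / w j) ^ a))"
        using False by (intro sum.cong refl t2) auto
      also have "\<dots> = cnj (\<Sum>a\<in>A. (w k / w j) ^ a)" by (simp only: cnj_sum)
      also have "(\<Sum>a\<in>A. (w k / w j) ^ a) = 0" using False orth[OF jk(2,1)] by auto
      finally show ?thesis using False by auto
    qed
  qed
  have "(\<Sum>a\<in>A. Q a) = (\<Sum>j\<in>J. \<Sum>k\<in>J. \<Sum>a\<in>A. complex_of_real ((min (r j) (r k)) ^ (2 * a)) * (c a j * cnj (c a k)))"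
    unfolding Q_def by (subst sum.swap, intro sum.cong refl, subst sum.swap, simp)
  also have "\<dots> = (\<Sum>j\<in>J. \<Sum>k\<in>J. if j = k then of_nat (card A) else 0)"
    by (intro sum.cong refl entry)
  also have "\<dots> = of_nat (card J * card A)" using assms(1) by simp
  finally have tot: "(\<Sum>a\<in>A. Q a) = of_nat (card J * card A)" .
  have Q0: "Q 0 = of_nat (card J * card J)" by (simp add: Q_def c_def)
  have "\<forall>a\<in>A - {0}. \<exists>q\<ge>0. Q a = complex_of_real q \<and> (q = 0 \<longrightarrow> (\<Sum>j\<in>T. c a j) = 0)"
  proof
    fix a assume a: "a \<in> A - {0}"
    show "\<exists>q\<ge>0. Q a = complex_of_real q \<and> (q = 0 \<longrightarrow> (\<Sum>j\<in>T. c a j) = 0)"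
      unfolding Q_def T_def
    proof (rule min_kernel_nonneg[of J r "\<lambda>x. x ^ (2 * a)" "c a"])
      show "r j ^ (2 * a) < r k ^ (2 * a)" if "j \<in> J" "k \<in> J" "r j < r k" for j k
        using that a rp[OF that(1)] by (intro power_strict_mono) auto
    qed (use assms(1) finJ rp in auto)
  qed
  then obtain q where q: "\<And>a. a \<in> A - {0} \<Longrightarrow> q a \<ge> 0" "\<And>a. a \<in> A - {0} \<Longrightarrow> Q a = complex_of_real (q a)"
     "\<And>a. a \<in> A - {0} \<Longrightarrow> q a = 0 \<Longrightarrow> (\<Sum>j\<in>T. c a j) = 0" by metis
  have "complex_of_real (real (card J * card J) + (\<Sum>a\<in>A - {0}. q a)) = complex_of_real (real (card J * card A))"
    using tot Q0 q(2) assms(2,3) by (simp add: sum.remove[of A 0])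
  then have sumq: "real (card J * card J) + (\<Sum>a\<in>A - {0}. q a) = real (card J * card A)"
    using of_real_eq_iff by blast
  have "real (card J * card A) \<le> real (card J * card J)" using card by (simp add: mult_left_mono)
  with sumq sum_nonneg[of "A - {0}" q, OF q(1)] have sq0: "(\<Sum>a\<in>A - {0}. q a) = 0" by linarith
  then have "q a = 0" if "a \<in> A - {0}" for a
    using that assms(2) sum_nonneg_eq_0_iff[of "A - {0}" q] q(1) by auto
  then have top0: "(\<Sum>j\<in>T. c a j) = 0" if "a \<in> A - {0}" for a using q(3) that by blast
  have cJ: "card J = card A" using sumq sq0 finJ assms(1) by simp
  define M where "M = Max (r ` J)"
  have T: "finite T" "T \<subseteq> J" "\<And>j. j \<in> T \<Longrightarrow> r j = M" using assms(1) by (auto simp: T_def M_def)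
  have "Max (r ` J) \<in> r ` J" using assms(1) finJ by (intro Max_in) auto
  then have Tne: "T \<noteq> {}" by (auto simp: T_def)
  \<comment> \<open>The same double count over the top level \<open>T\<close> alone. The diagonal
    gives \<open>card T * card A\<close>; since the sums of \<open>c a\<close> over \<open>T\<close>
    vanish for \<open>a\<close> other than \<open>0\<close>, the other evaluation leaves only the
    square of \<open>card T\<close>. So \<open>T\<close> has as many elements as
    \<open>J\<close>.\<close>
  have "of_nat (card T * card A) = (\<Sum>j\<in>T. \<Sum>k\<in>T. if j = k then of_nat (card A) else (0::complex))"
    using T(1) by simp
  also have "\<dots> = (\<Sum>j\<in>T. \<Sum>k\<in>T. \<Sum>a\<in>A. complex_of_real ((min (r j) (r k)) ^ (2 * a)) * (c a j * cnj (c a k)))"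
    using T(2) by (intro sum.cong refl entry[symmetric]) auto
  also have "\<dots> = (\<Sum>a\<in>A. \<Sum>j\<in>T. \<Sum>k\<in>T. complex_of_real (M ^ (2 * a)) * (c a j * cnj (c a k)))"
    by (subst (2) sum.swap, subst (3) sum.swap, intro sum.cong refl) (simp add: T(3))
  also have "\<dots> = (\<Sum>a\<in>A. complex_of_real (M ^ (2 * a)) * ((\<Sum>j\<in>T. c a j) * cnj (\<Sum>j\<in>T. c a j)))"
    unfolding cnj_sum sum_product by (simp add: sum_distrib_left)
  also have "\<dots> = (\<Sum>a\<in>A. if a = 0 then of_nat (card T * card T) else 0)"
    using top0 by (intro sum.cong refl) (auto simp: c_def)
  also have "\<dots> = of_nat (card T * card T)" using assms(2,3) by simp
  finally have "card T * card A = card T * card T" using of_nat_eq_iff by blast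
  then have "card T = card J" using Tne T(1) cJ by simp
  then have "T = J" using T assms(1) by (simp add: card_subset_eq)
  then show ?thesis using T(3) assms(7,8) by (simp add: r_def)
qed

section \<open>Embeddings and Kronecker's theorem\<close>

text \<open>Fields are carried as subsets of the complex numbers and embeddings as total functions
  considered on them. Moduli of images then make sense, and towers of extensions need no new
  types.\<close>

definition csubring :: "complex set \<Rightarrow> bool" where
  "csubring R \<longleftrightarrow> 1 \<in> R \<and> (\<forall>x\<in>R. \<forall>y\<in>R. x + y \<in> R \<and> x * y \<in> R) \<and> (\<forall>x\<in>R. - x \<in> R)"

text \<open>Quantifying over \<open>0\<close> as well is harmless because
  \<open>inverse 0 = 0\<close>.\<close>

definition csubfield :: "complex set \<Rightarrow> bool" where
  "csubfield F \<longleftrightarrow> csubring F \<and> (\<forall>x\<in>F. inverse x \<in> F)"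

definition over :: "complex set \<Rightarrow> complex poly \<Rightarrow> bool" where
  "over R p \<longleftrightarrow> (\<forall>i. coeff p i \<in> R)"

definition embedding_on :: "complex set \<Rightarrow> (complex \<Rightarrow> complex) \<Rightarrow> bool" where
  "embedding_on F \<sigma> \<longleftrightarrow> \<sigma> 1 = 1 \<and> (\<forall>x\<in>F. \<forall>y\<in>F. \<sigma> (x + y) = \<sigma> x + \<sigma> y \<and> \<sigma> (x * y) = \<sigma> x * \<sigma> y)"

lemma csubring_closed:
  assumes "csubring R"
  shows "0 \<in> R" "1 \<in> R" "x \<in> R \<Longrightarrow> y \<in> R \<Longrightarrow> x + y \<in> R" "x \<in> R \<Longrightarrow> y \<in> R \<Longrightarrow> x * y \<in> R"
    "x \<in> R \<Longrightarrow> - x \<in> R" "x \<in> R \<Longrightarrow> y \<in> R \<Longrightarrow> x - y \<in> R"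
proof -
  show "0 \<in> R" using assms unfolding csubring_def by (metis add.right_inverse)
  show "x \<in> R \<Longrightarrow> y \<in> R \<Longrightarrow> x - y \<in> R" using assms unfolding csubring_def
    by (metis diff_conv_add_uminus)
qed (use assms in \<open>auto simp: csubring_def\<close>)

lemma csubring_sum: "csubring R \<Longrightarrow> (\<And>i. i \<in> I \<Longrightarrow> f i \<in> R) \<Longrightarrow> sum f I \<in> R"
  by (induction I rule: infinite_finite_induct) (auto intro: csubring_closed)

lemma csubring_power: "csubring R \<Longrightarrow> x \<in> R \<Longrightarrow> x ^ n \<in> R"
  by (induction n) (auto intro: csubring_closed)

lemma csubring_Ints: "csubring \<int>" by (auto simp: csubring_def)

lemma csubfield_Rats: "csubfield \<rat>" by (auto simp: csubring_def csubfield_def)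

lemma over_simps:
  assumes "csubring R"
  shows "over R 0" "over R 1" "over R p \<Longrightarrow> over R q \<Longrightarrow> over R (p + q)"
    "over R p \<Longrightarrow> over R q \<Longrightarrow> over R (p * q)" "over R p \<Longrightarrow> over R q \<Longrightarrow> over R (p - q)"
    "over R p \<Longrightarrow> over R (- p)" "c \<in> R \<Longrightarrow> over R (monom c n)" "c \<in> R \<Longrightarrow> over R [:c:]"
    "over R p \<Longrightarrow> c \<in> R \<Longrightarrow> over R (pCons c p)" "over R p \<Longrightarrow> c \<in> R \<Longrightarrow> over R (smult c p)"
  using assms
  by (auto simp: over_def coeff_mult coeff_pCons intro!: csubring_closed csubring_sum split: nat.splits)

lemma over_poly: "csubring R \<Longrightarrow> over R p \<Longrightarrow> x \<in> R \<Longrightarrow> poly p x \<in> R"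
  by (simp add: poly_altdef over_def csubring_closed csubring_sum csubring_power)

text \<open>Long division divides only by the leading coefficient of \<open>q\<close>. The statement
  therefore covers both fields and monic divisors over the integers.\<close>

lemma over_div_mod:
  assumes R: "csubring R" and q: "over R q" "q \<noteq> 0" "inverse (lead_coeff q) \<in> R" and "over R p"
  shows "over R (p div q) \<and> over R (p mod q)"
  using \<open>over R p\<close>
\<comment> \<open>The zero polynomial and nonzero constants both have degree 0; the shifted measure
  tells them apart.\<close>
proof (induction "if p = 0 then 0 else Suc (degree p)" arbitrary: p rule: less_induct)
  case less
  show ?case
  proof (cases "p = 0 \<or> degree p < degree q")
    case True
    then show ?thesis using less.prems over_simps(1)[OF R] by (auto simp: div_poly_less mod_poly_less)
  next
    case False
    define m where "m = monom (lead_coeff p * inverse (lead_coeff q)) (degree p - degree q)"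
    define p' where "p' = p - m * q"
    have m: "over R m" unfolding m_def using R q(3) less.prems
      by (intro over_simps csubring_closed) (auto simp: over_def)
    have p': "over R p'" unfolding p'_def using R m q(1) less.prems by (intro over_simps)
    have lt: "p' = 0 \<or> degree p' < degree p"
    proof (cases "p' = 0")
      case False
      have "m \<noteq> 0" using q(2) \<open>\<not> (p = 0 \<or> _)\<close> by (auto simp: m_def)
      have dm: "degree (m * q) = degree p"
        using q(2) \<open>\<not> (p = 0 \<or> _)\<close> \<open>m \<noteq> 0\<close>
        by (auto simp: m_def degree_mult_eq degree_monom_eq)
      have "lead_coeff (m * q) = lead_coeff p"
        unfolding lead_coeff_mult using q(2) \<open>\<not> (p = 0 \<or> _)\<close> by (simp add: m_def degree_monom_eq)
      have "coeff p' (degree p) = 0" using dm \<open>lead_coeff (m * q) = _\<close> by (simp add: p'_def)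
      moreover have "degree p' \<le> degree p" unfolding p'_def using dm by (intro degree_diff_le) auto
      ultimately show ?thesis using False by (metis le_neq_implies_less leading_coeff_0_iff)
    qed auto
    have "over R (p' div q) \<and> over R (p' mod q)"
      by (rule less.hyps) (use lt p' False in auto)
    moreover have "p = p' + m * q" by (simp add: p'_def)
    then have "p div q = p' div q + m" "p mod q = p' mod q" using q(2) by simp_all
    ultimately show ?thesis using m R by (auto intro: over_simps)
  qed
qed

lemma embedding_props:
  assumes F: "csubfield F" and s: "embedding_on F \<sigma>"
  shows "\<sigma> 0 = 0" "x \<in> F \<Longrightarrow> \<sigma> (- x) = - \<sigma> x" "x \<in> F \<Longrightarrow> \<sigma> x = 0 \<Longrightarrow> x = 0"
    "x \<in> F \<Longrightarrow> \<sigma> (x ^ n) = \<sigma> x ^ n" "x \<in> F \<Longrightarrow> y \<in> F \<Longrightarrow> \<sigma> (x / y) = \<sigma> x / \<sigma> y"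
    "(\<And>i. i \<in> I \<Longrightarrow> f i \<in> F) \<Longrightarrow> \<sigma> (sum f I) = (\<Sum>i\<in>I. \<sigma> (f i))"
proof -
  have R: "csubring F" using F by (simp add: csubfield_def)
  note cl = csubring_closed[OF R]
  have add: "\<sigma> (x + y) = \<sigma> x + \<sigma> y" and mult: "\<sigma> (x * y) = \<sigma> x * \<sigma> y" if "x \<in> F" "y \<in> F" for x y
    using s that by (auto simp: embedding_on_def)
  have one: "\<sigma> 1 = 1" using s by (simp add: embedding_on_def)
  show z: "\<sigma> 0 = 0" using add[OF cl(1,1)] by simp
  show "x \<in> F \<Longrightarrow> \<sigma> (- x) = - \<sigma> x" for x
    using add[of x "-x"] cl(5) z by (simp add: eq_neg_iff_add_eq_0 add.commute)
  show "x \<in> F \<Longrightarrow> \<sigma> x = 0 \<Longrightarrow> x = 0" for x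
    using mult[of x "inverse x"] F one by (cases "x = 0") (auto simp: csubfield_def)
  have inv: "\<sigma> (inverse y) = inverse (\<sigma> y)" if "y \<in> F" for y
    using mult[of y "inverse y"] F one that z
    by (cases "y = 0") (auto simp: csubfield_def inverse_unique[symmetric])
  show "x \<in> F \<Longrightarrow> \<sigma> (x ^ n) = \<sigma> x ^ n" for x
    by (induction n) (auto simp: one mult csubring_power[OF R])
  show "x \<in> F \<Longrightarrow> y \<in> F \<Longrightarrow> \<sigma> (x / y) = \<sigma> x / \<sigma> y" for x y
    using mult[of x "inverse y"] inv F by (auto simp: divide_inverse csubfield_def)
  show "(\<And>i. i \<in> I \<Longrightarrow> f i \<in> F) \<Longrightarrow> \<sigma> (sum f I) = (\<Sum>i\<in>I. \<sigma> (f i))"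
    by (induction I rule: infinite_finite_induct) (auto simp: z add csubring_sum[OF R])
qed

lemma map_poly_embedding:
  assumes F: "csubfield F" and s: "embedding_on F \<sigma>" and "over F p" "over F q"
  shows "map_poly \<sigma> (p + q) = map_poly \<sigma> p + map_poly \<sigma> q"
    "map_poly \<sigma> (p * q) = map_poly \<sigma> p * map_poly \<sigma> q"
    "map_poly \<sigma> (- p) = - map_poly \<sigma> p"
proof -
  have R: "csubring F" using F by (simp add: csubfield_def)
  note z = embedding_props[OF F s]
  have add: "\<sigma> (x + y) = \<sigma> x + \<sigma> y" and mult: "\<sigma> (x * y) = \<sigma> x * \<sigma> y" if "x \<in> F" "y \<in> F" for x y
    using s that by (auto simp: embedding_on_def)
  show "map_poly \<sigma> (p + q) = map_poly \<sigma> p + map_poly \<sigma> q"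
    using assms(3,4) by (intro poly_eqI) (simp add: coeff_map_poly z add over_def)
  show "map_poly \<sigma> (- p) = - map_poly \<sigma> p"
    using assms(3,4) by (intro poly_eqI) (simp add: coeff_map_poly z over_def)
  show "map_poly \<sigma> (p * q) = map_poly \<sigma> p * map_poly \<sigma> q"
    using assms(3,4)
    by (intro poly_eqI) (simp add: coeff_map_poly z coeff_mult mult over_def csubring_closed[OF R])
qed

section \<open>Minimal polynomials and extension of embeddings\<close>

text \<open>Minimality of the degree is the only normalization; the leading coefficient may be any
  nonzero element of \<open>F\<close>.\<close>

definition is_minpoly :: "complex set \<Rightarrow> complex \<Rightarrow> complex poly \<Rightarrow> bool" where
  "is_minpoly F z p \<longleftrightarrow> over F p \<and> p \<noteq> 0 \<and> poly p z = 0 \<and>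
     (\<forall>q. over F q \<and> q \<noteq> 0 \<and> poly q z = 0 \<longrightarrow> degree p \<le> degree q)"

lemma minpoly_exists:
  assumes "over F q" "q \<noteq> 0" "poly q z = 0"
  shows "\<exists>p. is_minpoly F z p"
proof -
  obtain p where "(over F p \<and> p \<noteq> 0 \<and> poly p z = 0) \<and>
      (\<forall>q. over F q \<and> q \<noteq> 0 \<and> poly q z = 0 \<longrightarrow> degree p \<le> degree q)"
    using ex_has_least_nat[of "\<lambda>p. over F p \<and> p \<noteq> 0 \<and> poly p z = 0" q degree] assms by blast
  then show ?thesis by (auto simp: is_minpoly_def)
qed

lemma minpoly_dvd:
  assumes F: "csubfield F" and p: "is_minpoly F z p" and g: "over F g" "poly g z = 0"
  shows "p dvd g"
proof -
  have R: "csubring F" using F by (simp add: csubfield_def)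
  have p': "over F p" "p \<noteq> 0" "poly p z = 0" using p by (auto simp: is_minpoly_def)
  have "over F (g div p) \<and> over F (g mod p)"
    using F p' g R by (intro over_div_mod) (auto simp: csubfield_def over_def)
  moreover have "poly (g mod p) z = 0" using g p' by (simp add: poly_mod)
  ultimately have "g mod p = 0 \<or> degree p \<le> degree (g mod p)" using p by (auto simp: is_minpoly_def)
  then have "g mod p = 0" using degree_mod_less[OF p'(2), of g] by auto
  then show ?thesis by (simp add: dvd_eq_mod_eq_0)
qed

text \<open>Euclid's algorithm on \<open>p\<close> and \<open>g\<close>. When \<open>g\<close> has
  the smaller degree it is replaced by \<open>p mod g\<close>, whose value at \<open>z\<close> is
  minus that of \<open>(p div g) * g\<close>. This value is nonzero: otherwise
  \<open>p mod g\<close> and \<open>p div g\<close>, both of degree less than that of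
  \<open>p\<close>, would vanish at \<open>z\<close> and hence be zero.\<close>

lemma minpoly_invertible:
  assumes F: "csubfield F" and p: "is_minpoly F z p" and g: "over F g" "poly g z \<noteq> 0"
  shows "\<exists>h. over F h \<and> poly h z * poly g z = 1"
  using g
proof (induction "degree g" arbitrary: g rule: less_induct)
  case less
  have R: "csubring F" using F by (simp add: csubfield_def)
  have p': "over F p" "p \<noteq> 0" "poly p z = 0" using p by (auto simp: is_minpoly_def)
  have min: "q = 0" if "over F q" "poly q z = 0" "degree q < degree p" for q
    using p that by (force simp: is_minpoly_def)
  have g0: "g \<noteq> 0" using less.prems by auto
  have dm: "over F (p div g) \<and> over F (p mod g)"
    using F p' g0 less.prems R by (intro over_div_mod) (auto simp: csubfield_def over_def)
  have eq: "poly (p div g) z * poly g z + poly (p mod g) z = 0"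
    using p'(3) by (metis div_mult_mod_eq poly_add poly_mult)
  consider "degree p \<le> degree g" | "degree g = 0" | "0 < degree g" "degree g < degree p" by linarith
  then show ?case
  proof cases
    case 1
    have dm': "over F (g mod p)"
      using over_div_mod[OF R p'(1,2) _ less.prems(1)] F p' by (auto simp: csubfield_def over_def)
    have ev: "poly (g mod p) z = poly g z" using p' by (simp add: poly_mod)
    have "degree p \<noteq> 0"
    proof
      assume "degree p = 0"
      then obtain c where "p = [:c:]" by (metis degree_eq_zeroE)
      then show False using p' by auto
    qed
    then have "degree (g mod p) < degree p" using degree_mod_less'[of p g] p'(2)
      by (cases "g mod p = 0") auto
    then have "\<exists>h. over F h \<and> poly h z * poly (g mod p) z = 1"
      using 1 ev less.prems dm' by (intro less.hyps) auto
    then show ?thesis using ev by simp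
  next
    case 2
    then obtain c where "g = [:c:]" by (metis degree_eq_zeroE)
    then show ?thesis using less.prems F over_simps(8)[OF R, of "inverse c"]
      by (intro exI[of _ "[:inverse c:]"]) (auto simp: over_def csubfield_def coeff_pCons split: nat.splits if_splits)
  next
    case 3
    have dlt: "degree (p mod g) < degree g"
      using 3 degree_mod_less'[OF g0, of p] by (cases "p mod g = 0") auto
    have "poly (p mod g) z \<noteq> 0"
    proof
      assume r0: "poly (p mod g) z = 0"
      then have "p mod g = 0" using dlt 3 dm by (intro min) auto
      moreover have "poly (p div g) z = 0" using eq r0 less.prems by simp
      then have "p div g = 0" using 3 dm by (intro min) (use degree_div_less[of p g] p'(2) in auto)
      ultimately show False using p'(2) by (metis add_0 div_mult_mod_eq mult_zero_left)
    qed
    then obtain h where h: "over F h" "poly h z * poly (p mod g) z = 1"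
      using less.hyps[OF dlt] dm by blast
    have "poly (p mod g) z = - (poly (p div g) z * poly g z)"
      using eq by (simp add: add_eq_0_iff2)
    then have "poly (- (h * (p div g))) z * poly g z = 1" using h(2) by (simp add: algebra_simps)
    then show ?thesis using h(1) dm R by (intro exI[of _ "- (h * (p div g))"]) (auto intro: over_simps)
  qed
qed

text \<open>The values at \<open>z\<close> of polynomials over \<open>F\<close> already form a
  field. Two polynomials with the same value differ by a multiple of \<open>p\<close>, and the
  transported \<open>p\<close> vanishes at \<open>y\<close>, so evaluating the transported
  polynomial at \<open>y\<close> gives a well-defined map.\<close>

lemma embedding_extend:
  assumes F: "csubfield F" and s: "embedding_on F \<sigma>" and p: "is_minpoly F z p"
    and y: "poly (map_poly \<sigma> p) y = 0"
  shows "\<exists>F' \<sigma>'. csubfield F' \<and> embedding_on F' \<sigma>' \<and> F \<subseteq> F' \<and> z \<in> F' \<and> (\<forall>x\<in>F. \<sigma>' x = \<sigma> x) \<and> \<sigma>' z = y"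
proof -
  have R: "csubring F" using F by (simp add: csubfield_def)
  define F' where "F' = {poly g z |g. over F g}"
  \<comment> \<open>\<open>SOME\<close> picks an arbitrary polynomial representing \<open>x\<close>;
    the fact \<open>ev\<close> shows that the choice does not affect the value.\<close>
  define \<sigma>' where "\<sigma>' = (\<lambda>x. poly (map_poly \<sigma> (SOME g. over F g \<and> poly g z = x)) y)"
  note ms = map_poly_embedding[OF F s]
  have ev: "\<sigma>' (poly g z) = poly (map_poly \<sigma> g) y" if g: "over F g" for g
  proof -
    define g' where "g' = (SOME h. over F h \<and> poly h z = poly g z)"
    have g': "over F g'" "poly g' z = poly g z"
      using someI[of "\<lambda>h. over F h \<and> poly h z = poly g z" g] g by (auto simp: g'_def)
    have "over F (g' + (- g))" using g g' R by (auto intro: over_simps)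
    moreover have "poly (g' + (- g)) z = 0" using g' by simp
    ultimately have "p dvd g' + (- g)" by (intro minpoly_dvd[OF F p])
    then obtain d where d: "g' + (- g) = p * d" by auto
    have p': "over F p" "p \<noteq> 0" using p by (auto simp: is_minpoly_def)
    have "over F ((g' + (- g)) div p)"
      using over_div_mod[OF R p' _ \<open>over F (g' + (- g))\<close>] F p' by (auto simp: csubfield_def over_def)
    then have od: "over F d" using d p'(2) by simp
    have "map_poly \<sigma> (g' + (- g)) = map_poly \<sigma> g' - map_poly \<sigma> g"
      using ms(1)[OF g'(1) over_simps(6)[OF R g]] ms(3)[OF g g] by simp
    then have "poly (map_poly \<sigma> g') y - poly (map_poly \<sigma> g) y = poly (map_poly \<sigma> p * map_poly \<sigma> d) y"
      using ms(2)[OF p'(1) od] d by (metis poly_diff)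
    also have "\<dots> = 0" using y by simp
    finally show ?thesis by (simp add: \<sigma>'_def g'_def)
  qed
  have const: "over F [:c:]" if "c \<in> F" for c using R that by (rule over_simps)
  have X: "over F [:0, 1:]" using over_simps(9)[OF R const[OF csubring_closed(2)[OF R]] csubring_closed(1)[OF R]] .
  have mem: "poly g z \<in> F'" if "over F g" for g using that by (auto simp: F'_def)
  have s0: "\<sigma> 0 = 0" "\<sigma> 1 = 1" using embedding_props[OF F s] s by (auto simp: embedding_on_def)
  have F'field: "csubfield F'"
    unfolding csubfield_def csubring_def
  proof (intro conjI ballI)
    show "1 \<in> F'" using mem[OF over_simps(2)[OF R]] by simp
    fix x assume "x \<in> F'"
    then obtain g where g: "over F g" "x = poly g z" by (auto simp: F'_def)
    show "- x \<in> F'" using mem[OF over_simps(6)[OF R g(1)]] g by simp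
    show "inverse x \<in> F'"
    proof (cases "x = 0")
      case True
      then show ?thesis using mem[OF over_simps(1)[OF R]] by simp
    next
      case False
      then obtain h where h: "over F h" "poly h z * poly g z = 1"
        using minpoly_invertible[OF F p g(1)] g by auto
      then show ?thesis using mem[OF h(1)] False g by (metis inverse_unique mult.commute)
    qed
    fix y assume "y \<in> F'"
    then obtain h where h: "over F h" "y = poly h z" by (auto simp: F'_def)
    show "x + y \<in> F'" using mem[OF over_simps(3)[OF R g(1) h(1)]] g h by simp
    show "x * y \<in> F'" using mem[OF over_simps(4)[OF R g(1) h(1)]] g h by simp
  qed
  have emb: "embedding_on F' \<sigma>'"
    unfolding embedding_on_def
  proof (intro conjI ballI)
    show "\<sigma>' 1 = 1" using ev[OF over_simps(2)[OF R]] s0 by (simp add: map_poly_1')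
    fix x y assume "x \<in> F'" "y \<in> F'"
    then obtain g h where gh: "over F g" "x = poly g z" "over F h" "y = poly h z" by (auto simp: F'_def)
    show "\<sigma>' (x + y) = \<sigma>' x + \<sigma>' y"
      using ev[OF gh(1)] ev[OF gh(3)] ev[OF over_simps(3)[OF R gh(1,3)]] ms(1)[OF gh(1,3)] gh by simp
    show "\<sigma>' (x * y) = \<sigma>' x * \<sigma>' y"
      using ev[OF gh(1)] ev[OF gh(3)] ev[OF over_simps(4)[OF R gh(1,3)]] ms(2)[OF gh(1,3)] gh by simp
  qed
  have "F \<subseteq> F'" using mem[OF const] by auto
  moreover have "z \<in> F'" using mem[OF X] by simp
  moreover have "\<sigma>' x = \<sigma> x" if "x \<in> F" for x
    using ev[OF const[OF that]] s0 by (simp add: map_poly_pCons)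
  moreover have "\<sigma>' z = y" using ev[OF X] s0 by (simp add: map_poly_pCons)
  ultimately show ?thesis using F'field emb by blast
qed

text \<open>One element is adjoined at a time, and any root of its transported minimal polynomial
  may serve as its image. A root exists by the fundamental theorem of algebra, since an injective
  map of coefficients keeps the degree positive.\<close>

lemma embedding_extend_finite:
  assumes "finite Z" "csubfield F" "embedding_on F \<sigma>"
    and alg: "\<And>z. z \<in> Z \<Longrightarrow> \<exists>q. over F q \<and> q \<noteq> 0 \<and> poly q z = 0"
  shows "\<exists>F' \<sigma>'. csubfield F' \<and> embedding_on F' \<sigma>' \<and> F \<subseteq> F' \<and> Z \<subseteq> F' \<and> (\<forall>x\<in>F. \<sigma>' x = \<sigma> x)"
  using assms(1,4)
proof (induction Z rule: finite_induct)
  case empty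
  then show ?case using assms(2,3) by blast
next
  case (insert z Z)
  then obtain F1 \<sigma>1 where F1: "csubfield F1" "embedding_on F1 \<sigma>1" "F \<subseteq> F1" "Z \<subseteq> F1" "\<forall>x\<in>F. \<sigma>1 x = \<sigma> x"
    by (metis insertCI)
  obtain q where q: "over F q" "q \<noteq> 0" "poly q z = 0" using insert.prems by blast
  have "over F1 q" using q F1(3) by (auto simp: over_def)
  then obtain p where p: "is_minpoly F1 z p" using minpoly_exists q by blast
  have p': "over F1 p" "p \<noteq> 0" "poly p z = 0" using p by (auto simp: is_minpoly_def)
  have "degree p \<noteq> 0"
  proof
    assume "degree p = 0"
    then obtain c where "p = [:c:]" by (metis degree_eq_zeroE)
    then show False using p' by auto
  qed
  moreover have "degree p \<le> degree (map_poly \<sigma>1 p)"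
  proof (rule le_degree)
    show "coeff (map_poly \<sigma>1 p) (degree p) \<noteq> 0"
      using p' embedding_props(1)[OF F1(1,2)] embedding_props(3)[OF F1(1,2), of "lead_coeff p"]
      by (auto simp: over_def coeff_map_poly)
  qed
  ultimately obtain y where "poly (map_poly \<sigma>1 p) y = 0"
    using fundamental_theorem_of_algebra[of "map_poly \<sigma>1 p"] constant_degree[of "map_poly \<sigma>1 p"] by auto
  from embedding_extend[OF F1(1,2) p this] obtain F' \<sigma>' where
    "csubfield F'" "embedding_on F' \<sigma>'" "F1 \<subseteq> F'" "z \<in> F'" "\<forall>x\<in>F1. \<sigma>' x = \<sigma>1 x" by blast
  then show ?case using F1 by (intro exI[of _ F'] exI[of _ \<sigma>']) auto
qed

lemma embedding_poly:
  assumes F: "csubfield F" and s: "embedding_on F \<sigma>" and q: "over F q" and z: "z \<in> F"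
    and fix_q: "\<And>i. \<sigma> (coeff q i) = coeff q i"
  shows "\<sigma> (poly q z) = poly q (\<sigma> z)"
proof -
  have R: "csubring F" using F by (simp add: csubfield_def)
  have "\<sigma> (coeff q i * z ^ i) = coeff q i * \<sigma> z ^ i" for i
    using s q z fix_q[of i] embedding_props(4)[OF F s z, of i] csubring_power[OF R z, of i]
    by (auto simp: embedding_on_def over_def)
  moreover have "coeff q i * z ^ i \<in> F" for i
    using q z R by (auto simp: over_def intro: csubring_closed csubring_power)
  ultimately show ?thesis by (simp add: poly_altdef embedding_props(6)[OF F s])
qed

lemma minpoly_degree_pos: "is_minpoly F z p \<Longrightarrow> 0 < degree p"
  by (auto simp: is_minpoly_def elim!: degree_eq_zeroE intro!: gr0I)

lemma conjugate_embedding: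
  assumes p: "is_minpoly \<rat> z p" and y: "poly p y = 0"
  shows "\<exists>F \<sigma>. csubfield F \<and> embedding_on F \<sigma> \<and> \<rat> \<subseteq> F \<and> z \<in> F \<and> (\<forall>x\<in>\<rat>. \<sigma> x = x) \<and> \<sigma> z = y"
proof -
  have "embedding_on \<rat> (\<lambda>x. x)" by (simp add: embedding_on_def)
  from embedding_extend[OF csubfield_Rats this p] y show ?thesis by simp
qed

text \<open>Separability. A multiple root \<open>y\<close> is the image of \<open>z\<close> under an
  embedding that fixes the rationals; injectivity carries the vanishing of the derivative at
  \<open>y\<close> back to \<open>z\<close>, which contradicts minimality of the degree.\<close>

lemma minpoly_card_roots:
  assumes p: "is_minpoly \<rat> z p"
  shows "card {y. poly p y = 0} = degree p"
proof -
  have p': "over \<rat> p" "p \<noteq> 0" using p by (auto simp: is_minpoly_def)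
  have sep: "poly (pderiv p) y \<noteq> 0" if y: "poly p y = 0" for y
  proof
    assume y': "poly (pderiv p) y = 0"
    obtain F \<sigma> where F: "csubfield F" "embedding_on F \<sigma>" "\<rat> \<subseteq> F" "z \<in> F" "\<forall>x\<in>\<rat>. \<sigma> x = x" "\<sigma> z = y"
      using conjugate_embedding[OF p y] by blast
    have o: "over \<rat> (pderiv p)" using p'(1) by (auto simp: over_def coeff_pderiv)
    then have oF: "over F (pderiv p)" using F(3) by (auto simp: over_def)
    have "\<sigma> (poly (pderiv p) z) = 0"
      using embedding_poly[OF F(1,2) oF F(4)] o F y' by (simp add: over_def)
    then have "poly (pderiv p) z = 0"
      using embedding_props(3)[OF F(1,2), of "poly (pderiv p) z"] over_poly[OF _ oF F(4)] F(1)
      by (auto simp: csubfield_def)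
    moreover have "pderiv p \<noteq> 0" using minpoly_degree_pos[OF p] by (simp add: pderiv_eq_0_iff)
    ultimately have "degree p \<le> degree (pderiv p)" using p o by (auto simp: is_minpoly_def)
    then show False using minpoly_degree_pos[OF p] by (simp add: degree_pderiv)
  qed
  then have "rsquarefree p" by (auto simp: rsquarefree_roots)
  then have "order y p = 1" if "poly p y = 0" for y using rsquarefree_root_order that p'(2) by blast
  then have "(\<Prod>y | poly p y = 0. [:-y, 1:] ^ order y p) = (\<Prod>y | poly p y = 0. [:-y, 1:])"
    by (intro prod.cong) auto
  then have "p = smult (lead_coeff p) (\<Prod>y | poly p y = 0. [:-y, 1:])"
    using complex_poly_decompose[of p] by simp
  then have "degree p = degree (\<Prod>y | poly p y = 0. [:-y, 1:])"
    using p'(2) by (metis degree_smult_eq leading_coeff_0_iff)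
  also have "\<dots> = card {y. poly p y = 0}" by (subst degree_prod_sum_eq) auto
  finally show ?thesis by simp
qed

section \<open>Kronecker's theorem\<close>

text \<open>By Lagrange interpolation the coefficients of \<open>g\<close> are linear combinations
  of its values, with weights determined by the nodes. Hence one \<open>C\<close> serves all
  \<open>g\<close>.\<close>

lemma coeff_bound_interpolation:
  fixes Y :: "complex set"
  assumes "finite Y"
  shows "\<exists>C. \<forall>g. degree g < card Y \<longrightarrow> (\<forall>y\<in>Y. cmod (poly g y) \<le> 1) \<longrightarrow> (\<forall>i. cmod (coeff g i) \<le> C)"
proof -
  define lg where "lg = (\<lambda>y. \<Prod>x\<in>Y - {y}. [:-x, 1:])"
  define C where "C = (\<Sum>i<card Y. \<Sum>y\<in>Y. cmod (coeff (lg y) i / poly (lg y) y))"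
  have l1: "poly (lg y) y \<noteq> 0" if "y \<in> Y" for y using assms by (auto simp: lg_def poly_prod)
  have l0: "poly (lg y) x = 0" if "y \<in> Y" "x \<in> Y" "x \<noteq> y" for x y
    using assms that by (auto simp: lg_def poly_prod)
  have deg: "degree (lg y) = card Y - 1" if "y \<in> Y" for y
    using assms that by (simp add: lg_def degree_prod_sum_eq)
  have "cmod (coeff g i) \<le> C" if g: "degree g < card Y" "\<forall>y\<in>Y. cmod (poly g y) \<le> 1" for g i
  proof -
    have "g = (\<Sum>y\<in>Y. smult (poly g y / poly (lg y) y) (lg y))"
    proof (rule poly_eqI_degree[of Y])
      fix x assume x: "x \<in> Y"
      have "poly (\<Sum>y\<in>Y. smult (poly g y / poly (lg y) y) (lg y)) x
          = (\<Sum>y\<in>Y. if y = x then poly g x else 0)"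
        unfolding poly_sum using l0 l1 x by (intro sum.cong refl) auto
      then show "poly g x = poly (\<Sum>y\<in>Y. smult (poly g y / poly (lg y) y) (lg y)) x"
        using x assms by simp
    next
      have "degree (\<Sum>y\<in>Y. smult (poly g y / poly (lg y) y) (lg y)) \<le> card Y - 1"
        using deg by (intro degree_sum_le assms) (metis degree_smult_le)
      then show "degree (\<Sum>y\<in>Y. smult (poly g y / poly (lg y) y) (lg y)) < card Y" using g(1) by linarith
    qed (use g in auto)
    then have eq: "coeff g i = (\<Sum>y\<in>Y. poly g y * (coeff (lg y) i / poly (lg y) y))"
      by (metis (no_types, lifting) coeff_smult coeff_sum sum.cong times_divide_eq_left times_divide_eq_right)
    show ?thesis
    proof (cases "i < card Y")
      case True
      have "cmod (coeff g i) \<le> (\<Sum>y\<in>Y. cmod (poly g y * (coeff (lg y) i / poly (lg y) y)))"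
        unfolding eq by (rule norm_sum)
      also have "\<dots> \<le> (\<Sum>y\<in>Y. cmod (coeff (lg y) i / poly (lg y) y))"
        unfolding norm_mult using g(2) by (intro sum_mono mult_left_le_one_le) auto
      also have "\<dots> \<le> C" unfolding C_def using True
        by (intro member_le_sum[of i "{..<card Y}" "\<lambda>i. \<Sum>y\<in>Y. cmod (coeff (lg y) i / poly (lg y) y)"])
           (auto intro: sum_nonneg)
      finally show ?thesis .
    next
      case False
      then have "coeff g i = 0" using g(1) by (intro coeff_eq_0) simp
      then show ?thesis by (auto simp: C_def intro!: sum_nonneg)
    qed
  qed
  then show ?thesis by blast
qed

lemma common_denominator:
  fixes S :: "complex set"
  assumes "finite S" "S \<subseteq> \<rat>"
  shows "\<exists>N>0::nat. \<forall>x\<in>S. of_nat N * x \<in> \<int>"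
  using assms
proof (induction S rule: finite_induct)
  case empty
  then show ?case by auto
next
  case (insert x S)
  then obtain N where N: "N > 0" "\<forall>x\<in>S. of_nat N * x \<in> \<int>" by auto
  obtain a b where ab: "b > 0" "x = of_int a / of_int b"
    using insert.prems by (metis Rats_cases' insert_subset)
  have "of_nat (N * nat b) * x = of_int (int N * a)" using ab by simp
  moreover have "of_nat (N * nat b) * y \<in> \<int>" if "y \<in> S" for y
  proof -
    have "of_nat (N * nat b) * y = of_nat (nat b) * (of_nat N * y)" by simp
    then show ?thesis using N(2) that by (metis Ints_mult Ints_of_nat)
  qed
  ultimately show ?case using N(1) ab(1)
    by (intro exI[of _ "N * nat b"]) (auto simp del: of_nat_mult)
qed

lemma mod_sum_smult: "(\<Sum>i\<in>I. smult (c i) (f i)) mod p = (\<Sum>i\<in>I. smult (c i) (f i mod p))"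
  for p :: "complex poly"
  by (induction I rule: infinite_finite_induct) (auto simp: poly_mod_add_left mod_smult_left)

text \<open>The powers of \<open>z\<close>, reduced modulo its minimal polynomial, have coefficients that are bounded
  (the conjugates lie on the unit circle) and share a denominator, so two of them coincide.\<close>

lemma kronecker_root_of_unity:
  assumes a: "over \<int> a" "lead_coeff a = 1" "poly a z = 0"
    and p: "is_minpoly \<rat> z p" and unit: "\<And>y. poly p y = 0 \<Longrightarrow> cmod y = 1"
  shows "\<exists>n>0. z ^ n = 1"
proof -
  define Y where "Y = {y. poly p y = 0}"
  define d where "d = degree p"
  define D where "D = degree a"
  define g where "g = (\<lambda>n. monom 1 n mod p)"
  have p': "over \<rat> p" "p \<noteq> 0" "poly p z = 0" using p by (auto simp: is_minpoly_def)
  have a0: "a \<noteq> 0" using a(2) by auto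
  have Y: "finite Y" "card Y = d" using p' minpoly_card_roots[OF p] by (auto simp: Y_def d_def poly_roots_finite)
  have dpos: "0 < d" using minpoly_degree_pos[OF p] by (simp add: d_def)
  have "over \<rat> a" using a(1) Ints_subset_Rats by (auto simp: over_def)
  then have "p dvd a" using minpoly_dvd[OF csubfield_Rats p] a by blast
  have D: "0 < D" using \<open>p dvd a\<close> dpos a0 dvd_imp_degree_le[of p a] by (simp add: D_def d_def)
  have gdeg: "degree (g n) < d" for n
    unfolding g_def d_def using degree_mod_less'[OF p'(2), of "monom 1 n"] dpos
    by (cases "monom 1 n mod p = 0") (auto simp: d_def)
  have geval: "poly (g n) y = y ^ n" if "poly p y = 0" for n y
    using that by (simp add: g_def poly_mod poly_monom)
  obtain C where "\<And>g. degree g < card Y \<Longrightarrow> (\<forall>y\<in>Y. cmod (poly g y) \<le> 1) \<Longrightarrow> (\<forall>i. cmod (coeff g i) \<le> C)"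
    using coeff_bound_interpolation[OF Y(1)] by blast
  then have C: "cmod (coeff (g n) i) \<le> C" for n i
    using Y(2) gdeg geval unit by (auto simp: Y_def norm_power)
  have og: "over \<rat> (g n)" for n
    using over_div_mod[of \<rat> p "monom 1 n"] csubfield_Rats p' over_simps(7)[of \<rat> 1 n]
    by (auto simp: csubfield_def g_def over_def)
  \<comment> \<open>Only the first \<open>D\<close> residues need a common denominator. Division by
    the monic integer polynomial \<open>a\<close> leaves an integer remainder of degree less than
    \<open>D\<close>, and \<open>p\<close> divides \<open>a\<close>, so every \<open>g n\<close> is
    an integer combination of \<open>g 0, ..., g (D - 1)\<close>.\<close>
  define S where "S = (\<Union>i<D. (coeff (g i)) ` {..<d})"
  have "finite S" "S \<subseteq> \<rat>" using og by (auto simp: S_def over_def)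
  then obtain N :: nat where N: "N > 0" "\<forall>x\<in>S. of_nat N * x \<in> \<int>" using common_denominator by blast
  have gint: "of_nat N * coeff (g n) i \<in> \<int>" for n i
  proof (cases "i < d")
    case True
    define r where "r = monom 1 n mod a"
    have r: "over \<int> r" unfolding r_def
      using over_div_mod[OF csubring_Ints a(1) a0, of "monom 1 n"] a(2) over_simps(7)[OF csubring_Ints] by auto
    have rdeg: "degree r < D" unfolding r_def D_def
      using degree_mod_less'[OF a0, of "monom 1 n"] D by (cases "monom 1 n mod a = 0") (auto simp: D_def)
    have "r = (\<Sum>i<D. smult (coeff r i) (monom 1 i))"
      using poly_as_sum_of_monoms'[of r "D - 1"] rdeg D
      by (simp add: smult_monom lessThan_Suc_atMost[symmetric])
    then have "r mod p = (\<Sum>i<D. smult (coeff r i) (g i))"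
      using mod_sum_smult[of "coeff r" "\<lambda>i. monom 1 i" "{..<D}" p] by (simp add: g_def)
    moreover have "r mod p = g n" using \<open>p dvd a\<close> by (simp add: r_def g_def mod_mod_cancel)
    ultimately have "coeff (g n) i = (\<Sum>j<D. coeff r j * coeff (g j) i)" by (simp add: coeff_sum)
    then have "of_nat N * coeff (g n) i = (\<Sum>j<D. coeff r j * (of_nat N * coeff (g j) i))"
      by (simp add: sum_distrib_left mult_ac)
    also have "\<dots> \<in> \<int>"
    proof (rule Ints_sum)
      fix j assume "j \<in> {..<D}"
      then have "of_nat N * coeff (g j) i \<in> \<int>" using N(2) True by (auto simp: S_def)
      then show "coeff r j * (of_nat N * coeff (g j) i) \<in> \<int>" 
        using Ints_mult[of "coeff r j" "of_nat N * coeff (g j) i"] r by (simp add: over_def)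
    qed
    finally show ?thesis .
  next
    case False
    then have "coeff (g n) i = 0" using gdeg[of n] by (intro coeff_eq_0) simp
    then show ?thesis by simp
  qed
  define K where "K = {x \<in> \<int>. cmod x \<le> real N * C}"
  have "finite K"
  proof (rule finite_subset)
    show "K \<subseteq> of_int ` {- \<lceil>real N * C\<rceil>..\<lceil>real N * C\<rceil>}"
    proof
      fix x assume "x \<in> K"
      then obtain k :: int where "x = of_int k" "cmod x \<le> real N * C" by (auto simp: K_def elim: Ints_cases)
      then show "x \<in> of_int ` {- \<lceil>real N * C\<rceil>..\<lceil>real N * C\<rceil>}" by (auto intro!: imageI) linarith+
    qed
  qed auto
  have "range (\<lambda>n. smult (of_nat N) (g n)) \<subseteq> Poly ` {xs. set xs \<subseteq> K \<and> length xs \<le> d}"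
  proof safe
    fix n
    let ?q = "smult (of_nat N) (g n)"
    have "set (coeffs ?q) \<subseteq> K"
      using gint C N by (auto simp: K_def coeffs_def norm_mult mult_left_mono)
    moreover have "length (coeffs ?q) \<le> d"
      using gdeg[of n] N(1) by (auto simp: length_coeffs coeffs_def)
    ultimately show "?q \<in> Poly ` {xs. set xs \<subseteq> K \<and> length xs \<le> d}"
      by (intro image_eqI[of _ _ "coeffs ?q"]) auto
  qed
  then have "finite (range (\<lambda>n. smult (of_nat N) (g n)))"
    using finite_lists_length_le[OF \<open>finite K\<close>, of d] finite_surj by blast
  then have "\<not> inj (\<lambda>n. smult (of_nat N) (g n))" using finite_imageD by fastforce
  then obtain m n where "m < n" and eqs: "smult (of_nat N) (g m) = smult (of_nat N) (g n)"
    by (auto simp: inj_def) (metis linorder_neqE_nat)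
  have "smult (inverse (of_nat N)) (smult (of_nat N) (g m)) = smult (inverse (of_nat N)) (smult (of_nat N) (g n))"
    by (simp only: eqs)
  then have "g m = g n" using N(1) by (simp add: smult_smult)
  then have "z ^ m = z ^ n" using geval[OF p'(3)] by metis
  moreover have "z \<noteq> 0" using unit[OF p'(3)] by auto
  ultimately have "z ^ (n - m) = 1" using \<open>m < n\<close> by (simp add: power_diff)
  then show ?thesis using \<open>m < n\<close> by (intro exI[of _ "n - m"]) auto
qed

text \<open>Compared with \<open>1 \<in> Z\<close>, every other element is a root of the sum of the
  monomials with exponents in \<open>A\<close>, a monic integer polynomial. An embedding sending
  \<open>z\<close> to a given conjugate is extended to all of \<open>Z\<close>, because equality of
  moduli draws on the relations between all pairs. The common modulus is then read off at
  \<open>\<tau> 1 = 1\<close>.\<close>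

theorem finite_spectrum_roots_of_unity:
  fixes A :: "nat set" and Z :: "complex set"
  assumes "finite A" "0 \<in> A" "finite Z" "card A \<le> card Z" "1 \<in> Z" "0 \<notin> Z"
    and orth: "\<And>x y. x \<in> Z \<Longrightarrow> y \<in> Z \<Longrightarrow> x \<noteq> y \<Longrightarrow> (\<Sum>a\<in>A. (x / y) ^ a) = 0"
    and "z \<in> Z"
  shows "\<exists>n>0. z ^ n = 1"
proof (cases "z = 1")
  case False
  define a where "a = (\<Sum>k\<in>A. monom (1::complex) k)"
  have ca: "coeff a i = (if i \<in> A then 1 else 0)" for i
    using assms(1) by (simp add: a_def coeff_sum)
  have a0: "a \<noteq> 0" using ca[of 0] assms(2) by auto
  have lc: "lead_coeff a = 1" using ca[of "degree a"] a0 by (auto split: if_splits)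
  have oa: "over \<int> a" using ca by (simp add: over_def)
  have ra: "poly a x = 0" if "x \<in> Z" "x \<noteq> 1" for x
    using orth[OF that(1) assms(5) that(2)] by (simp add: a_def poly_sum poly_monom)
  have alg: "\<exists>q. over \<rat> q \<and> q \<noteq> 0 \<and> poly q x = 0" if "x \<in> Z" for x
  proof (cases "x = 1")
    case True
    have "over \<rat> [:-1, 1:]" by (auto simp: over_def coeff_pCons split: nat.splits)
    then show ?thesis using True by (intro exI[of _ "[:-1, 1:]"]) auto
  next
    case False
    then show ?thesis using ra[OF that] a0 oa Ints_subset_Rats by (auto simp: over_def)
  qed
  obtain p where p: "is_minpoly \<rat> z p" using alg[OF assms(8)] minpoly_exists by blast
  have "cmod y = 1" if y: "poly p y = 0" for y
  proof -
    obtain F \<sigma> where F: "csubfield F" "embedding_on F \<sigma>" "\<rat> \<subseteq> F" "z \<in> F" "\<sigma> z = y"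
      using conjugate_embedding[OF p y] by blast
    have "\<exists>q. over F q \<and> q \<noteq> 0 \<and> poly q x = 0" if "x \<in> Z" for x
      using alg[OF that] F(3) by (auto simp: over_def)
    from embedding_extend_finite[OF assms(3) F(1,2) this] obtain F' \<tau> where
      F': "csubfield F'" "embedding_on F' \<tau>" "F \<subseteq> F'" "Z \<subseteq> F'" "\<forall>x\<in>F. \<tau> x = \<sigma> x" by blast
    have R: "csubring F'" using F' by (simp add: csubfield_def)
    note t = embedding_props[OF F'(1,2)]
    have "cmod (\<tau> z) = cmod (\<tau> 1)"
    proof (rule equal_moduli[of Z A \<tau>])
      show "\<tau> j \<noteq> 0" if "j \<in> Z" for j using t(3)[of j] that F'(4) assms(6) by auto
      show "(\<Sum>a\<in>A. (\<tau> j / \<tau> k) ^ a) = 0" if jk: "j \<in> Z" "k \<in> Z" "j \<noteq> k" for j k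
      proof -
        have jkF: "j \<in> F'" "k \<in> F'" using jk F'(4) by auto
        then have "j / k \<in> F'" using F'(1) csubring_closed(4)[OF R] by (auto simp: csubfield_def divide_inverse)
        then have "\<tau> (\<Sum>a\<in>A. (j / k) ^ a) = (\<Sum>a\<in>A. (\<tau> j / \<tau> k) ^ a)"
          using t(6)[of A "\<lambda>a. (j / k) ^ a"] t(4,5) jkF csubring_power[OF R] by simp
        then show ?thesis using orth[OF jk] t(1) by simp
      qed
    qed (use assms in auto)
    then show ?thesis using F'(2,5) F(4,5) by (simp add: embedding_on_def)
  qed
  then show ?thesis using kronecker_root_of_unity[OF oa lc _ p] ra[OF assms(8) False] by blast
qed auto

section \<open>Exponential sums against the Poisson measure\<close>

text \<open>Cauchy's inequality on discs of radius \<open>r\<close> bounds the derivatives in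
  \<open>z\<close>, and therefore the difference quotients, by \<open>B / r\<close> uniformly in
  \<open>x\<close>. Dominated convergence then differentiates under the integral.\<close>

lemma holomorphic_on_integral:
  fixes f :: "complex \<Rightarrow> 'a \<Rightarrow> complex"
  assumes "finite_measure M" "open S"
    and hol: "\<And>x. x \<in> space M \<Longrightarrow> (\<lambda>z. f z x) holomorphic_on S"
    and meas: "\<And>z. z \<in> S \<Longrightarrow> f z \<in> borel_measurable M"
    and bound: "\<And>z x. z \<in> S \<Longrightarrow> x \<in> space M \<Longrightarrow> cmod (f z x) \<le> B"
  shows "(\<lambda>z. LINT x|M. f z x) holomorphic_on S"
proof -
  interpret finite_measure M by fact
  have int: "integrable M (f z)" if "z \<in> S" for z
    using that meas bound by (intro integrable_const_bound[where B = B]) auto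
  have "\<exists>D. ((\<lambda>z. LINT x|M. f z x) has_field_derivative D) (at z0)" if z0: "z0 \<in> S" for z0
  proof -
    obtain e where e: "e > 0" "cball z0 e \<subseteq> S" using assms(2) z0 open_contains_cball by blast
    \<comment> \<open>Half of \<open>e\<close>, so that closed discs of radius \<open>r\<close>
      around points of \<open>ball z0 r\<close> still lie in \<open>S\<close>.\<close>
    define r where "r = e / 2"
    have r: "r > 0" using e by (simp add: r_def)
    have sub: "cball z r \<subseteq> S" if "z \<in> ball z0 r" for z
    proof
      fix w assume "w \<in> cball z r"
      then have "dist z0 w \<le> e" using that dist_triangle[of z0 w z] by (simp add: r_def)
      then show "w \<in> S" using e(2) by auto
    qed
    have lip: "cmod (f z x - f z0 x) \<le> B / r * cmod (z - z0)" if z: "z \<in> ball z0 r" and x: "x \<in> space M" for z x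
    proof (rule field_differentiable_bound[of "ball z0 r"])
      fix w assume w: "w \<in> ball z0 r"
      have wS: "w \<in> S" using sub[OF w] r by auto
      show "((\<lambda>z. f z x) has_field_derivative deriv (\<lambda>z. f z x) w) (at w within ball z0 r)"
        using hol[OF x] assms(2) wS by (auto intro: holomorphic_derivI)
      have "cmod ((deriv ^^ 1) (\<lambda>z. f z x) w) \<le> fact 1 * B / r ^ 1"
      proof (rule Cauchy_inequality)
        show "(\<lambda>z. f z x) holomorphic_on ball w r"
          using hol[OF x] sub[OF w] ball_subset_cball holomorphic_on_subset by blast
        show "continuous_on (cball w r) (\<lambda>z. f z x)"
          using hol[OF x] sub[OF w] holomorphic_on_imp_continuous_on continuous_on_subset by blast
        show "cmod (f v x) \<le> B" if "cmod (w - v) = r" for v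
        proof -
          have "v \<in> cball w r" using that by (simp add: dist_norm)
          then show ?thesis using bound[OF _ x] sub[OF w] by blast
        qed
      qed (use r in auto)
      then show "cmod (deriv (\<lambda>z. f z x) w) \<le> B / r" by simp
    qed (use z r in auto)
    define D where "D = (LINT x|M. deriv (\<lambda>z. f z x) z0)"
    have "((\<lambda>z. ((LINT x|M. f z x) - (LINT x|M. f z0 x)) / (z - z0)) \<longlongrightarrow> D) (at z0)"
      unfolding tendsto_at_iff_sequentially comp_def
    proof (intro allI impI)
      fix X :: "nat \<Rightarrow> complex" assume X: "\<forall>i. X i \<in> UNIV - {z0}" "X \<longlonglongrightarrow> z0"
      then obtain n0 where n0: "\<And>n. n \<ge> n0 \<Longrightarrow> X n \<in> ball z0 r"
        using r by (metis lim_sequentially mem_ball dist_commute)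
      define q where "q = (\<lambda>n x. (f (X (n + n0)) x - f z0 x) / (X (n + n0) - z0))"
      have XS: "X (n + n0) \<in> S" for n using n0[of "n + n0"] sub[of "X (n + n0)"] r by auto
      have lim: "(\<lambda>n. q n x) \<longlonglongrightarrow> deriv (\<lambda>z. f z x) z0" if x: "x \<in> space M" for x
      proof -
        have "((\<lambda>z. f z x) has_field_derivative deriv (\<lambda>z. f z x) z0) (at z0)"
          using hol[OF x] assms(2) z0 by (auto intro: holomorphic_derivI)
        then have "(\<lambda>n. (f (X n) x - f z0 x) / (X n - z0)) \<longlonglongrightarrow> deriv (\<lambda>z. f z x) z0"
          using X unfolding has_field_derivative_iff tendsto_at_iff_sequentially comp_def by blast
        from LIMSEQ_ignore_initial_segment[OF this, of n0] show ?thesis by (simp add: q_def)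
      qed
      have qm: "q n \<in> borel_measurable M" for n
        unfolding q_def using meas XS z0 by (intro borel_measurable_divide borel_measurable_diff) auto
      have "(\<lambda>n. LINT x|M. q n x) \<longlonglongrightarrow> D"
        unfolding D_def
      proof (rule integral_dominated_convergence[where w = "\<lambda>_. B / r"])
        show "(\<lambda>x. deriv (\<lambda>z. f z x) z0) \<in> borel_measurable M"
          using lim qm by (rule borel_measurable_LIMSEQ_metric[rotated])
        show "AE x in M. norm (q n x) \<le> B / r" for n
        proof (rule AE_I2)
          fix x assume "x \<in> space M"
          from lip[OF n0[of "n + n0"] this] show "norm (q n x) \<le> B / r"
            using X(1) by (simp add: q_def norm_divide divide_le_eq)
        qed
      qed (use qm lim in auto)
      moreover have "(LINT x|M. q n x) = ((LINT x|M. f (X (n + n0)) x) - (LINT x|M. f z0 x)) / (X (n + n0) - z0)" for n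
        using int[OF XS[of n]] int[OF z0] by (simp add: q_def)
      ultimately have "(\<lambda>n. ((LINT x|M. f (X (n + n0)) x) - (LINT x|M. f z0 x)) / (X (n + n0) - z0)) \<longlonglongrightarrow> D"
        by simp
      then show "(\<lambda>n. ((LINT x|M. f (X n) x) - (LINT x|M. f z0 x)) / (X n - z0)) \<longlonglongrightarrow> D"
        by (rule LIMSEQ_offset)
    qed
    then show ?thesis by (auto simp: has_field_derivative_iff)
  qed
  then show ?thesis
    using assms(2) by (simp add: holomorphic_on_open)
qed

section \<open>The Cayley map and the mean value property at \<i>\<close>

text \<open>This is minus the cotangent of \<open>pi * t\<close>, the image of
  \<open>exp (2 \<pi> \<i> t)\<close> under the Cayley map
  \<open>w \<mapsto> \<i> (1 + w) / (1 - w)\<close>. It maps the open unit interval onto the real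
  line and carries Lebesgue measure to the Poisson measure of the point \<i>, with density
  \<open>1 / (\<pi> (1 + x\<^sup>2))\<close>. Integrals against that measure are therefore written
  over \<open>{0<..<1}\<close>.\<close>

definition cay :: "real \<Rightarrow> real" where "cay t = tan (pi * t - pi / 2)"

lemma cay_cos: "0 < t \<Longrightarrow> t < 1 \<Longrightarrow> 0 < cos (pi * t - pi / 2)"
  by (rule cos_gt_zero_pi) (auto simp: field_simps)

lemma cay_deriv:
  assumes "0 < t" "t < 1"
  shows "(cay has_field_derivative pi * (1 + (cay t)\<^sup>2)) (at t within S)"
proof -
  have "cos (pi * t - pi / 2) \<noteq> 0" using cay_cos[OF assms] by simp
  then have "((\<lambda>t. tan (pi * t - pi / 2)) has_field_derivative (inverse ((cos (pi * t - pi / 2))\<^sup>2) * pi)) (at t)"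
    by (auto intro!: derivative_eq_intros)
  then have "(cay has_field_derivative pi * (1 + (cay t)\<^sup>2)) (at t)"
    using tan_sec[OF \<open>cos _ \<noteq> 0\<close>] by (simp add: cay_def[abs_def] mult.commute power_inverse)
  then show ?thesis by (rule has_field_derivative_at_within)
qed

lemma cay_continuous: "continuous_on {0<..<1} cay"
  by (rule DERIV_continuous_on) (use cay_deriv in auto)

lemma cay_arctan: "0 < t \<Longrightarrow> t < 1 \<Longrightarrow> arctan (cay t) = pi * t - pi / 2"
  unfolding cay_def by (rule arctan_tan) (auto simp: field_simps)

lemma cay_inj: "inj_on cay {0<..<1}"
  by (rule inj_onI) (metis cay_arctan add_diff_cancel_right' diff_add_cancel greaterThanLessThan_iff mult_cancel_left pi_neq_zero)

lemma cay_surj: "\<exists>t\<in>{0<..<1}. cay t = x"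
proof
  show "cay (1/2 + arctan x / pi) = x" by (simp add: cay_def algebra_simps tan_arctan)
  show "1/2 + arctan x / pi \<in> {0<..<1}" using arctan_bounded[of x] by (auto simp: field_simps)
qed

lemma cay_eq:
  assumes "0 < t" "t < 1"
  defines "w \<equiv> exp (2 * of_real pi * \<i> * of_real t)"
  shows "w \<noteq> 1" "\<i> * (1 + w) / (1 - w) = complex_of_real (cay t)"
proof -
  define v where "v = exp (of_real pi * \<i> * of_real t)"
  have v: "v \<noteq> 0" "w = v * v" by (simp_all add: v_def w_def exp_add[symmetric] mult_ac)
  have arg: "of_real pi * \<i> * of_real t = \<i> * complex_of_real (pi * t)" by simp
  have vc: "v = of_real (cos (pi * t)) + \<i> * of_real (sin (pi * t))"
    unfolding v_def arg exp_Euler cos_of_real sin_of_real ..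
  have "inverse v = exp (\<i> * (- complex_of_real (pi * t)))"
    unfolding v_def arg by (simp add: exp_minus)
  then have vc': "inverse v = of_real (cos (pi * t)) - \<i> * of_real (sin (pi * t))"
    unfolding exp_Euler cos_minus sin_minus cos_of_real sin_of_real by simp
  have s: "sin (pi * t) > 0" using assms by (intro sin_gt_zero) auto
  have c1: "cay t = - (cos (pi * t) / sin (pi * t))"
    by (simp add: cay_def tan_def sin_diff cos_diff)
  have vv: "v + inverse v = 2 * of_real (cos (pi * t))" "inverse v - v = - 2 * \<i> * of_real (sin (pi * t))"
    unfolding vc' by (simp_all add: vc)
  have "inverse v - v \<noteq> 0" using s vv(2) by simp
  then show "w \<noteq> 1" using v by (auto simp: field_simps)
  have "v + inverse v = (1 + v * v) / v" "inverse v - v = (1 - v * v) / v"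
    using v(1) by (simp_all add: divide_simps)
  then have "\<i> * (1 + w) / (1 - w) = \<i> * (v + inverse v) / (inverse v - v)"
    using v(1) unfolding v(2) by (simp only:) simp
  also have "\<dots> = of_real (cay t)"
    unfolding vv c1 using s by (simp add: field_simps)
  finally show "\<i> * (1 + w) / (1 - w) = complex_of_real (cay t)" .
qed

lemma Im_cayley:
  assumes "cmod w \<le> 1" "w \<noteq> 1"
  shows "Im (\<i> * (1 + w) / (1 - w)) \<ge> 0"
proof -
  have "Im (\<i> * (1 + w) / (1 - w)) = Re ((1 + w) / (1 - w))" by (metis Im_i_times times_divide_eq_right)
  also have "\<dots> = (1 - (cmod w)\<^sup>2) / (cmod (1 - w))\<^sup>2"
    unfolding cmod_power2 by (simp add: Re_divide power2_eq_square algebra_simps)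
  also have "\<dots> \<ge> 0" using assms by (simp add: power_le_one)
  finally show ?thesis .
qed

text \<open>Cauchy's formula at the centre of circles of radius less than 1, transported by the
  Cayley map, which sends \<open>0\<close> to \<i>. As the radius tends to 1, boundedness of \<Phi>
  gives dominated convergence. Holomorphy slightly below the real axis makes \<Phi> continuous at
  all boundary points except the one corresponding to infinity.\<close>

lemma poisson_mean_value:
  assumes "\<eta> > 0" and hol: "\<Phi> holomorphic_on {z. - \<eta> < Im z}"
    and bound: "\<And>z. - \<eta> < Im z \<Longrightarrow> cmod (\<Phi> z) \<le> B"
  shows "((\<lambda>t. \<Phi> (of_real (cay t))) has_integral \<Phi> \<i>) {0<..<1}"
proof -
  define \<psi> where "\<psi> = (\<lambda>w. \<i> * (1 + w) / (1 - w))"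
  define e where "e = (\<lambda>t::real. exp (2 * of_real pi * \<i> * of_real t))"
  \<comment> \<open>\<open>n + 2\<close> makes the radius positive already for
    \<open>n = 0\<close>.\<close>
  define r where "r = (\<lambda>n. 1 - 1 / real (n + 2))"
  have r: "0 < r n" "r n < 1" for n by (auto simp: r_def)
  have rlim: "r \<longlonglongrightarrow> 1" unfolding r_def by real_asymp
  have psi: "- \<eta> < Im (\<psi> w)" if "cmod w \<le> 1" "w \<noteq> 1" for w
    using Im_cayley[OF that] assms(1) unfolding \<psi>_def by linarith
  have op: "open {z. - \<eta> < Im z}" by (simp add: open_halfspace_Im_gt)
  have gh: "(\<lambda>w. \<Phi> (\<psi> w)) holomorphic_on cball 0 (r n)" for n
  proof (rule holomorphic_on_compose_gen[OF _ hol, unfolded comp_def])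
    have ne: "w \<noteq> 1" if "w \<in> cball 0 (r n)" for w :: complex using that r[of n] by (auto simp: dist_norm)
    then show "\<psi> holomorphic_on cball 0 (r n)"
      unfolding \<psi>_def by (intro holomorphic_intros) (auto simp: )
    show "\<psi> ` cball 0 (r n) \<subseteq> {z. - \<eta> < Im z}"
      using psi ne r[of n] by fastforce
  qed
  have en: "cmod (e t) = 1" for t by (simp add: e_def norm_exp)
  have circ: "((\<lambda>t. \<Phi> (\<psi> (r n * e t))) has_integral \<Phi> \<i>) {0<..<1}" for n
  proof -
    have "((\<lambda>u. \<Phi> (\<psi> u) / (u - 0)) has_contour_integral (2 * of_real pi * \<i> * \<Phi> (\<psi> 0))) (circlepath 0 (r n))"
      using gh r by (intro Cauchy_integral_circlepath_simple) auto
    then have "((\<lambda>t. \<Phi> (\<psi> (r n * e t)) / (r n * e t) * (2 * pi * \<i> * r n * e t)) has_integral (2 * of_real pi * \<i> * \<Phi> (\<psi> 0))) {0..1}"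
      unfolding has_contour_integral vector_derivative_circlepath by (simp add: circlepath e_def)
    moreover have "\<Phi> (\<psi> (r n * e t)) / (r n * e t) * (2 * pi * \<i> * r n * e t) = (2 * of_real pi * \<i>) * \<Phi> (\<psi> (r n * e t))" for t
      using r[of n] by (simp add: e_def)
    ultimately have "((\<lambda>t. (2 * of_real pi * \<i>) * \<Phi> (\<psi> (r n * e t))) has_integral (2 * of_real pi * \<i> * \<Phi> (\<psi> 0))) {0..1}"
      by simp
    then have "((\<lambda>t. \<Phi> (\<psi> (r n * e t))) has_integral \<Phi> (\<psi> 0)) {0..1}"
      using has_integral_mult_right[of _ _ "{0..1}" "1 / (2 * of_real pi * \<i>)"] by fastforce
    moreover have "\<psi> 0 = \<i>" by (simp add: \<psi>_def)
    ultimately show ?thesis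
      using has_integral_Icc_iff_Ioo by metis
  qed
  have lim: "(\<lambda>n. \<Phi> (\<psi> (r n * e t))) \<longlonglongrightarrow> \<Phi> (of_real (cay t))" if t: "t \<in> {0<..<1}" for t
  proof -
    have e1: "e t \<noteq> 1" "\<psi> (e t) = of_real (cay t)" using cay_eq[of t] t by (auto simp: e_def \<psi>_def)
    have "(\<lambda>n. complex_of_real (r n) * e t) \<longlonglongrightarrow> of_real 1 * e t"
      by (intro tendsto_intros rlim)
    then have "(\<lambda>n. \<psi> (r n * e t)) \<longlonglongrightarrow> \<psi> (e t)"
      unfolding \<psi>_def using e1(1) by (intro tendsto_intros) auto
    moreover have "isCont \<Phi> (\<psi> (e t))"
      using holomorphic_on_imp_continuous_on[OF hol] op psi[of "e t"] en e1
      by (auto simp: continuous_on_eq_continuous_at)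
    ultimately show ?thesis using e1(2) by (metis isCont_tendsto_compose)
  qed
  have "(\<lambda>t. \<Phi> (of_real (cay t))) integrable_on {0<..<1} \<and>
     (\<lambda>n. integral {0<..<1} (\<lambda>t. \<Phi> (\<psi> (r n * e t)))) \<longlonglongrightarrow> integral {0<..<1} (\<lambda>t. \<Phi> (of_real (cay t)))"
  proof (rule conjI)
    note dc = dominated_convergence[where f = "\<lambda>n t. \<Phi> (\<psi> (r n * e t))" and h = "\<lambda>_. B" and S = "{0<..<1}"
        and g = "\<lambda>t. \<Phi> (of_real (cay t))"]
    have i: "(\<lambda>t. \<Phi> (\<psi> (r n * e t))) integrable_on {0<..<1}" for n using circ by blast
    have h: "(\<lambda>_. B) integrable_on {0<..<1::real}"
      unfolding integrable_on_open_interval_real by (intro integrable_continuous_real continuous_on_const)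
    have b: "cmod (\<Phi> (\<psi> (r n * e t))) \<le> B" for n t
    proof (rule bound, rule psi)
      show "cmod (r n * e t) \<le> 1" using r[of n] en by (simp add: norm_mult)
      show "r n * e t \<noteq> 1" using r[of n] en[of t] by (metis abs_of_pos less_irrefl mult.right_neutral norm_mult norm_of_real norm_one)
    qed
    show "(\<lambda>t. \<Phi> (of_real (cay t))) integrable_on {0<..<1}" using i h b lim by (intro dc) auto
    show "(\<lambda>n. integral {0<..<1} (\<lambda>t. \<Phi> (\<psi> (r n * e t)))) \<longlonglongrightarrow> integral {0<..<1} (\<lambda>t. \<Phi> (of_real (cay t)))"
      using i h b lim by (intro dc) auto
  qed
  moreover have "integral {0<..<1} (\<lambda>t. \<Phi> (\<psi> (r n * e t))) = \<Phi> \<i>" for n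
    using circ by (rule integral_unique)
  ultimately have int: "(\<lambda>t. \<Phi> (of_real (cay t))) integrable_on {0<..<1}"
    and "(\<lambda>n::nat. \<Phi> \<i>) \<longlonglongrightarrow> integral {0<..<1} (\<lambda>t. \<Phi> (of_real (cay t)))"
    by simp_all
  then have "\<Phi> \<i> = integral {0<..<1} (\<lambda>t. \<Phi> (of_real (cay t)))"
    by (simp add: LIMSEQ_const_iff)
  then show ?thesis using integrable_integral[OF int] by simp
qed

section \<open>Sums over separated frequencies\<close>

definition separated :: "real \<Rightarrow> real set \<Rightarrow> bool" where
  "separated \<delta> K \<longleftrightarrow> (\<forall>x\<in>K. \<forall>y\<in>K. x \<noteq> y \<longrightarrow> \<delta> \<le> \<bar>x - y\<bar>)"

lemma separated_subset: "separated \<delta> K \<Longrightarrow> K' \<subseteq> K \<Longrightarrow> separated \<delta> K'"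
  by (auto simp: separated_def)

text \<open>Nonnegative points at mutual distance at least 1 have distinct integer parts, so no term
  of the series is used twice.\<close>

lemma separated_sum_nonneg:
  fixes h :: "nat \<Rightarrow> real"
  assumes "finite K" "separated 1 K" "\<And>n. 0 \<le> h n" "summable h" "\<And>x. x \<in> K \<Longrightarrow> 0 \<le> x"
  shows "(\<Sum>x\<in>K. h (nat \<lfloor>x\<rfloor>)) \<le> suminf h"
proof -
  have "inj_on (\<lambda>x. nat \<lfloor>x\<rfloor>) K"
  proof (rule inj_onI, rule ccontr)
    fix x y assume xy: "x \<in> K" "y \<in> K" "nat \<lfloor>x\<rfloor> = nat \<lfloor>y\<rfloor>" "x \<noteq> y"
    then have "\<lfloor>x\<rfloor> = \<lfloor>y\<rfloor>" using assms(5) by (metis eq_nat_nat_iff zero_le_floor)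
    then have "\<bar>x - y\<bar> < 1" by linarith
    moreover have "1 \<le> \<bar>x - y\<bar>" using assms(2) xy(1,2,4) unfolding separated_def by blast
    ultimately show False by linarith
  qed
  then have "(\<Sum>x\<in>K. h (nat \<lfloor>x\<rfloor>)) = (\<Sum>n\<in>(\<lambda>x. nat \<lfloor>x\<rfloor>) ` K. h n)"
    by (simp add: sum.reindex)
  also have "\<dots> \<le> suminf h" using assms by (intro sum_le_suminf) auto
  finally show ?thesis .
qed

lemma separated_sum:
  fixes h :: "nat \<Rightarrow> real"
  assumes "finite K" "separated 1 K" "\<And>n. 0 \<le> h n" "summable h"
  shows "(\<Sum>x\<in>K. h (nat \<lfloor>\<bar>x - y\<bar>\<rfloor>)) \<le> 2 * suminf h"
proof -
  let ?K1 = "{x\<in>K. y \<le> x}" and ?K2 = "{x\<in>K. x < y}"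
  have "(\<Sum>x\<in>?K1. h (nat \<lfloor>\<bar>x - y\<bar>\<rfloor>)) = (\<Sum>u\<in>(\<lambda>x. x - y) ` ?K1. h (nat \<lfloor>u\<rfloor>))"
    by (subst sum.reindex) (auto simp: inj_on_def)
  also have "\<dots> \<le> suminf h"
    using assms by (intro separated_sum_nonneg) (auto simp: separated_def)
  finally have 1: "(\<Sum>x\<in>?K1. h (nat \<lfloor>\<bar>x - y\<bar>\<rfloor>)) \<le> suminf h" .
  have "(\<Sum>x\<in>?K2. h (nat \<lfloor>\<bar>x - y\<bar>\<rfloor>)) = (\<Sum>u\<in>(\<lambda>x. y - x) ` ?K2. h (nat \<lfloor>u\<rfloor>))"
    by (subst sum.reindex) (auto simp: inj_on_def)
  also have "\<dots> \<le> suminf h"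
    using assms by (intro separated_sum_nonneg) (auto simp: separated_def abs_minus_commute)
  finally have 2: "(\<Sum>x\<in>?K2. h (nat \<lfloor>\<bar>x - y\<bar>\<rfloor>)) \<le> suminf h" .
  have "(\<Sum>x\<in>K. h (nat \<lfloor>\<bar>x - y\<bar>\<rfloor>)) = (\<Sum>x\<in>?K1 \<union> ?K2. h (nat \<lfloor>\<bar>x - y\<bar>\<rfloor>))"
    by (rule sum.cong) auto
  also have "\<dots> = (\<Sum>x\<in>?K1. h (nat \<lfloor>\<bar>x - y\<bar>\<rfloor>)) + (\<Sum>x\<in>?K2. h (nat \<lfloor>\<bar>x - y\<bar>\<rfloor>))"
    by (rule sum.union_disjoint) (use assms(1) in auto)
  finally have "(\<Sum>x\<in>K. h (nat \<lfloor>\<bar>x - y\<bar>\<rfloor>)) = (\<Sum>x\<in>?K1. h (nat \<lfloor>\<bar>x - y\<bar>\<rfloor>)) + (\<Sum>x\<in>?K2. h (nat \<lfloor>\<bar>x - y\<bar>\<rfloor>))" .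
  with 1 2 show ?thesis by simp
qed

text \<open>The bound \<open>4\<close> is twice the sum of the geometric series with ratio \<open>exp (- 1) \<le> 1 / 2\<close>.\<close>

lemma summable_exp_neg: "summable (\<lambda>n::nat. exp (- real n))" "(\<Sum>n::nat. exp (- real n)) \<le> 2"
proof -
  have e: "exp (- 1 :: real) \<le> 1 / 2"
    using exp_ge_add_one_self[of 1] by (simp add: exp_minus field_simps)
  have eq: "(\<lambda>n::nat. exp (- real n)) = (\<lambda>n. exp (- 1) ^ n)"
    by (auto simp: exp_of_nat_mult[symmetric])
  have "norm (exp (- 1 :: real)) < 1" using e by simp
  note g = geometric_sums[OF this]
  show "summable (\<lambda>n::nat. exp (- real n))" unfolding eq using g sums_summable by blast
  have "(\<Sum>n::nat. exp (- real n)) = 1 / (1 - exp (- 1))" unfolding eq using g sums_unique by metis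
  also have "\<dots> \<le> 1 / (1 / 2)" using e by (intro divide_left_mono) auto
  finally show "(\<Sum>n::nat. exp (- real n)) \<le> 2" by simp
qed

lemma separated_exp_sum:
  assumes "finite K" "separated 1 K"
  shows "(\<Sum>x\<in>K. exp (- \<bar>x - y\<bar>)) \<le> 4"
proof -
  have "(\<Sum>x\<in>K. exp (- \<bar>x - y\<bar>)) \<le> (\<Sum>x\<in>K. exp (- real (nat \<lfloor>\<bar>x - y\<bar>\<rfloor>)))"
    by (intro sum_mono) auto
  also have "\<dots> \<le> 2 * (\<Sum>n::nat. exp (- real n))"
    using assms summable_exp_neg by (intro separated_sum) auto
  finally show ?thesis using summable_exp_neg(2) by linarith
qed

text \<open>For \<nu> at least 0 the function \<open>exp (\<i> \<nu> z)\<close> is bounded on half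
  planes \<open>Im z > - 1\<close>, and its value at \<i> is \<open>exp (- \<nu>)\<close>. Complex
  conjugation handles negative \<nu>.\<close>

lemma poisson_exp: "((\<lambda>t. exp (\<i> * of_real (\<nu> * cay t))) has_integral of_real (exp (- \<bar>\<nu>\<bar>))) {0<..<1}"
proof -
  have pos: "((\<lambda>t. exp (\<i> * of_real (\<mu> * cay t))) has_integral of_real (exp (- \<mu>))) {0<..<1}" if "\<mu> \<ge> 0" for \<mu>
  proof -
    have "((\<lambda>t. exp (\<i> * of_real \<mu> * of_real (cay t))) has_integral exp (\<i> * of_real \<mu> * \<i>)) {0<..<1}"
    proof (rule poisson_mean_value[of 1 "\<lambda>z. exp (\<i> * of_real \<mu> * z)" "exp \<mu>"])
      show "cmod (exp (\<i> * of_real \<mu> * z)) \<le> exp \<mu>" if "- 1 < Im z" for z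
        using mult_left_mono[of "- Im z" 1 \<mu>] that \<open>\<mu> \<ge> 0\<close> by simp
    qed (auto intro!: holomorphic_intros)
    moreover have "\<i> * of_real \<mu> * \<i> = complex_of_real (- \<mu>)" by (simp add: algebra_simps)
    ultimately show ?thesis by (simp only: exp_of_real) (simp add: mult.assoc)
  qed
  show ?thesis
  proof (cases "\<nu> \<ge> 0")
    case True
    then show ?thesis using pos by simp
  next
    case False
    have "((\<lambda>t. cnj (exp (\<i> * of_real (- \<nu> * cay t)))) has_integral cnj (of_real (exp (- (- \<nu>))))) {0<..<1}"
      using pos[of "- \<nu>"] False
        has_integral_cnj[of "\<lambda>t. exp (\<i> * of_real (- \<nu> * cay t))" "of_real (exp (- (- \<nu>)))" "{0<..<1}"]
      by (simp only: comp_def)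
    then show ?thesis using False by (simp add: exp_cnj)
  qed
qed

text \<open>The Gram matrix of the exponentials in \<open>L\<^sup>2\<close> of the Poisson measure is \<open>exp (- \<bar>k - l\<bar>)\<close>,
  so it is bounded on separated frequencies by Schur's test.\<close>

lemma poisson_square_sum:
  assumes "finite K" "separated 1 K"
  shows "(\<lambda>t. (cmod (\<Sum>k\<in>K. c k * exp (\<i> * of_real (k * cay t))))\<^sup>2) integrable_on {0<..<1}"
    and "integral {0<..<1} (\<lambda>t. (cmod (\<Sum>k\<in>K. c k * exp (\<i> * of_real (k * cay t))))\<^sup>2) \<le> 4 * (\<Sum>k\<in>K. (cmod (c k))\<^sup>2)"
proof -
  let ?F = "\<lambda>t. \<Sum>k\<in>K. c k * exp (\<i> * of_real (k * cay t))"
  define I where "I = (\<Sum>k\<in>K. \<Sum>l\<in>K. c k * cnj (c l) * of_real (exp (- \<bar>k - l\<bar>)))"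
  have sq: "complex_of_real ((cmod (?F t))\<^sup>2) = (\<Sum>k\<in>K. \<Sum>l\<in>K. c k * cnj (c l) * exp (\<i> * of_real ((k - l) * cay t)))" for t
  proof -
    have e: "exp (\<i> * of_real (k * x)) * cnj (exp (\<i> * of_real (l * x))) = exp (\<i> * of_real ((k - l) * x))" for k l x :: real
      unfolding exp_cnj exp_add[symmetric] by (rule arg_cong[of _ _ exp]) (simp add: algebra_simps)
    have "a * exp (\<i> * of_real (k * x)) * cnj (b * exp (\<i> * of_real (l * x))) = a * cnj b * exp (\<i> * of_real ((k - l) * x))"
      for a b and k l x :: real
      unfolding e[symmetric] by (simp only: complex_cnj_mult mult.assoc mult.left_commute)
    then show ?thesis unfolding complex_norm_square cnj_sum sum_product by (intro sum.cong refl)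
  qed
  have "((\<lambda>t. complex_of_real ((cmod (?F t))\<^sup>2)) has_integral I) {0<..<1}"
    unfolding sq I_def
    by (rule has_integral_sum[OF assms(1)], rule has_integral_sum[OF assms(1)], rule has_integral_mult_right, rule poisson_exp)
  then have re: "((\<lambda>t. (cmod (?F t))\<^sup>2) has_integral Re I) {0<..<1}"
    using has_integral_Re[of "\<lambda>t. complex_of_real ((cmod (?F t))\<^sup>2)" I] by (simp only: Re_complex_of_real)
  then show "(\<lambda>t. (cmod (?F t))\<^sup>2) integrable_on {0<..<1}" by blast
  have "Re I \<le> cmod I" by (rule complex_Re_le_cmod)
  also have "\<dots> \<le> (\<Sum>k\<in>K. \<Sum>l\<in>K. cmod (c k) * cmod (c l) * exp (- \<bar>k - l\<bar>))"
    unfolding I_def by (rule sum_norm_le, rule sum_norm_le) (simp add: norm_mult)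
  also have "\<dots> \<le> (\<Sum>k\<in>K. \<Sum>l\<in>K. ((cmod (c k))\<^sup>2 / 2 + (cmod (c l))\<^sup>2 / 2) * exp (- \<bar>k - l\<bar>))"
  proof (intro sum_mono mult_right_mono)
    fix k l
    have "0 \<le> (cmod (c k) - cmod (c l))\<^sup>2" by simp
    then show "cmod (c k) * cmod (c l) \<le> (cmod (c k))\<^sup>2 / 2 + (cmod (c l))\<^sup>2 / 2"
      by (simp add: power2_eq_square algebra_simps)
  qed auto
  also have "\<dots> = (\<Sum>k\<in>K. \<Sum>l\<in>K. (cmod (c k))\<^sup>2 / 2 * exp (- \<bar>k - l\<bar>))
      + (\<Sum>k\<in>K. \<Sum>l\<in>K. (cmod (c l))\<^sup>2 / 2 * exp (- \<bar>k - l\<bar>))"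
    by (simp only: distrib_right sum.distrib)
  also have "(\<Sum>k\<in>K. \<Sum>l\<in>K. (cmod (c l))\<^sup>2 / 2 * exp (- \<bar>k - l\<bar>))
      = (\<Sum>l\<in>K. \<Sum>k\<in>K. (cmod (c l))\<^sup>2 / 2 * exp (- \<bar>k - l\<bar>))"
    by (rule sum.swap)
  also have "(\<Sum>k\<in>K. \<Sum>l\<in>K. (cmod (c k))\<^sup>2 / 2 * exp (- \<bar>k - l\<bar>))
      + (\<Sum>l\<in>K. \<Sum>k\<in>K. (cmod (c l))\<^sup>2 / 2 * exp (- \<bar>k - l\<bar>))
      = (\<Sum>k\<in>K. (cmod (c k))\<^sup>2 / 2 * (\<Sum>l\<in>K. exp (- \<bar>l - k\<bar>)))
      + (\<Sum>l\<in>K. (cmod (c l))\<^sup>2 / 2 * (\<Sum>k\<in>K. exp (- \<bar>k - l\<bar>)))"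
    unfolding sum_distrib_left by (simp only: abs_minus_commute)
  also have "\<dots> \<le> (\<Sum>k\<in>K. (cmod (c k))\<^sup>2 / 2 * 4) + (\<Sum>l\<in>K. (cmod (c l))\<^sup>2 / 2 * 4)"
    using separated_exp_sum[OF assms] by (intro add_mono sum_mono mult_left_mono) auto
  also have "\<dots> = 4 * (\<Sum>k\<in>K. (cmod (c k))\<^sup>2)" by (simp add: sum_distrib_left sum.distrib[symmetric])
  finally show "integral {0<..<1} (\<lambda>t. (cmod (?F t))\<^sup>2) \<le> 4 * (\<Sum>k\<in>K. (cmod (c k))\<^sup>2)"
    using re by (simp add: integral_unique)
qed

section \<open>Lower and upper bounds for exponential sums\<close>

lemma integrable_on_continuous_bounded:
  fixes f :: "real \<Rightarrow> 'b::euclidean_space"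
  assumes "S \<in> sets lebesgue" "continuous_on S f" "h integrable_on S" "\<And>x. x \<in> S \<Longrightarrow> norm (f x) \<le> h x"
  shows "f integrable_on S"
  using continuous_imp_measurable_on_sets_lebesgue[OF assms(2,1)] assms(3,4,1)
  by (rule measurable_bounded_by_integrable_imp_integrable)

lemma integrable_on_compact:
  fixes f :: "real \<Rightarrow> 'b::euclidean_space"
  assumes "compact E" "continuous_on E f"
  shows "f integrable_on E"
proof -
  obtain B where "\<And>x. x \<in> E \<Longrightarrow> norm (f x) \<le> B"
    using compact_imp_bounded[OF compact_continuous_image[OF assms(2,1)]] by (auto simp: bounded_iff)
  then show ?thesis
    using assms lmeasurable_compact[OF assms(1)]
    by (intro integrable_on_continuous_bounded[OF _ _ integrable_on_const[of E B]]) (auto simp: fmeasurableD)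
qed

lemma integrable_lebesgue_on_compact:
  fixes f :: "real \<Rightarrow> 'b::euclidean_space"
  assumes "compact E" "continuous_on E f"
  shows "integrable (lebesgue_on E) f"
proof -
  obtain B where "\<And>x. x \<in> E \<Longrightarrow> norm (f x) \<le> B"
    using compact_imp_bounded[OF compact_continuous_image[OF assms(2,1)]] by (auto simp: bounded_iff)
  moreover have "finite_measure (lebesgue_on E)"
    using finite_measure_lebesgue_on lmeasurable_compact assms(1) by blast
  moreover have "f \<in> borel_measurable (lebesgue_on E)"
    using assms lmeasurable_compact by (intro continuous_imp_measurable_on_sets_lebesgue) (auto simp: fmeasurableD)
  ultimately show ?thesis
    by (intro finite_measure.integrable_const_bound[where B = B]) auto
qed

section \<open>The Cauchy transform and harmonic measure\<close>

text \<open>In the upper half plane its imaginary part is \<pi> times the harmonic measure of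
  \<open>E\<close>. Exponentiating \<open>- \<i> a\<close> times this function, with
  \<open>a\<close> real, gives a holomorphic function whose modulus is governed by that
  measure.\<close>

definition cauchy_transform :: "real set \<Rightarrow> complex \<Rightarrow> complex" where
  "cauchy_transform E z = (LINT t|lebesgue_on E. 1 / (of_real t - z))"

lemma cauchy_transform_holomorphic:
  assumes "compact E" "\<eta> > 0"
  shows "cauchy_transform E holomorphic_on {z. \<eta> < Im z}"
proof -
  have "(\<lambda>z. LINT t|lebesgue_on E. 1 / (of_real t - z)) holomorphic_on {z. \<eta> < Im z}"
  proof (rule holomorphic_on_integral[where B = "1 / \<eta>"])
    show "finite_measure (lebesgue_on E)"
      using finite_measure_lebesgue_on lmeasurable_compact assms(1) by blast
    show "open {z. \<eta> < Im z}" by (rule open_halfspace_Im_gt)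
    have ne: "of_real t - z \<noteq> 0" if "z \<in> {z. \<eta> < Im z}" for t and z :: complex
      using that assms(2) by auto
    show "(\<lambda>z. 1 / (of_real t - z)) holomorphic_on {z. \<eta> < Im z}" for t
      using ne by (intro holomorphic_intros)
    show "(\<lambda>t. 1 / (of_real t - z)) \<in> borel_measurable (lebesgue_on E)" if "z \<in> {z. \<eta> < Im z}" for z
      by (intro borel_measurable_divide borel_measurable_diff borel_measurable_const)
         (auto intro!: continuous_imp_measurable_on_sets_lebesgue continuous_intros
           simp: lmeasurable_compact[OF assms(1)] fmeasurableD)
    show "cmod (1 / (of_real t - z)) \<le> 1 / \<eta>" if "z \<in> {z. \<eta> < Im z}" for t z
    proof -
      have "\<eta> \<le> \<bar>Im (of_real t - z)\<bar>" using that by simp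
      also have "\<dots> \<le> cmod (of_real t - z)" by (rule abs_Im_le_cmod)
      finally show ?thesis using assms(2) by (simp add: norm_divide frac_le)
    qed
  qed
  then show ?thesis by (simp add: cauchy_transform_def[abs_def])
qed

lemma Im_cauchy_transform:
  assumes "compact E" "y > 0"
  shows "(\<lambda>t. y / ((t - x)\<^sup>2 + y\<^sup>2)) integrable_on E"
    and "Im (cauchy_transform E (Complex x y)) = integral E (\<lambda>t. y / ((t - x)\<^sup>2 + y\<^sup>2))"
proof -
  have pos: "(t - x)\<^sup>2 + y\<^sup>2 \<noteq> 0" for t using assms(2) by (simp add: add_nonneg_eq_0_iff)
  have c: "continuous_on E (\<lambda>t. y / ((t - x)\<^sup>2 + y\<^sup>2))" using pos by (intro continuous_intros) auto
  then show "(\<lambda>t. y / ((t - x)\<^sup>2 + y\<^sup>2)) integrable_on E" by (rule integrable_on_compact[OF assms(1)])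
  have ne: "of_real t - Complex x y \<noteq> 0" for t using assms(2) by (auto simp: complex_eq_iff)
  have i: "integrable (lebesgue_on E) (\<lambda>t. 1 / (of_real t - Complex x y))"
    using ne by (intro integrable_lebesgue_on_compact assms continuous_intros) auto
  have im: "Im (1 / (of_real t - Complex x y)) = y / ((t - x)\<^sup>2 + y\<^sup>2)" for t
    by (simp add: Im_divide power2_eq_square)
  have "Im (cauchy_transform E (Complex x y)) = (LINT t|lebesgue_on E. Im (1 / (of_real t - Complex x y)))"
    unfolding cauchy_transform_def using i by (rule integral_Im[symmetric])
  also have "\<dots> = (LINT t|lebesgue_on E. y / ((t - x)\<^sup>2 + y\<^sup>2))" unfolding im ..
  also have "\<dots> = integral E (\<lambda>t. y / ((t - x)\<^sup>2 + y\<^sup>2))"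
    using integrable_lebesgue_on_compact[OF assms(1) c] lmeasurable_compact[OF assms(1)]
    by (intro lebesgue_integral_eq_integral) (auto simp: fmeasurableD)
  finally show "Im (cauchy_transform E (Complex x y)) = integral E (\<lambda>t. y / ((t - x)\<^sup>2 + y\<^sup>2))" .
qed

text \<open>The kernel is positive with total mass \<pi> on the line, as its primitive is an
  arctangent.\<close>

lemma Im_cauchy_transform_bounds:
  assumes "compact E" "y > 0"
  shows "0 \<le> Im (cauchy_transform E (Complex x y))" "Im (cauchy_transform E (Complex x y)) \<le> pi"
proof -
  note I = Im_cauchy_transform[OF assms, of x]
  have nn: "0 \<le> y / ((t - x)\<^sup>2 + y\<^sup>2)" for t using assms(2) by simp
  show "0 \<le> Im (cauchy_transform E (Complex x y))" unfolding I(2) using nn by (intro integral_nonneg I)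
  obtain a b where ab: "E \<subseteq> {a..b}" "a \<le> b"
  proof -
    obtain B where B: "\<And>x. x \<in> E \<Longrightarrow> \<bar>x\<bar> \<le> B" using compact_imp_bounded[OF assms(1)] by (auto simp: bounded_iff)
    show thesis by (rule that[of "- \<bar>B\<bar>" "\<bar>B\<bar>"]) (use B in force)+
  qed
  have "((\<lambda>t. y / ((t - x)\<^sup>2 + y\<^sup>2)) has_integral (arctan ((b - x) / y) - arctan ((a - x) / y))) {a..b}"
  proof (rule fundamental_theorem_of_calculus[OF ab(2)])
    fix t
    have "((\<lambda>t. arctan ((t - x) / y)) has_field_derivative y / ((t - x)\<^sup>2 + y\<^sup>2)) (at t within {a..b})"
      using assms(2) by (auto intro!: derivative_eq_intros simp: field_simps power2_eq_square)
    then show "((\<lambda>t. arctan ((t - x) / y)) has_vector_derivative y / ((t - x)\<^sup>2 + y\<^sup>2)) (at t within {a..b})"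
      by (simp add: has_real_derivative_iff_has_vector_derivative)
  qed
  then have "integral E (\<lambda>t. y / ((t - x)\<^sup>2 + y\<^sup>2)) \<le> arctan ((b - x) / y) - arctan ((a - x) / y)"
    using nn ab(1) I(1) by (metis has_integral_integrable integral_subset_le integral_unique)
  also have "\<dots> \<le> pi" using arctan_bounded[of "(b - x) / y"] arctan_bounded[of "(a - x) / y"] by linarith
  finally show "Im (cauchy_transform E (Complex x y)) \<le> pi" unfolding I(2) .
qed

text \<open>The range \<open>1 \<le> y \<le> 2\<close> accommodates the point \<i> after an upward
  shift by at most 1; the kernel is then at least \<open>1 / (L\<^sup>2 + 4)\<close> on
  \<open>E\<close>.\<close>

lemma Im_cauchy_transform_lower:
  assumes "compact E" "\<And>t. t \<in> E \<Longrightarrow> \<bar>t\<bar> \<le> L" "1 \<le> y" "y \<le> 2"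
  shows "measure lebesgue E / (L\<^sup>2 + 4) \<le> Im (cauchy_transform E (Complex 0 y))"
proof -
  note I = Im_cauchy_transform[OF assms(1), of y 0]
  have E: "E \<in> lmeasurable" using lmeasurable_compact assms(1) by blast
  have "measure lebesgue E / (L\<^sup>2 + 4) = integral E (\<lambda>t. 1 / (L\<^sup>2 + 4))"
    using lmeasure_integral[OF E] integral_mult_right[of E "1 / (L\<^sup>2 + 4)" "\<lambda>t. 1"] by simp
  also have "\<dots> \<le> integral E (\<lambda>t. y / ((t - 0)\<^sup>2 + y\<^sup>2))"
  proof (intro integral_le integrable_on_const E I)
    fix t assume "t \<in> E"
    then have "t\<^sup>2 \<le> L\<^sup>2" using assms(2) by (metis abs_ge_zero power2_abs power_mono)
    moreover have "y\<^sup>2 \<le> 4" using assms power_mono[of y 2 2] by simp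
    ultimately show "1 / (L\<^sup>2 + 4) \<le> y / ((t - 0)\<^sup>2 + y\<^sup>2)" using assms(3)
      by (intro frac_le) (auto simp: add_nonneg_pos)
  qed (use assms in auto)
  finally show ?thesis using I(2) assms(3) by simp
qed

text \<open>At positive distance \<open>d\<close> from \<open>E\<close> the kernel at height
  \<open>y\<close> is at most \<open>y / d\<^sup>2\<close>.\<close>

lemma Im_cauchy_transform_tendsto_0:
  assumes "compact E" "x \<notin> E"
  shows "(\<lambda>n. Im (cauchy_transform E (Complex x (1 / real (Suc n))))) \<longlonglongrightarrow> 0"
proof (cases "E = {}")
  case True
  have "Im (cauchy_transform E (Complex x (1 / real (Suc n)))) = 0" for n
    using Im_cauchy_transform(2)[OF assms(1), of "1 / real (Suc n)" x] True by simp
  then show ?thesis by simp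
next
  case False
  have E: "E \<in> lmeasurable" using lmeasurable_compact assms(1) by blast
  define d where "d = infdist x E"
  have d: "d > 0" unfolding d_def using assms False
    by (metis compact_imp_closed in_closed_iff_infdist_zero infdist_nonneg order_le_less)
  have le: "d \<le> \<bar>t - x\<bar>" if "t \<in> E" for t
    using infdist_le[OF that, of x] by (simp add: d_def dist_real_def abs_minus_commute)
  have bd: "Im (cauchy_transform E (Complex x y)) \<le> y * (measure lebesgue E / d\<^sup>2)" if "y > 0" for y
  proof -
    note I = Im_cauchy_transform[OF assms(1) that, of x]
    have "integral E (\<lambda>t. y / ((t - x)\<^sup>2 + y\<^sup>2)) \<le> integral E (\<lambda>t. y / d\<^sup>2)"
    proof (intro integral_le integrable_on_const E I)
      fix t assume "t \<in> E"
      then have "d\<^sup>2 \<le> (t - x)\<^sup>2" using le d by (metis less_imp_le power2_abs power_mono)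
      then show "y / ((t - x)\<^sup>2 + y\<^sup>2) \<le> y / d\<^sup>2" using that d by (intro divide_left_mono mult_pos_pos add_nonneg_pos) (auto simp: add_increasing2)
    qed
    also have "\<dots> = y * (measure lebesgue E / d\<^sup>2)"
      using lmeasure_integral[OF E] integral_mult_right[of E "y / d\<^sup>2" "\<lambda>t. 1"] by simp
    finally show ?thesis unfolding I(2) .
  qed
  have lim: "(\<lambda>n. 1 / real (Suc n) * (measure lebesgue E / d\<^sup>2)) \<longlonglongrightarrow> 0"
    using LIMSEQ_inverse_real_of_nat by (intro tendsto_mult_left_zero) (simp only: inverse_eq_divide)
  show ?thesis
  proof (rule tendsto_sandwich[OF _ _ tendsto_const lim]; intro always_eventually allI)
    fix n
    have "0 < 1 / real (Suc n)" by simp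
    then show "0 \<le> Im (cauchy_transform E (Complex x (1 / real (Suc n))))"
      and "Im (cauchy_transform E (Complex x (1 / real (Suc n)))) \<le> 1 / real (Suc n) * (measure lebesgue E / d\<^sup>2)"
      using Im_cauchy_transform_bounds(1)[OF assms(1)] bd by blast+
  qed
qed

text \<open>Convexity of \<open>exp\<close>. With \<open>u\<close> a harmonic measure, this replaces
  an exponential of \<open>u\<close> by an expression linear in \<open>u\<close>, which can be
  integrated termwise.\<close>

lemma exp_secant: "0 \<le> u \<Longrightarrow> u \<le> 1 \<Longrightarrow> exp (u * b) \<le> 1 + u * exp b" for u b :: real
proof -
  assume u: "0 \<le> u" "u \<le> 1"
  have "exp ((1 - u) *\<^sub>R 0 + u *\<^sub>R b) \<le> (1 - u) * exp 0 + u * exp b"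
    using convex_onD[OF exp_convex, of u 0 b] u by simp
  with u show ?thesis by simp
qed

text \<open>At \<i> the frequency \<open>k\<close> is damped to \<open>exp (- k)\<close>. Since the
  frequencies start at 1 and have gaps at least 1, the squares of these factors sum to at most
  \<open>2 * exp (- 2)\<close>, hence to at most \<open>1 / 2\<close>. By the Cauchy--Schwarz
  inequality the sum has modulus at most \<open>3 / 4\<close>.\<close>

lemma exp_sum_at_i:
  assumes "finite K" "separated 1 K" "K \<subseteq> {1..}" and c: "(\<Sum>k\<in>K. (cmod (c k))\<^sup>2) \<le> 1"
  shows "1 / 4 \<le> cmod (1 + (\<Sum>k\<in>K. c k * of_real (exp (- k))))"
proof -
  have "(\<Sum>k\<in>K. exp (- k) ^ 2) = (\<Sum>k\<in>K. exp (- 2) * exp (- 2 * (k - 1)))"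
    by (intro sum.cong refl) (simp add: power2_eq_square exp_add[symmetric])
  also have "\<dots> \<le> (\<Sum>k\<in>K. exp (- 2) * exp (- real (nat \<lfloor>k - 1\<rfloor>)))"
  proof (intro sum_mono mult_left_mono)
    fix k assume "k \<in> K"
    then have "0 \<le> k - 1" using assms(3) by auto
    then have "real (nat \<lfloor>k - 1\<rfloor>) \<le> k - 1" by simp
    then have "- (k - 1) \<le> - real (nat \<lfloor>k - 1\<rfloor>)" by (simp only: neg_le_iff_le)
    moreover have "- 2 * (k - 1) \<le> - (k - 1)" using \<open>0 \<le> k - 1\<close> by (simp add: algebra_simps)
    ultimately have "- 2 * (k - 1) \<le> - real (nat \<lfloor>k - 1\<rfloor>)" by (rule order_trans[rotated])
    then show "exp (- 2 * (k - 1)) \<le> exp (- real (nat \<lfloor>k - 1\<rfloor>))" by simp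
  qed auto
  also have "\<dots> = exp (- 2) * (\<Sum>x\<in>(\<lambda>k. k - 1) ` K. exp (- real (nat \<lfloor>x\<rfloor>)))"
    by (subst sum.reindex) (auto simp: inj_on_def sum_distrib_left)
  also have "\<dots> \<le> exp (- 2) * 2"
  proof (rule mult_left_mono)
    have "(\<Sum>x\<in>(\<lambda>k. k - 1) ` K. exp (- real (nat \<lfloor>x\<rfloor>))) \<le> (\<Sum>n::nat. exp (- real n))"
      using assms summable_exp_neg(1) by (intro separated_sum_nonneg) (auto simp: separated_def)
    then show "(\<Sum>x\<in>(\<lambda>k. k - 1) ` K. exp (- real (nat \<lfloor>x\<rfloor>))) \<le> 2" using summable_exp_neg(2) by linarith
  qed auto
  also have "\<dots> \<le> 1 / 2"
  proof -
    have "4 \<le> exp (1::real) * exp 1" using exp_ge_add_one_self[of 1] mult_mono[of 2 "exp (1::real)" 2 "exp 1"] by simp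
    then show ?thesis by (simp add: exp_minus exp_add[symmetric] field_simps)
  qed
  finally have S: "(\<Sum>k\<in>K. exp (- k) ^ 2) \<le> 1 / 2" .
  have "cmod (\<Sum>k\<in>K. c k * of_real (exp (- k))) \<le> (\<Sum>k\<in>K. cmod (c k) * exp (- k))"
    by (rule sum_norm_le) (simp add: norm_mult)
  also have "\<dots> \<le> sqrt (\<Sum>k\<in>K. (cmod (c k))\<^sup>2) * sqrt (\<Sum>k\<in>K. exp (- k) ^ 2)"
    using L2_set_mult_ineq[of "\<lambda>k. cmod (c k)" "\<lambda>k. exp (- k)" K] by (simp add: L2_set_def)
  also have "\<dots> \<le> 1 * (3 / 4)"
  proof (intro mult_mono)
    show "sqrt (\<Sum>k\<in>K. (cmod (c k))\<^sup>2) \<le> 1" using c by simp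
    show "sqrt (\<Sum>k\<in>K. exp (- k) ^ 2) \<le> 3 / 4"
    proof (rule real_le_lsqrt)
      show "(\<Sum>k\<in>K. exp (- k) ^ 2) \<le> (3 / 4)\<^sup>2" using S by (rule order_trans) (simp add: power2_eq_square)
    qed auto
  qed (auto intro: sum_nonneg)
  finally have "cmod (\<Sum>k\<in>K. c k * of_real (exp (- k))) \<le> 3 / 4" by simp
  then show ?thesis using norm_diff_ineq[of 1 "\<Sum>k\<in>K. c k * of_real (exp (- k))"] by simp
qed

lemma cay_preimage:
  assumes E: "compact E"
  shows "compact {t\<in>{0<..<1}. cay t \<in> E}" "cay ` {t\<in>{0<..<1}. cay t \<in> E} = E"
proof -
  let ?S = "{t\<in>{0<..<1}. cay t \<in> E}"
  have Simg: "?S = (\<lambda>x. 1 / 2 + arctan x / pi) ` E"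
  proof (intro equalityI subsetI)
    fix t assume t: "t \<in> ?S"
    then have "t = 1 / 2 + arctan (cay t) / pi" using cay_arctan[of t] by (simp add: field_simps)
    then show "t \<in> (\<lambda>x. 1 / 2 + arctan x / pi) ` E" using t by auto
  next
    fix t assume "t \<in> (\<lambda>x. 1 / 2 + arctan x / pi) ` E"
    then obtain x where x: "x \<in> E" "t = 1 / 2 + arctan x / pi" by auto
    have "cay t = x" by (simp add: cay_def x(2) algebra_simps tan_arctan)
    moreover have "t \<in> {0<..<1}" using arctan_bounded[of x] by (auto simp: x(2) field_simps)
    ultimately show "t \<in> ?S" using x(1) by simp
  qed
  show "compact ?S" unfolding Simg by (intro compact_continuous_image continuous_intros E) auto
  show "cay ` ?S = E"
  proof (intro equalityI subsetI)
    fix x assume "x \<in> E"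
    then show "x \<in> cay ` ?S" using cay_surj[of x] by auto
  qed auto
qed

lemma cay_integral:
  fixes f :: "real \<Rightarrow> real"
  assumes E: "compact E" and f: "continuous_on E f" "\<And>x. x \<in> E \<Longrightarrow> 0 \<le> f x"
  shows "(\<lambda>t. \<bar>pi * (1 + (cay t)\<^sup>2)\<bar> * f (cay t)) integrable_on {t\<in>{0<..<1}. cay t \<in> E}"
    and "integral {t\<in>{0<..<1}. cay t \<in> E} (\<lambda>t. \<bar>pi * (1 + (cay t)\<^sup>2)\<bar> * f (cay t)) = integral E f"
proof -
  let ?S = "{t\<in>{0<..<1}. cay t \<in> E}"
  note S = cay_preimage[OF E]
  have Sm: "?S \<in> sets lebesgue" using lmeasurable_compact[OF S(1)] by (rule fmeasurableD)
  have Ei: "f absolutely_integrable_on cay ` ?S"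
    unfolding S(2) using f(2) by (intro nonnegative_absolutely_integrable_1 integrable_on_compact E f(1))
  have "inj_on cay ?S" using cay_inj by (rule inj_on_subset) auto
  then have cv: "(\<lambda>t. \<bar>pi * (1 + (cay t)\<^sup>2)\<bar> * f (cay t)) absolutely_integrable_on ?S \<and>
     integral ?S (\<lambda>t. \<bar>pi * (1 + (cay t)\<^sup>2)\<bar> * f (cay t)) = integral E f"
    using has_absolute_integral_change_of_variables_1'[OF Sm, of cay "\<lambda>t. pi * (1 + (cay t)\<^sup>2)" f "integral E f"] Ei
      cay_deriv unfolding S(2) by auto
  then show "(\<lambda>t. \<bar>pi * (1 + (cay t)\<^sup>2)\<bar> * f (cay t)) integrable_on ?S"
    using set_lebesgue_integral_eq_integral(1) by blast
  show "integral ?S (\<lambda>t. \<bar>pi * (1 + (cay t)\<^sup>2)\<bar> * f (cay t)) = integral E f" using cv by blast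
qed

text \<open>The two-constants argument: an exponential sum \<open>F\<close> that is small on \<open>E\<close> is multiplied by the
  bounded holomorphic function whose modulus is, on the real line, a large constant on \<open>E\<close>
  and \<open>1\<close> off \<open>E\<close>. Harmonic measure makes the product large at \<open>\<i>\<close>, which contradicts the mean value
  inequality. The boundary values of the Cauchy transform are avoided by shifting it up by \<open>\<eta>\<close>.\<close>

lemma exp_sum_lower_bound_compact:
  assumes E: "compact E" and m: "0 < measure lebesgue E"
  shows "\<exists>\<epsilon>>0. \<forall>K c. finite K \<and> separated 1 K \<and> K \<subseteq> {1..} \<and> (\<Sum>k\<in>K. (cmod (c k))\<^sup>2) \<le> 1 \<longrightarrow>
    \<epsilon> \<le> integral E (\<lambda>x. (cmod (1 + (\<Sum>k\<in>K. c k * exp (\<i> * of_real (k * x)))))\<^sup>2)"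
proof -
  obtain L where L: "\<And>t. t \<in> E \<Longrightarrow> \<bar>t\<bar> \<le> L" using compact_imp_bounded[OF E] by (auto simp: bounded_iff)
  define \<kappa> where "\<kappa> = measure lebesgue E / (L\<^sup>2 + 4)"
  have kpos: "\<kappa> > 0" unfolding \<kappa>_def using m by (simp add: add_nonneg_pos)
  \<comment> \<open>The exponent is tuned so that the weight \<open>H\<close> below has squared
    modulus at least 144 at \<i>. As that of \<open>F\<close> is at least \<open>1 / 16\<close>
    there, the product is at least 9, exceeding by 1 the bound 8 for the integral of
    \<open>Q\<close>. The number \<open>N\<close> bounds the squared weight on the real
    line.\<close>
  define a where "a = ln 144 / (2 * \<kappa>)"
  have a: "a > 0" using kpos by (simp add: a_def)
  define N where "N = exp (2 * a * pi)"
  define \<epsilon> where "\<epsilon> = 1 / N"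
  let ?C = "cauchy_transform E"
  have "\<epsilon> \<le> integral E (\<lambda>x. (cmod (1 + (\<Sum>k\<in>K. c k * exp (\<i> * of_real (k * x)))))\<^sup>2)"
    if K: "finite K" "separated 1 K" "K \<subseteq> {1..}" and c: "(\<Sum>k\<in>K. (cmod (c k))\<^sup>2) \<le> 1" for K c
  proof -
    define F where "F = (\<lambda>z. 1 + (\<Sum>k\<in>K. c k * exp (\<i> * of_real k * z)))"
    define Q where "Q = (\<lambda>t. (cmod (F (of_real (cay t))))\<^sup>2)"
    have Fhol: "F holomorphic_on A" for A unfolding F_def by (intro holomorphic_intros)
    have Fi: "1 / 4 \<le> cmod (F \<i>)"
      using exp_sum_at_i[OF K c] by (simp add: F_def exp_of_real[symmetric] mult.commute mult.left_commute mult.assoc)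
    have FL: "(cmod (F z)) \<le> 1 + (\<Sum>k\<in>K. cmod (c k) * exp k)" if "-1 < Im z" for z
    proof -
      have "cmod (F z) \<le> cmod 1 + cmod (\<Sum>k\<in>K. c k * exp (\<i> * of_real k * z))" unfolding F_def by (rule norm_triangle_ineq)
      also have "cmod (\<Sum>k\<in>K. c k * exp (\<i> * of_real k * z)) \<le> (\<Sum>k\<in>K. cmod (c k) * exp k)"
      proof (rule sum_norm_le)
        fix k assume "k \<in> K"
        then have "1 \<le> k" using K(3) by auto
        then have "- (k * Im z) \<le> k" using mult_left_mono[of "- Im z" 1 k] that by simp
        then show "cmod (c k * exp (\<i> * of_real k * z)) \<le> cmod (c k) * exp k"
          by (simp add: norm_mult mult_left_mono)
      qed
      finally show ?thesis by simp
    qed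
    \<comment> \<open>The constant term is treated as frequency 0. The enlarged frequency set still
      has gaps at least 1, and its squared coefficients sum to at most 2; with the factor 4 of
      \<open>poisson_square_sum\<close> this gives the bound 8.\<close>
    define c' where "c' = (\<lambda>k. if k = 0 then 1 else c k)"
    have K0: "finite (insert 0 K)" "separated 1 (insert 0 K)" "0 \<notin> K"
      using K by (auto simp: separated_def)
    have Fc': "F (of_real x) = (\<Sum>k\<in>insert 0 K. c' k * exp (\<i> * of_real (k * x)))" for x
    proof -
      have "(\<Sum>k\<in>K. c' k * exp (\<i> * of_real (k * x))) = (\<Sum>k\<in>K. c k * exp (\<i> * of_real k * of_real x))"
        using K0(3) by (intro sum.cong refl) (auto simp: c'_def mult.assoc)
      then show ?thesis using K0 by (simp add: F_def c'_def)
    qed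
    have sc': "(\<Sum>k\<in>insert 0 K. (cmod (c' k))\<^sup>2) \<le> 2"
    proof -
      have "(\<Sum>k\<in>K. (cmod (c' k))\<^sup>2) = (\<Sum>k\<in>K. (cmod (c k))\<^sup>2)"
        using K0(3) by (intro sum.cong refl) (auto simp: c'_def)
      then show ?thesis using K0 c by (simp add: c'_def)
    qed
    have Qint: "Q integrable_on {0<..<1}" and Qle: "integral {0<..<1} Q \<le> 8"
      using poisson_square_sum[OF K0(1,2), of c'] sc' unfolding Q_def Fc' by auto
    have Qpos: "0 \<le> Q t" for t by (simp add: Q_def)
    have Qcont: "continuous_on {0<..<1} Q"
      unfolding Q_def F_def by (intro continuous_intros continuous_on_of_real cay_continuous)
    \<comment> \<open>\<open>Q\<close> times \<pi> times the harmonic measure of \<open>E\<close>,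
      seen from height \<open>1 / (n + 1)\<close> above the real point \<open>cay t\<close>.\<close>
    define g where "g = (\<lambda>n t. Q t * Im (?C (Complex (cay t) (1 / real (Suc n)))))"
    have gbound: "0 \<le> g n t" "g n t \<le> pi * Q t" for n t
      using Im_cauchy_transform_bounds[OF E, of "1 / real (Suc n)" "cay t"] Qpos[of t]
      by (auto simp: g_def mult.commute[of pi] intro: mult_left_mono)
    have gcont: "continuous_on {0<..<1} (g n)" for n
    proof -
      have "continuous_on {0<..<1} (\<lambda>t. ?C (Complex (cay t) (1 / real (Suc n))))"
      proof (rule continuous_on_compose2[of "{z. 1 / real (Suc (Suc n)) < Im z}" ?C])
        show "continuous_on {z. 1 / real (Suc (Suc n)) < Im z} ?C"
          using cauchy_transform_holomorphic[OF E, of "1 / real (Suc (Suc n))"]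
          by (simp add: holomorphic_on_imp_continuous_on)
        show "continuous_on {0<..<1} (\<lambda>t. Complex (cay t) (1 / real (Suc n)))"
          unfolding Complex_eq by (intro continuous_intros continuous_on_of_real cay_continuous)
        have "1 / real (Suc (Suc n)) < 1 / real (Suc n)" by (intro divide_strict_left_mono) auto
        then show "(\<lambda>t. Complex (cay t) (1 / real (Suc n))) ` {0<..<1} \<subseteq> {z. 1 / real (Suc (Suc n)) < Im z}"
          by auto
      qed
      then show ?thesis unfolding g_def by (intro continuous_intros Qcont)
    qed
    have gint: "g n integrable_on {0<..<1}" for n
      using gbound[of n] by (intro integrable_on_continuous_bounded[OF _ gcont integrable_on_cmult_left[OF Qint, of pi]]) auto
    have glow: "pi / N \<le> integral {0<..<1} (g n)" for n
    proof -
      define \<eta> where "\<eta> = 1 / real (Suc n)"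
      have eta: "0 < \<eta>" "\<eta> \<le> 1" by (auto simp: \<eta>_def)
      define H where "H = (\<lambda>z. exp (of_real a * (- \<i>) * ?C (z + \<i> * of_real \<eta>)))"
      \<comment> \<open>After squaring, the modulus on the real line is \<open>Q\<close> times the
        squared weight, so the mean value formula leads to an estimate in mean square.\<close>
      define \<Phi> where "\<Phi> = (\<lambda>z. (F z * H z)\<^sup>2)"
      have Hhol: "H holomorphic_on {z. - (\<eta> / 2) < Im z}"
        unfolding H_def
        by (intro holomorphic_intros holomorphic_on_compose_gen[OF _ cauchy_transform_holomorphic[OF E, of "\<eta> / 2"], unfolded comp_def])
           (use eta in auto)
      have Hnorm: "cmod (H z) = exp (a * Im (?C (Complex (Re z) (Im z + \<eta>))))" for z
      proof -
        have "z + \<i> * of_real \<eta> = Complex (Re z) (Im z + \<eta>)" by (simp add: complex_eq_iff)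
        then show ?thesis by (simp add: H_def)
      qed
      have Hb: "cmod (H z) \<le> exp (a * pi)" if "- (\<eta> / 2) < Im z" for z
        unfolding Hnorm using Im_cauchy_transform_bounds(2)[OF E, of "Im z + \<eta>" "Re z"] that eta a by simp
      define B where "B = 1 + (\<Sum>k\<in>K. cmod (c k) * exp k)"
      have "((\<lambda>t. \<Phi> (of_real (cay t))) has_integral \<Phi> \<i>) {0<..<1}"
      proof (rule poisson_mean_value[of "\<eta> / 2" _ "(B * exp (a * pi))\<^sup>2"])
        show "\<Phi> holomorphic_on {z. - (\<eta> / 2) < Im z}"
          unfolding \<Phi>_def by (intro holomorphic_intros Fhol Hhol)
        fix z assume z: "- (\<eta> / 2) < Im z"
        then have "cmod (F z) \<le> B" using FL[of z] eta by (simp add: B_def)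
        then show "cmod (\<Phi> z) \<le> (B * exp (a * pi))\<^sup>2"
          using Hb[OF z] unfolding \<Phi>_def norm_power norm_mult
          by (intro power_mono mult_mono) (auto intro: order_trans[OF norm_ge_zero])
      qed (use eta in auto)
      then have mv: "(\<lambda>t. \<Phi> (of_real (cay t))) integrable_on {0<..<1}" "\<Phi> \<i> = integral {0<..<1} (\<lambda>t. \<Phi> (of_real (cay t)))"
        by (auto simp: integral_unique)
      have pt: "cmod (\<Phi> (of_real (cay t))) \<le> Q t + N / pi * g n t" for t
      proof -
        define u where "u = Im (?C (Complex (cay t) \<eta>)) / pi"
        have u: "0 \<le> u" "u \<le> 1" using Im_cauchy_transform_bounds[OF E eta(1), of "cay t"] by (auto simp: u_def)
        have "cmod (\<Phi> (of_real (cay t))) = Q t * (cmod (H (of_real (cay t))))\<^sup>2"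
          by (simp add: \<Phi>_def Q_def norm_power norm_mult power_mult_distrib)
        also have "(cmod (H (of_real (cay t))))\<^sup>2 = exp (u * (2 * a * pi))"
          unfolding Hnorm by (simp add: u_def power2_eq_square exp_add[symmetric])
        also have "Q t * exp (u * (2 * a * pi)) \<le> Q t * (1 + u * N)"
          unfolding N_def using exp_secant[OF u] Qpos by (intro mult_left_mono) auto
        also have "\<dots> = Q t + N / pi * g n t" by (simp add: u_def g_def \<eta>_def algebra_simps)
        finally show ?thesis .
      qed
      have Ng: "(\<lambda>t. N / pi * g n t) integrable_on {0<..<1}"
        using integrable_on_cmult_left[OF gint[of n], of "N / pi"] by simp
      have "9 \<le> cmod (\<Phi> \<i>)"
      proof -
        have "\<kappa> \<le> Im (?C (Complex 0 (1 + \<eta>)))"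
          unfolding \<kappa>_def using eta L by (intro Im_cauchy_transform_lower E) auto
        then have "ln 144 \<le> 2 * a * Im (?C (Complex 0 (1 + \<eta>)))"
          using kpos by (simp add: a_def field_simps)
        then have "exp (ln 144) \<le> exp (2 * a * Im (?C (Complex 0 (1 + \<eta>))))" by (simp only: exp_le_cancel_iff)
        also have "\<dots> = (cmod (H \<i>))\<^sup>2" unfolding Hnorm by (simp add: power2_eq_square exp_add[symmetric])
        finally have "144 \<le> (cmod (H \<i>))\<^sup>2" by simp
        moreover have "1 / 16 \<le> (cmod (F \<i>))\<^sup>2" using power_mono[OF Fi, of 2] by (simp add: power2_eq_square)
        ultimately have "1 / 16 * 144 \<le> (cmod (F \<i>))\<^sup>2 * (cmod (H \<i>))\<^sup>2" by (intro mult_mono) auto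
        then show ?thesis by (simp add: \<Phi>_def norm_power norm_mult power_mult_distrib)
      qed
      also have "cmod (\<Phi> \<i>) \<le> integral {0<..<1} (\<lambda>t. Q t + N / pi * g n t)"
        unfolding mv(2) using mv(1) pt by (intro integral_norm_bound_integral integrable_add Qint Ng) auto
      also have "\<dots> = integral {0<..<1} Q + N / pi * integral {0<..<1} (g n)"
        unfolding integral_add[OF Qint Ng] by (simp only: integral_mult_right)
      finally have "1 \<le> N / pi * integral {0<..<1} (g n)" using Qle by linarith
      then show ?thesis by (simp add: N_def field_simps)
    qed
    define S where "S = {t\<in>{0<..<1}. cay t \<in> E}"
    have Scomp: "compact S" unfolding S_def by (rule cay_preimage[OF E])
    have Sm: "S \<in> sets lebesgue" using lmeasurable_compact[OF Scomp] by (simp add: fmeasurableD)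
    let ?T = "{0<..<1} - S"
    have Tm: "?T \<in> sets lebesgue" using Sm by auto
    have Qabs: "Q absolutely_integrable_on {0<..<1}" using Qint Qpos by (intro nonnegative_absolutely_integrable_1)
    have Ssub: "S \<subseteq> {0<..<1}" by (auto simp: S_def)
    have QS: "Q integrable_on S"
      by (rule set_lebesgue_integral_eq_integral(1)[OF set_integrable_subset[OF Qabs Sm Ssub]])
    have QT: "Q integrable_on ?T"
      by (rule set_lebesgue_integral_eq_integral(1)[OF set_integrable_subset[OF Qabs Tm Diff_subset]])
    have gS: "g n integrable_on S" for n
      using gbound[of n] continuous_on_subset[OF gcont[of n] Ssub] Sm
      by (intro integrable_on_continuous_bounded[OF _ _ integrable_on_cmult_left[OF QS, of pi]]) auto
    have gT: "g n integrable_on ?T" for n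
      using gbound[of n] continuous_on_subset[OF gcont[of n] Diff_subset[of _ S]] Tm
      by (intro integrable_on_continuous_bounded[OF _ _ integrable_on_cmult_left[OF QT, of pi]]) auto
    \<comment> \<open>The height tends to 0 only on the part lying over the complement of
      \<open>E\<close>, where the harmonic measure tends to 0. On \<open>S\<close> the bound of
      \<open>g n\<close> by \<open>pi * Q\<close> is kept instead of a limit.\<close>
    have limT: "(\<lambda>n. integral ?T (g n)) \<longlonglongrightarrow> integral ?T (\<lambda>t. 0)"
    proof (rule dominated_convergence(2)[where h = "\<lambda>t. pi * Q t"])
      show "(\<lambda>n. g n t) \<longlonglongrightarrow> 0" if "t \<in> ?T" for t
        unfolding g_def using that Im_cauchy_transform_tendsto_0[OF E, of "cay t"]
        by (intro tendsto_mult_right_zero) (auto simp: S_def)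
    qed (use gT gbound QT in \<open>auto intro: integrable_on_cmult_left\<close>)
    have "pi / N \<le> pi * integral S Q + integral ?T (g n)" for n
    proof -
      have "integral (S \<union> ?T) (g n) = integral S (g n) + integral ?T (g n)"
        by (rule integral_Un[OF gS gT]) (auto simp: Diff_disjoint)
      moreover have "S \<union> ?T = {0<..<1}" by (auto simp: S_def)
      moreover have "integral S (g n) \<le> integral S (\<lambda>t. pi * Q t)"
        by (rule integral_le[OF gS _ gbound(2)]) (use QS in simp)
      ultimately show ?thesis using glow[of n] by simp
    qed
    then have "pi / N \<le> pi * integral S Q + integral ?T (\<lambda>t. 0)"
      by (intro LIMSEQ_le_const[OF tendsto_add[OF tendsto_const limT]]) auto
    then have low: "\<epsilon> \<le> integral S Q" by (simp add: \<epsilon>_def field_simps N_def)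
    have "continuous_on E (\<lambda>x. (cmod (F (of_real x)))\<^sup>2)" unfolding F_def by (intro continuous_intros)
    note cv = cay_integral[OF E this zero_le_power2]
    \<comment> \<open>The Jacobian of \<open>cay\<close> is at least 1, so passing to Lebesgue
      measure on \<open>E\<close> can only increase the integral.\<close>
    have "integral S Q \<le> integral S (\<lambda>t. \<bar>pi * (1 + (cay t)\<^sup>2)\<bar> * Q t)"
    proof (rule integral_le[OF QS])
      show "(\<lambda>t. \<bar>pi * (1 + (cay t)\<^sup>2)\<bar> * Q t) integrable_on S" using cv(1) by (simp add: S_def Q_def)
      fix t
      have "1 * 1 \<le> pi * (1 + (cay t)\<^sup>2)" using pi_ge_two by (intro mult_mono) auto
      then have "1 \<le> \<bar>pi * (1 + (cay t)\<^sup>2)\<bar>" by linarith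
      then show "Q t \<le> \<bar>pi * (1 + (cay t)\<^sup>2)\<bar> * Q t" using mult_right_mono[OF _ Qpos[of t]] by fastforce
    qed
    also have "\<dots> = integral E (\<lambda>x. (cmod (F (of_real x)))\<^sup>2)" using cv(2) by (simp add: S_def Q_def)
    finally have "integral S Q \<le> integral E (\<lambda>x. (cmod (F (of_real x)))\<^sup>2)" .
    with low show ?thesis unfolding F_def by (simp add: mult.assoc)
  qed
  moreover have "\<epsilon> > 0" by (simp add: \<epsilon>_def N_def)
  ultimately show ?thesis by blast
qed

section \<open>Rescaling to arbitrary gaps and domains\<close>

lemma integral_scale:
  fixes f :: "real \<Rightarrow> real"
  assumes "compact E" "0 < a" "continuous_on UNIV f" "\<And>x. 0 \<le> f x"
  shows "integral ((*) a ` E) f = a * integral E (\<lambda>x. f (a * x))"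
proof -
  have Em: "E \<in> sets lebesgue" using lmeasurable_compact[OF assms(1)] by (rule fmeasurableD)
  have "compact ((*) a ` E)" using assms(1) by (intro compact_continuous_image continuous_intros)
  then have "f absolutely_integrable_on (*) a ` E"
    using assms(3,4) by (intro nonnegative_absolutely_integrable_1 integrable_on_compact) (auto intro: continuous_on_subset)
  then have "integral E (\<lambda>x. \<bar>a\<bar> * f (a * x)) = integral ((*) a ` E) f"
    using has_absolute_integral_change_of_variables_1'[OF Em, of "(*) a" "\<lambda>_. a" f "integral ((*) a ` E) f"] assms(2)
    by (auto simp: inj_on_def intro!: derivative_eq_intros)
  then show ?thesis using assms(2) by simp
qed

lemma expo_altdef: "expo k x = exp (\<i> * of_real (k / \<delta> * (2 * pi * \<delta> * x)))" if "\<delta> \<noteq> 0"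
  using that by (simp add: expo_def mult_ac)

lemma expo_simps:
  "expo 0 x = 1" "cmod (expo k x) = 1" "expo (k + l) x = expo k x * expo l x" "expo k (x + y) = expo k x * expo k y"
  "cnj (expo k x) = expo (- k) x" "expo (k - l) x = expo k x * cnj (expo l x)" "expo k x \<noteq> 0"
  "expo k x * cnj (expo k x) = 1"
proof -
  show "cmod (expo k x) = 1" by (simp add: expo_def norm_exp)
  show c: "cnj (expo k x) = expo (- k) x" for k by (simp add: expo_def exp_cnj)
  show "expo (k + l) x = expo k x * expo l x" "expo k (x + y) = expo k x * expo k y"
    by (simp_all add: expo_def exp_add[symmetric] algebra_simps)
  show "expo (k - l) x = expo k x * cnj (expo l x)" unfolding c
    by (simp add: expo_def exp_add[symmetric] algebra_simps)
  show "expo k x * cnj (expo k x) = 1" unfolding c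
    by (simp add: expo_def exp_add[symmetric])
qed (simp_all add: expo_def)

lemma expo_continuous: "continuous_on A (expo k)"
  unfolding expo_def[abs_def] by (intro continuous_intros)

lemma separated_scale:
  assumes "separated \<delta> K" "\<delta> > 0"
  shows "separated 1 ((\<lambda>k. k / \<delta>) ` K)"
  unfolding separated_def
proof safe
  fix x y assume "x \<in> K" "y \<in> K" "x / \<delta> \<noteq> y / \<delta>"
  then have "\<delta> \<le> \<bar>x - y\<bar>" using assms(1) by (auto simp: separated_def)
  then have "1 \<le> \<bar>x - y\<bar> / \<delta>" using assms(2) by simp
  also have "\<dots> = \<bar>x / \<delta> - y / \<delta>\<bar>" using assms(2) by (simp add: diff_divide_distrib[symmetric] abs_divide)
  finally show "1 \<le> \<bar>x / \<delta> - y / \<delta>\<bar>" .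
qed

lemma scaled_exp_sum:
  assumes "finite K" "\<delta> > 0"
  shows "(\<Sum>k\<in>K. c k * expo k x) = (\<Sum>k\<in>(\<lambda>k. k / \<delta>) ` K. c (k * \<delta>) * exp (\<i> * of_real (k * (2 * pi * \<delta> * x))))"
    and "(\<Sum>k\<in>(\<lambda>k. k / \<delta>) ` K. (cmod (c (k * \<delta>)))\<^sup>2) = (\<Sum>k\<in>K. (cmod (c k))\<^sup>2)"
proof -
  have inj: "inj_on (\<lambda>k. k / \<delta>) K" using assms(2) by (auto simp: inj_on_def)
  show "(\<Sum>k\<in>K. c k * expo k x) = (\<Sum>k\<in>(\<lambda>k. k / \<delta>) ` K. c (k * \<delta>) * exp (\<i> * of_real (k * (2 * pi * \<delta> * x))))"
    using assms(2) by (subst sum.reindex[OF inj]) (auto simp: expo_altdef[of \<delta>] intro!: sum.cong)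
  show "(\<Sum>k\<in>(\<lambda>k. k / \<delta>) ` K. (cmod (c (k * \<delta>)))\<^sup>2) = (\<Sum>k\<in>K. (cmod (c k))\<^sup>2)"
    using assms(2) by (subst sum.reindex[OF inj]) auto
qed

text \<open>On a bounded interval Lebesgue measure is at most a multiple of the Poisson measure.
  Dilation by \<open>a\<close> turns the gap \<delta> into 1 and the interval into
  \<open>{- M..M}\<close>; in \<open>C\<close> the factor \<open>pi * (1 + M\<^sup>2)\<close> bounds
  the Jacobian of \<open>cay\<close> there, and 4 comes from
  \<open>poisson_square_sum\<close>.\<close>

lemma exp_sum_upper_bound:
  assumes "\<delta> > 0" "L > 0"
  shows "\<exists>C>0. \<forall>K c. finite K \<and> separated \<delta> K \<longrightarrow>
     integral {- L..L} (\<lambda>x. (cmod (\<Sum>k\<in>K. c k * expo k x))\<^sup>2) \<le> C * (\<Sum>k\<in>K. (cmod (c k))\<^sup>2)"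
proof -
  define a where "a = 2 * pi * \<delta>"
  define M where "M = a * L"
  have a: "a > 0" "M > 0" using assms by (auto simp: a_def M_def)
  define C where "C = pi * (1 + M\<^sup>2) * 4 / a"
  have C: "C > 0" using a by (simp add: C_def add_pos_nonneg)
  have "integral {- L..L} (\<lambda>x. (cmod (\<Sum>k\<in>K. c k * expo k x))\<^sup>2) \<le> C * (\<Sum>k\<in>K. (cmod (c k))\<^sup>2)"
    if K: "finite K" "separated \<delta> K" for K c
  proof -
    let ?K = "(\<lambda>k. k / \<delta>) ` K"
    define f where "f = (\<lambda>y. (cmod (\<Sum>k\<in>?K. c (k * \<delta>) * exp (\<i> * of_real (k * y))))\<^sup>2)"
    have fc: "continuous_on A f" for A unfolding f_def by (intro continuous_intros)
    have f0: "0 \<le> f x" for x by (simp add: f_def)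
    have img: "(*) a ` {- L..L} = {- M..M}" using a by (simp add: M_def)
    let ?S = "{t\<in>{0<..<1}. cay t \<in> {- M..M}}"
    have cM: "compact {- M..M}" by simp
    note cv = cay_integral[OF cM fc f0]
    note K' = poisson_square_sum[OF _ separated_scale[OF K(2) assms(1)], of "\<lambda>k. c (k * \<delta>)"]
    have fi: "(\<lambda>t. f (cay t)) integrable_on {0<..<1}" unfolding f_def using K' K(1) by auto
    have Sm: "?S \<in> sets lebesgue" using cay_preimage(1)[OF cM] lmeasurable_compact fmeasurableD by blast
    have fS: "(\<lambda>t. f (cay t)) integrable_on ?S"
      using f0 by (intro set_lebesgue_integral_eq_integral(1) set_integrable_subset[OF nonnegative_absolutely_integrable_1[OF fi] Sm]) auto
    have "integral {- M..M} f = integral ?S (\<lambda>t. \<bar>pi * (1 + (cay t)\<^sup>2)\<bar> * f (cay t))" using cv(2) by simp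
    also have "\<dots> \<le> integral ?S (\<lambda>t. pi * (1 + M\<^sup>2) * f (cay t))"
    proof (rule integral_le[OF cv(1)])
      show "(\<lambda>t. pi * (1 + M\<^sup>2) * f (cay t)) integrable_on ?S"
        using integrable_on_cmult_left[OF fS, of "pi * (1 + M\<^sup>2)"] by simp
      fix t assume "t \<in> ?S"
      then have "(cay t)\<^sup>2 \<le> M\<^sup>2" by (intro power2_le_iff_abs_le[THEN iffD2]) (use a in auto)
      then have "\<bar>pi * (1 + (cay t)\<^sup>2)\<bar> \<le> pi * (1 + M\<^sup>2)" by (simp add: abs_mult)
      then show "\<bar>pi * (1 + (cay t)\<^sup>2)\<bar> * f (cay t) \<le> pi * (1 + M\<^sup>2) * f (cay t)" using f0 by (rule mult_right_mono)
    qed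
    also have "\<dots> = pi * (1 + M\<^sup>2) * integral ?S (\<lambda>t. f (cay t))" by (simp only: integral_mult_right)
    also have "\<dots> \<le> pi * (1 + M\<^sup>2) * (4 * (\<Sum>k\<in>K. (cmod (c k))\<^sup>2))"
    proof (rule mult_left_mono)
      have "integral ?S (\<lambda>t. f (cay t)) \<le> integral {0<..<1} (\<lambda>t. f (cay t))"
        using f0 by (intro integral_subset_le fS fi) auto
      also have "\<dots> \<le> 4 * (\<Sum>k\<in>?K. (cmod (c (k * \<delta>)))\<^sup>2)" unfolding f_def using K' K(1) by auto
      finally show "integral ?S (\<lambda>t. f (cay t)) \<le> 4 * (\<Sum>k\<in>K. (cmod (c k))\<^sup>2)"
        using scaled_exp_sum(2)[OF K(1) assms(1), of c] by simp
    qed (auto simp: add_nonneg_nonneg)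
    finally have b: "integral {- M..M} f \<le> pi * (1 + M\<^sup>2) * (4 * (\<Sum>k\<in>K. (cmod (c k))\<^sup>2))" .
    have "a * integral {- L..L} (\<lambda>x. f (a * x)) = integral {- M..M} f"
      using integral_scale[of "{- L..L}" a f] a fc f0 img by simp
    moreover have "f (a * x) = (cmod (\<Sum>k\<in>K. c k * expo k x))\<^sup>2" for x
      using scaled_exp_sum(1)[OF K(1) assms(1), of c x] by (simp add: f_def a_def)
    ultimately have "a * integral {- L..L} (\<lambda>x. (cmod (\<Sum>k\<in>K. c k * expo k x))\<^sup>2) = integral {- M..M} f" by simp
    then show ?thesis using b a by (simp add: C_def field_simps)
  qed
  then show ?thesis using C by blast
qed

text \<open>Inner regularity yields a compact subset with more than half of the measure of \<Omega>;
  restricting a nonnegative integrand to it loses nothing in a lower bound. Dilation by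
  \<open>2 * pi * \<delta>\<close> brings the gap to 1.\<close>

lemma exp_sum_lower_bound:
  assumes "bounded \<Omega>" "\<Omega> \<in> sets lebesgue" "0 < emeasure lebesgue \<Omega>" "\<delta> > 0"
  shows "\<exists>\<epsilon>>0. \<forall>K c. finite K \<and> separated \<delta> K \<and> K \<subseteq> {\<delta>..} \<and> (\<Sum>k\<in>K. (cmod (c k))\<^sup>2) \<le> 1 \<longrightarrow>
    \<epsilon> \<le> (LINT x|lebesgue_on \<Omega>. (cmod (1 + (\<Sum>k\<in>K. c k * expo k x)))\<^sup>2)"
proof -
  have lm: "\<Omega> \<in> lmeasurable" using assms(1,2) by (rule bounded_set_imp_lmeasurable)
  have m: "0 < measure lebesgue \<Omega>" using assms(3) emeasure_eq_measure2[OF lm] by simp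
  obtain E where E: "closed E" "E \<subseteq> \<Omega>" "\<Omega> - E \<in> lmeasurable" "emeasure lebesgue (\<Omega> - E) < ennreal (measure lebesgue \<Omega> / 2)"
    using sets_lebesgue_inner_closed[OF assms(2), of "measure lebesgue \<Omega> / 2"] m by auto
  have cE: "compact E" using E(1,2) assms(1) bounded_subset compact_eq_bounded_closed by blast
  have mE: "0 < measure lebesgue E"
  proof -
    have "measure lebesgue (\<Omega> - E) < measure lebesgue \<Omega> / 2"
      using E(4) m emeasure_eq_measure2[OF E(3)] by (simp add: ennreal_less_iff)
    moreover have "measure lebesgue (\<Omega> - E) = measure lebesgue \<Omega> - measure lebesgue E"
      using E(2) lm lmeasurable_compact[OF cE] by (intro measurable_measure_Diff) (auto simp: fmeasurableD)
    ultimately show ?thesis using m by linarith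
  qed
  define a where "a = 2 * pi * \<delta>"
  have a: "a > 0" using assms by (simp add: a_def)
  have cE': "compact ((*) a ` E)" using cE by (intro compact_continuous_image continuous_intros)
  have "0 < measure lebesgue ((*) a ` E)"
  proof -
    have "integral ((*) a ` E) (\<lambda>x. 1) = a * integral E (\<lambda>x. 1)"
      using integral_scale[OF cE a, of "\<lambda>_. 1"] by simp
    then show ?thesis using mE a lmeasure_integral[OF lmeasurable_compact[OF cE]] lmeasure_integral[OF lmeasurable_compact[OF cE']]
      by simp
  qed
  from exp_sum_lower_bound_compact[OF cE' this] obtain \<epsilon> where e: "\<epsilon> > 0"
    "\<And>K c. finite K \<Longrightarrow> separated 1 K \<Longrightarrow> K \<subseteq> {1..} \<Longrightarrow> (\<Sum>k\<in>K. (cmod (c k))\<^sup>2) \<le> 1 \<Longrightarrow>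
       \<epsilon> \<le> integral ((*) a ` E) (\<lambda>x. (cmod (1 + (\<Sum>k\<in>K. c k * exp (\<i> * of_real (k * x)))))\<^sup>2)" by blast
  have "\<epsilon> / a \<le> (LINT x|lebesgue_on \<Omega>. (cmod (1 + (\<Sum>k\<in>K. c k * expo k x)))\<^sup>2)"
    if K: "finite K" "separated \<delta> K" "K \<subseteq> {\<delta>..}" "(\<Sum>k\<in>K. (cmod (c k))\<^sup>2) \<le> 1" for K c
  proof -
    let ?K = "(\<lambda>k. k / \<delta>) ` K"
    let ?g = "\<lambda>x. (cmod (1 + (\<Sum>k\<in>K. c k * expo k x)))\<^sup>2"
    define f where "f = (\<lambda>y. (cmod (1 + (\<Sum>k\<in>?K. c (k * \<delta>) * exp (\<i> * of_real (k * y)))))\<^sup>2)"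
    have gc: "continuous_on A ?g" for A by (intro continuous_intros expo_continuous)
    obtain B where B: "\<Omega> \<subseteq> cbox (-B) B" using bounded_subset_cbox_symmetric[OF assms(1)] by auto
    have "?g absolutely_integrable_on cbox (-B) B"
      by (intro nonnegative_absolutely_integrable_1 integrable_on_compact gc) auto
    from this assms(2) B have gabs: "?g absolutely_integrable_on \<Omega>" by (rule set_integrable_subset)
    have "\<epsilon> \<le> integral ((*) a ` E) f" unfolding f_def
    proof (rule e(2))
      show "?K \<subseteq> {1..}" using K(3) assms(4) by auto
    qed (use K separated_scale[OF K(2) assms(4)] scaled_exp_sum(2)[OF K(1) assms(4), of c] in auto)
    also have "integral ((*) a ` E) f = a * integral E (\<lambda>x. f (a * x))"
      unfolding f_def by (rule integral_scale[OF cE a]) (auto intro!: continuous_intros)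
    also have "(\<lambda>x. f (a * x)) = ?g"
      using scaled_exp_sum(1)[OF K(1) assms(4), of c] by (simp add: f_def a_def)
    also have "integral E ?g \<le> integral \<Omega> ?g"
      by (intro integral_subset_le[OF E(2) integrable_on_compact[OF cE gc]] set_lebesgue_integral_eq_integral(1)[OF gabs]) auto
    finally have "\<epsilon> \<le> a * integral \<Omega> ?g" using a by simp
    moreover have "(LINT x|lebesgue_on \<Omega>. ?g x) = integral \<Omega> ?g"
      using gabs assms(2) by (intro lebesgue_integral_eq_integral) (simp_all add: integrable_restrict_space set_integrable_def)
    ultimately show ?thesis using a by (simp add: field_simps)
  qed
  then show ?thesis using e(1) a by (intro exI[of _ "\<epsilon> / a"]) auto
qed

section \<open>Bessel inequality and large sieve\<close>

text \<open>The functions that occur are exponentials, indicators and finite combinations or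
  products of such. This class is closed under these operations and integrable on finite measure
  spaces, which removes integrability questions from the Hilbert space arguments.\<close>

definition bounded_meas :: "'a measure \<Rightarrow> ('a \<Rightarrow> complex) \<Rightarrow> bool" where
  "bounded_meas M f \<longleftrightarrow> f \<in> borel_measurable M \<and> (\<exists>B. \<forall>x\<in>space M. cmod (f x) \<le> B)"

definition inn :: "'a measure \<Rightarrow> ('a \<Rightarrow> complex) \<Rightarrow> ('a \<Rightarrow> complex) \<Rightarrow> complex" where
  "inn M f g = (LINT x|M. f x * cnj (g x))"

definition nsq :: "'a measure \<Rightarrow> ('a \<Rightarrow> complex) \<Rightarrow> real" where
  "nsq M f = (LINT x|M. (cmod (f x))\<^sup>2)"

lemma bounded_measI: "f \<in> borel_measurable M \<Longrightarrow> (\<And>x. x \<in> space M \<Longrightarrow> cmod (f x) \<le> B) \<Longrightarrow> bounded_meas M f"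
  by (auto simp: bounded_meas_def)

lemma bounded_meas_mult:
  assumes "bounded_meas M f" "bounded_meas M g"
  shows "bounded_meas M (\<lambda>x. f x * g x)"
proof -
  obtain B C where "\<forall>x\<in>space M. cmod (f x) \<le> B" "\<forall>x\<in>space M. cmod (g x) \<le> C"
    using assms by (auto simp: bounded_meas_def)
  then have "cmod (f x * g x) \<le> \<bar>B\<bar> * \<bar>C\<bar>" if "x \<in> space M" for x
    unfolding norm_mult using that by (intro mult_mono) (auto intro: order_trans[OF _ abs_ge_self])
  then show ?thesis using assms by (intro bounded_measI[where B = "\<bar>B\<bar> * \<bar>C\<bar>"]) (auto simp: bounded_meas_def)
qed

lemma bounded_meas_add:
  assumes "bounded_meas M f" "bounded_meas M g"
  shows "bounded_meas M (\<lambda>x. f x + g x)"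
proof -
  obtain B C where "\<forall>x\<in>space M. cmod (f x) \<le> B" "\<forall>x\<in>space M. cmod (g x) \<le> C"
    using assms by (auto simp: bounded_meas_def)
  then have "cmod (f x + g x) \<le> B + C" if "x \<in> space M" for x
    using that norm_triangle_mono by blast
  then show ?thesis using assms by (intro bounded_measI[where B = "B + C"]) (auto simp: bounded_meas_def)
qed

lemma bounded_meas_const: "bounded_meas M (\<lambda>x. c)" by (rule bounded_measI[where B = "cmod c"]) auto

lemma bounded_meas_cnj: "bounded_meas M f \<Longrightarrow> bounded_meas M (\<lambda>x. cnj (f x))"
  unfolding bounded_meas_def
  using measurable_compose[OF _ borel_measurable_continuous_onI[OF continuous_on_cnj[OF continuous_on_id]], of f M] by auto

lemma bounded_meas_diff: "bounded_meas M f \<Longrightarrow> bounded_meas M g \<Longrightarrow> bounded_meas M (\<lambda>x. f x - g x)"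
  using bounded_meas_add[OF _ bounded_meas_mult[OF bounded_meas_const[of _ "-1"]], of M f g] by simp

lemma bounded_meas_sum:
  "(\<And>i. i \<in> I \<Longrightarrow> bounded_meas M (f i)) \<Longrightarrow> bounded_meas M (\<lambda>x. \<Sum>i\<in>I. f i x)"
  by (induction I rule: infinite_finite_induct) (auto intro: bounded_meas_const bounded_meas_add)

lemma bounded_meas_integrable:
  "finite_measure M \<Longrightarrow> bounded_meas M f \<Longrightarrow> integrable M f"
  by (auto simp: bounded_meas_def intro: finite_measure.integrable_const_bound)

lemma bounded_meas_sq_integrable:
  assumes "finite_measure M" "bounded_meas M f"
  shows "integrable M (\<lambda>x. (cmod (f x))\<^sup>2)"
proof -
  have "integrable M (\<lambda>x. Re (f x * cnj (f x)))"
    using assms by (intro integrable_Re bounded_meas_integrable bounded_meas_mult bounded_meas_cnj)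
  moreover have "Re (f x * cnj (f x)) = (cmod (f x))\<^sup>2" for x
    using complex_norm_square[of "f x"] by (metis Re_complex_of_real)
  ultimately show ?thesis by simp
qed

lemma inn_self: "finite_measure M \<Longrightarrow> bounded_meas M f \<Longrightarrow> inn M f f = of_real (nsq M f)"
  unfolding inn_def nsq_def complex_norm_square[symmetric] by (rule integral_complex_of_real)

lemma nsq_nonneg: "0 \<le> nsq M f" by (simp add: nsq_def)

lemma nsq_diff:
  assumes M: "finite_measure M" and f: "bounded_meas M f" and g: "bounded_meas M g"
  shows "nsq M (\<lambda>x. f x - g x) = nsq M f - 2 * Re (inn M f g) + nsq M g"
proof -
  define h where "h = (\<lambda>x. Re (f x * cnj (g x)))"
  have i: "integrable M (\<lambda>x. f x * cnj (g x))"
    by (intro bounded_meas_integrable M bounded_meas_mult bounded_meas_cnj f g)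
  have h: "integrable M h" "(LINT x|M. h x) = Re (inn M f g)"
    unfolding h_def inn_def by (intro integrable_Re i, intro integral_Re i)
  have pt: "(cmod (f x - g x))\<^sup>2 = (cmod (f x))\<^sup>2 - 2 * h x + (cmod (g x))\<^sup>2" for x
    unfolding cmod_power2 h_def by (simp add: power2_eq_square algebra_simps)
  show ?thesis
    unfolding nsq_def pt h(2)[symmetric]
    using bounded_meas_sq_integrable[OF M f] bounded_meas_sq_integrable[OF M g] h(1) by simp
qed

lemma inn_sum_right:
  assumes M: "finite_measure M" and f: "bounded_meas M f" and e: "\<And>k. k \<in> K \<Longrightarrow> bounded_meas M (e k)"
  shows "inn M f (\<lambda>x. \<Sum>k\<in>K. c k * e k x) = (\<Sum>k\<in>K. cnj (c k) * inn M f (e k))"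
proof -
  have i: "integrable M (\<lambda>x. f x * cnj (e k x))" if "k \<in> K" for k
    by (intro bounded_meas_integrable M bounded_meas_mult bounded_meas_cnj f e that)
  have "inn M f (\<lambda>x. \<Sum>k\<in>K. c k * e k x) = (LINT x|M. (\<Sum>k\<in>K. cnj (c k) * (f x * cnj (e k x))))"
    by (simp add: inn_def sum_distrib_left mult_ac)
  also have "\<dots> = (\<Sum>k\<in>K. LINT x|M. cnj (c k) * (f x * cnj (e k x)))"
    using i by (intro Bochner_Integration.integral_sum) auto
  finally show ?thesis by (simp add: inn_def)
qed

lemma inn_commute: "inn M g f = cnj (inn M f g)"
proof -
  have "g x * cnj (f x) = cnj (f x * cnj (g x))" for x by simp
  then show ?thesis unfolding inn_def by (simp only: Bochner_Integration.integral_cnj)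
qed

lemma inn_sum_left:
  assumes M: "finite_measure M" and f: "bounded_meas M f" and e: "\<And>k. k \<in> K \<Longrightarrow> bounded_meas M (e k)"
  shows "inn M (\<lambda>x. \<Sum>k\<in>K. c k * e k x) f = (\<Sum>k\<in>K. c k * inn M (e k) f)"
  using inn_sum_right[OF M f e, where K = K and c = c] unfolding inn_commute[of M "\<lambda>x. \<Sum>k\<in>K. c k * e k x"]
  by (simp add: cnj_sum inn_commute[of M _ f])

text \<open>The common square norm \<open>s\<close> is 1 on \<Omega> and \<open>1 / p\<close> on an
  interval of that length.\<close>

lemma nsq_orthonormal_sum:
  assumes M: "finite_measure M" and K: "finite K" and e: "\<And>k. k \<in> K \<Longrightarrow> bounded_meas M (e k)"
    and on: "\<And>k l. k \<in> K \<Longrightarrow> l \<in> K \<Longrightarrow> inn M (e k) (e l) = (if k = l then of_real s else 0)"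
  shows "nsq M (\<lambda>x. \<Sum>k\<in>K. c k * e k x) = s * (\<Sum>k\<in>K. (cmod (c k))\<^sup>2)"
proof -
  have b: "bounded_meas M (\<lambda>x. \<Sum>k\<in>K. c k * e k x)"
    by (intro bounded_meas_sum bounded_meas_mult bounded_meas_const e)
  have "complex_of_real (nsq M (\<lambda>x. \<Sum>k\<in>K. c k * e k x)) = (\<Sum>k\<in>K. c k * inn M (e k) (\<lambda>x. \<Sum>k\<in>K. c k * e k x))"
    using inn_sum_left[OF M b e, where K = K and c = c] inn_self[OF M b] by simp
  also have "\<dots> = (\<Sum>k\<in>K. c k * (\<Sum>l\<in>K. cnj (c l) * inn M (e k) (e l)))"
    using inn_sum_right[OF M e e, where K = K and c = c] by (intro sum.cong refl) simp
  also have "\<dots> = (\<Sum>k\<in>K. c k * (\<Sum>l\<in>K. if k = l then cnj (c l) * of_real s else 0))"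
    by (intro sum.cong refl arg_cong2[where f = "(*)"]) (auto simp: on)
  also have "\<dots> = (\<Sum>k\<in>K. of_real (s * (cmod (c k))\<^sup>2))"
    using K by (intro sum.cong refl) (simp add: complex_norm_square[symmetric] mult_ac flip: of_real_power)
  also have "\<dots> = of_real (s * (\<Sum>k\<in>K. (cmod (c k))\<^sup>2))" by (simp add: sum_distrib_left)
  finally show ?thesis using of_real_eq_iff by blast
qed

text \<open>Completing the square: the last sum is the loss from using coefficients other than the
  Fourier coefficients.\<close>

lemma nsq_diff_orthonormal_sum:
  assumes M: "finite_measure M" and K: "finite K" and f: "bounded_meas M f" and e: "\<And>k. k \<in> K \<Longrightarrow> bounded_meas M (e k)"
    and on: "\<And>k l. k \<in> K \<Longrightarrow> l \<in> K \<Longrightarrow> inn M (e k) (e l) = (if k = l then 1 else 0)"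
  shows "nsq M (\<lambda>x. f x - (\<Sum>k\<in>K. c k * e k x))
    = nsq M f - (\<Sum>k\<in>K. (cmod (inn M f (e k)))\<^sup>2) + (\<Sum>k\<in>K. (cmod (c k - inn M f (e k)))\<^sup>2)"
proof -
  have b: "bounded_meas M (\<lambda>x. \<Sum>k\<in>K. c k * e k x)"
    by (intro bounded_meas_sum bounded_meas_mult bounded_meas_const e)
  have "(cmod (c k - a))\<^sup>2 = (cmod (c k))\<^sup>2 - 2 * Re (cnj (c k) * a) + (cmod a)\<^sup>2" for k a
    unfolding cmod_power2 by (simp add: power2_eq_square algebra_simps)
  then show ?thesis
    using nsq_diff[OF M f b] nsq_orthonormal_sum[OF M K e, where s = 1 and c = c] inn_sum_right[OF M f e, where K = K and c = c] on
    by (simp add: sum.distrib sum_subtractf sum_distrib_left)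
qed

text \<open>A bound for the map from coefficients to functions passes to its adjoint. It is obtained
  by expanding the nonnegative square norm of \<open>f\<close> minus the combination with
  coefficients \<open>inn M f (e k) / C\<close>.\<close>

lemma dual_sieve:
  assumes M: "finite_measure M" and K: "finite K" and f: "bounded_meas M f" and e: "\<And>k. k \<in> K \<Longrightarrow> bounded_meas M (e k)"
    and C: "C > 0" "\<And>c. nsq M (\<lambda>x. \<Sum>k\<in>K. c k * e k x) \<le> C * (\<Sum>k\<in>K. (cmod (c k))\<^sup>2)"
  shows "(\<Sum>k\<in>K. (cmod (inn M f (e k)))\<^sup>2) \<le> C * nsq M f"
proof -
  define c where "c = (\<lambda>k. of_real (1 / C) * inn M f (e k))"
  define A where "A = (\<Sum>k\<in>K. (cmod (inn M f (e k)))\<^sup>2)"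
  have b: "bounded_meas M (\<lambda>x. \<Sum>k\<in>K. c k * e k x)"
    by (intro bounded_meas_sum bounded_meas_mult bounded_meas_const e)
  have "Re (cnj (c k) * inn M f (e k)) = (1 / C) * (cmod (inn M f (e k)))\<^sup>2" for k
    unfolding c_def cmod_power2 by (simp add: power2_eq_square algebra_simps add_divide_distrib)
  then have 1: "Re (inn M f (\<lambda>x. \<Sum>k\<in>K. c k * e k x)) = A / C"
    using inn_sum_right[OF M f e, where K = K and c = c] by (simp add: A_def sum_distrib_left sum_divide_distrib)
  have "(\<Sum>k\<in>K. (cmod (c k))\<^sup>2) = A / C\<^sup>2"
    using C(1) by (simp add: A_def c_def norm_mult norm_divide power_mult_distrib power_divide sum_divide_distrib)
  then have 2: "nsq M (\<lambda>x. \<Sum>k\<in>K. c k * e k x) \<le> A / C" using C(2)[of c] C(1) by (simp add: power2_eq_square)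
  have "0 \<le> nsq M f - 2 * (A / C) + A / C"
    using nsq_diff[OF M f b] nsq_nonneg[of M "\<lambda>x. f x - (\<Sum>k\<in>K. c k * e k x)"] 1 2 by linarith
  then show ?thesis using C(1) by (simp add: A_def field_simps)
qed

lemma bounded_meas_expo: "S \<in> sets lebesgue \<Longrightarrow> bounded_meas (lebesgue_on S) (expo k)"
  using continuous_imp_measurable_on_sets_lebesgue[OF expo_continuous]
  by (intro bounded_measI[where B = 1]) (auto simp: expo_simps)

text \<open>Dual to \<open>exp_sum_upper_bound\<close>. The constant is the same for all subsets
  \<open>S\<close> of the interval; for the function 1 on \<open>S\<close> the right-hand side
  becomes \<open>C\<close> times the measure of \<open>S\<close>.\<close>

lemma large_sieve:
  assumes "\<delta> > 0" "L > 0"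
  shows "\<exists>C>0. \<forall>K S f. finite K \<and> separated \<delta> K \<and> S \<in> sets lebesgue \<and> S \<subseteq> {- L..L} \<and> bounded_meas (lebesgue_on S) f \<longrightarrow>
    (\<Sum>k\<in>K. (cmod (inn (lebesgue_on S) f (expo k)))\<^sup>2) \<le> C * nsq (lebesgue_on S) f"
proof -
  obtain C where C: "C > 0" "\<And>K c. finite K \<Longrightarrow> separated \<delta> K \<Longrightarrow>
     integral {- L..L} (\<lambda>x. (cmod (\<Sum>k\<in>K. c k * expo k x))\<^sup>2) \<le> C * (\<Sum>k\<in>K. (cmod (c k))\<^sup>2)"
    using exp_sum_upper_bound[OF assms] by blast
  have "(\<Sum>k\<in>K. (cmod (inn (lebesgue_on S) f (expo k)))\<^sup>2) \<le> C * nsq (lebesgue_on S) f"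
    if h: "finite K" "separated \<delta> K" "S \<in> sets lebesgue" "S \<subseteq> {- L..L}" "bounded_meas (lebesgue_on S) f" for K S f
  proof (rule dual_sieve[OF _ h(1,5) bounded_meas_expo[OF h(3)] C(1)])
    have Sl: "S \<in> lmeasurable" using h(3,4) bounded_subset[OF bounded_closed_interval] by (intro bounded_set_imp_lmeasurable) auto
    then show fm: "finite_measure (lebesgue_on S)" by (rule finite_measure_lebesgue_on)
    fix c
    let ?g = "\<lambda>x. (cmod (\<Sum>k\<in>K. c k * expo k x))\<^sup>2"
    have gc: "continuous_on A ?g" for A by (intro continuous_intros expo_continuous)
    have bm: "bounded_meas (lebesgue_on S) (\<lambda>x. \<Sum>k\<in>K. c k * expo k x)"
      by (rule bounded_meas_sum, rule bounded_meas_mult[OF bounded_meas_const bounded_meas_expo[OF h(3)]])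
    have gi: "?g integrable_on {- L..L}" by (intro integrable_on_compact gc) auto
    have "nsq (lebesgue_on S) (\<lambda>x. \<Sum>k\<in>K. c k * expo k x) = integral S ?g"
      unfolding nsq_def by (rule lebesgue_integral_eq_integral[OF bounded_meas_sq_integrable[OF fm bm] h(3)])
    also have "\<dots> \<le> integral {- L..L} ?g"
    proof (rule integral_subset_le[OF h(4) _ gi])
      have "?g absolutely_integrable_on {- L..L}" by (rule nonnegative_absolutely_integrable_1[OF gi]) simp
      from this h(3,4) show "?g integrable_on S"
        by (rule set_lebesgue_integral_eq_integral(1)[OF set_integrable_subset])
    qed auto
    also have "\<dots> \<le> C * (\<Sum>k\<in>K. (cmod (c k))\<^sup>2)" using C(2) h by blast
    finally show "nsq (lebesgue_on S) (\<lambda>x. \<Sum>k\<in>K. c k * expo k x) \<le> C * (\<Sum>k\<in>K. (cmod (c k))\<^sup>2)" .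
  qed
  then show ?thesis using C(1) by blast
qed

section \<open>Fourier tails along separated frequencies\<close>

text \<open>A square-summable form of the Riemann--Lebesgue lemma, uniform over all frequency sets
  with gap \<delta>: the threshold \<open>R\<close> is chosen before \<open>K\<close>.\<close>

definition tail_small :: "real \<Rightarrow> real set \<Rightarrow> bool" where
  "tail_small \<delta> S \<longleftrightarrow> (\<forall>\<epsilon>>0. \<exists>R>0. \<forall>K. finite K \<and> separated \<delta> K \<and> (\<forall>t\<in>K. R \<le> \<bar>t\<bar>) \<longrightarrow>
     (\<Sum>t\<in>K. (cmod (integral S (expo t)))\<^sup>2) \<le> \<epsilon>)"

lemma tail_smallE:
  assumes "tail_small \<delta> S" "0 < \<epsilon>"
  obtains R where "R > 0" "\<And>K. finite K \<Longrightarrow> separated \<delta> K \<Longrightarrow> (\<forall>t\<in>K. R \<le> \<bar>t\<bar>) \<Longrightarrow> (\<Sum>t\<in>K. (cmod (integral S (expo t)))\<^sup>2) \<le> \<epsilon>"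
proof -
  from assms(1)[unfolded tail_small_def, rule_format, OF assms(2)]
  obtain R where "R > 0" "\<forall>K. finite K \<and> separated \<delta> K \<and> (\<forall>t\<in>K. R \<le> \<bar>t\<bar>) \<longrightarrow> (\<Sum>t\<in>K. (cmod (integral S (expo t)))\<^sup>2) \<le> \<epsilon>"
    by (elim exE conjE)
  then show thesis by (intro that[of R]) simp_all
qed

text \<open>Assuming only a triangle inequality covers sums as well as differences of integrals.
  Each set gets \<open>\<epsilon> / 4\<close> because
  \<open>(a + b)\<^sup>2 \<le> 2 a\<^sup>2 + 2 b\<^sup>2\<close>.\<close>

lemma tail_small_add:
  assumes "tail_small \<delta> S" "tail_small \<delta> T"
    and le: "\<And>t. cmod (integral V (expo t)) \<le> cmod (integral S (expo t)) + cmod (integral T (expo t))"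
  shows "tail_small \<delta> V"
  unfolding tail_small_def
proof (intro allI impI)
  fix \<epsilon> :: real assume "\<epsilon> > 0"
  then have e: "\<epsilon> / 4 > 0" by simp
  obtain R1 where R1: "R1 > 0" "\<And>K. finite K \<Longrightarrow> separated \<delta> K \<Longrightarrow> (\<forall>t\<in>K. R1 \<le> \<bar>t\<bar>) \<Longrightarrow> (\<Sum>t\<in>K. (cmod (integral S (expo t)))\<^sup>2) \<le> \<epsilon> / 4"
    using tail_smallE[OF assms(1) e] by metis
  obtain R2 where R2: "R2 > 0" "\<And>K. finite K \<Longrightarrow> separated \<delta> K \<Longrightarrow> (\<forall>t\<in>K. R2 \<le> \<bar>t\<bar>) \<Longrightarrow> (\<Sum>t\<in>K. (cmod (integral T (expo t)))\<^sup>2) \<le> \<epsilon> / 4"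
    using tail_smallE[OF assms(2) e] by metis
  show "\<exists>R>0. \<forall>K. finite K \<and> separated \<delta> K \<and> (\<forall>t\<in>K. R \<le> \<bar>t\<bar>) \<longrightarrow> (\<Sum>t\<in>K. (cmod (integral V (expo t)))\<^sup>2) \<le> \<epsilon>"
  proof (intro exI[of _ "max R1 R2"] conjI allI impI)
    fix K assume K: "finite K \<and> separated \<delta> K \<and> (\<forall>t\<in>K. max R1 R2 \<le> \<bar>t\<bar>)"
    have "(cmod (integral V (expo t)))\<^sup>2 \<le> 2 * (cmod (integral S (expo t)))\<^sup>2 + 2 * (cmod (integral T (expo t)))\<^sup>2" for t
    proof -
      define a b where "a = cmod (integral S (expo t))" and "b = cmod (integral T (expo t))"
      have "(cmod (integral V (expo t)))\<^sup>2 \<le> (a + b)\<^sup>2" using le[of t] by (intro power_mono) (auto simp: a_def b_def)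
      also have "\<dots> \<le> 2 * a\<^sup>2 + 2 * b\<^sup>2" using zero_le_power2[of "a - b"] by (simp add: power2_eq_square algebra_simps)
      finally show ?thesis by (simp add: a_def b_def)
    qed
    then have "(\<Sum>t\<in>K. (cmod (integral V (expo t)))\<^sup>2) \<le> 2 * (\<Sum>t\<in>K. (cmod (integral S (expo t)))\<^sup>2) + 2 * (\<Sum>t\<in>K. (cmod (integral T (expo t)))\<^sup>2)"
      unfolding sum_distrib_left sum.distrib[symmetric] by (intro sum_mono)
    also have "\<dots> \<le> 2 * (\<epsilon> / 4) + 2 * (\<epsilon> / 4)" using K by (intro add_mono mult_left_mono R1(2) R2(2)) auto
    finally show "(\<Sum>t\<in>K. (cmod (integral V (expo t)))\<^sup>2) \<le> \<epsilon>" by simp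
  qed (use R1 R2 in auto)
qed

lemma separated_inverse_square_tail:
  assumes "\<delta> > 0" "\<epsilon> > 0"
  shows "\<exists>R>0. \<forall>K. finite K \<and> separated \<delta> K \<and> (\<forall>t\<in>K. R \<le> \<bar>t\<bar>) \<longrightarrow> (\<Sum>t\<in>K. 1 / t\<^sup>2) \<le> \<epsilon>"
proof -
  define f where "f = (\<lambda>n::nat. 1 / (real n)\<^sup>2)"
  have sf: "summable f" using inverse_power_summable[of 2, where 'a = real] by (simp add: f_def inverse_eq_divide)
  have e: "\<epsilon> * \<delta>\<^sup>2 / 2 > 0" using assms by simp
  obtain n0 where n0: "\<And>n. n \<ge> n0 \<Longrightarrow> norm (\<Sum>i. f (i + n)) < \<epsilon> * \<delta>\<^sup>2 / 2"
    using suminf_exist_split[OF e sf] by auto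
  \<comment> \<open>\<open>N\<close> is positive, so no denominator vanishes. With the first
    \<open>N\<close> terms set to 0, the bound of \<open>separated_sum\<close> by the whole series
    of \<open>h\<close> becomes a bound by a tail of the series of inverse squares.\<close>
  define N where "N = Suc n0"
  define h where "h = (\<lambda>n. if n < N then 0 else f n)"
  have hs: "summable h" by (rule summable_comparison_test'[OF sf, of 0]) (auto simp: h_def f_def)
  have "suminf h = (\<Sum>i. h (i + N)) + (\<Sum>i<N. h i)" by (rule suminf_split_initial_segment[OF hs])
  also have "(\<Sum>i<N. h i) = 0" by (intro sum.neutral) (auto simp: h_def)
  also have "(\<Sum>i. h (i + N)) = (\<Sum>i. f (i + N))" by (simp add: h_def)
  finally have hb: "suminf h \<le> \<epsilon> * \<delta>\<^sup>2 / 2" using n0[of N] by (simp add: N_def)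
  show ?thesis
  proof (intro exI[of _ "\<delta> * real N"] conjI allI impI)
    fix K assume K: "finite K \<and> separated \<delta> K \<and> (\<forall>t\<in>K. \<delta> * real N \<le> \<bar>t\<bar>)"
    have inj: "inj_on (\<lambda>k. k / \<delta>) K" using assms by (auto simp: inj_on_def)
    have "(\<Sum>t\<in>K. 1 / t\<^sup>2) \<le> (\<Sum>t\<in>K. 1 / \<delta>\<^sup>2 * h (nat \<lfloor>\<bar>t / \<delta> - 0\<bar>\<rfloor>))"
    proof (rule sum_mono)
      fix t assume "t \<in> K"
      then have "real N \<le> \<bar>t / \<delta>\<bar>" using K assms by (auto simp: field_simps)
      then have fl: "N \<le> nat \<lfloor>\<bar>t / \<delta>\<bar>\<rfloor>" by (simp add: le_nat_floor)
      have "real (nat \<lfloor>\<bar>t / \<delta>\<bar>\<rfloor>) \<le> \<bar>t / \<delta>\<bar>" by simp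
      then have "(real (nat \<lfloor>\<bar>t / \<delta>\<bar>\<rfloor>))\<^sup>2 \<le> (\<bar>t / \<delta>\<bar>)\<^sup>2" by (intro power_mono) auto
      moreover have "0 < real (nat \<lfloor>\<bar>t / \<delta>\<bar>\<rfloor>)" using fl unfolding N_def by linarith
      then have "0 < (real (nat \<lfloor>\<bar>t / \<delta>\<bar>\<rfloor>))\<^sup>2" by (rule zero_less_power)
      ultimately have "1 / (\<bar>t / \<delta>\<bar>)\<^sup>2 \<le> f (nat \<lfloor>\<bar>t / \<delta>\<bar>\<rfloor>)" unfolding f_def by (intro frac_le) auto
      moreover have "1 / (\<bar>t / \<delta>\<bar>)\<^sup>2 = \<delta>\<^sup>2 * (1 / t\<^sup>2)" using assms by (simp add: power_divide)
      ultimately show "1 / t\<^sup>2 \<le> 1 / \<delta>\<^sup>2 * h (nat \<lfloor>\<bar>t / \<delta> - 0\<bar>\<rfloor>)"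
        using fl assms by (simp add: h_def field_simps)
    qed
    also have "\<dots> = 1 / \<delta>\<^sup>2 * (\<Sum>u\<in>(\<lambda>k. k / \<delta>) ` K. h (nat \<lfloor>\<bar>u - 0\<bar>\<rfloor>))"
      by (simp add: sum.reindex[OF inj] sum_distrib_left)
    also have "\<dots> \<le> 1 / \<delta>\<^sup>2 * (2 * suminf h)"
      using K assms by (intro mult_left_mono separated_sum separated_scale hs) (auto simp: h_def f_def)
    also have "\<dots> \<le> 1 / \<delta>\<^sup>2 * (2 * (\<epsilon> * \<delta>\<^sup>2 / 2))" using hb by (intro mult_left_mono) auto
    finally show "(\<Sum>t\<in>K. 1 / t\<^sup>2) \<le> \<epsilon>" using assms by simp
  qed (use assms in \<open>simp add: N_def\<close>)
qed

lemma expo_has_integral: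
  assumes "t \<noteq> 0" "a \<le> b"
  shows "(expo t has_integral (expo t b - expo t a) / (2 * of_real pi * \<i> * of_real t)) {a..b}"
proof -
  define q where "q = 2 * of_real pi * \<i> * complex_of_real t"
  have q: "q \<noteq> 0" using assms by (simp add: q_def)
  have "(expo t has_integral (expo t b / q - expo t a / q)) {a..b}"
  proof (rule fundamental_theorem_of_calculus[OF assms(2)])
    fix x
    have "((\<lambda>z. exp (q * z) / q) has_field_derivative exp (q * of_real x)) (at (of_real x))"
      using q by (auto intro!: derivative_eq_intros)
    from has_vector_derivative_real_field[OF this] show "((\<lambda>x. expo t x / q) has_vector_derivative expo t x) (at x within {a..b})"
      by (simp add: expo_def q_def)
  qed
  then show ?thesis by (simp add: q_def diff_divide_distrib)
qed

lemma integral_expo_interval: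
  assumes "t \<noteq> 0"
  shows "cmod (integral {a..b} (expo t)) \<le> 1 / \<bar>t\<bar>"
proof (cases "a \<le> b")
  case True
  have "cmod (integral {a..b} (expo t)) = cmod (expo t b - expo t a) / (2 * pi * \<bar>t\<bar>)"
    using expo_has_integral[OF assms True] by (simp add: integral_unique norm_divide norm_mult)
  also have "\<dots> \<le> 2 / (2 * pi * \<bar>t\<bar>)"
    using norm_triangle_ineq4[of "expo t b" "expo t a"] by (intro divide_right_mono) (auto simp: expo_simps)
  also have "\<dots> \<le> 1 / \<bar>t\<bar>" using assms pi_ge_two by (simp add: field_simps)
  finally show ?thesis .
qed auto

lemma tail_small_interval:
  assumes "\<delta> > 0"
  shows "tail_small \<delta> {a..b}"
  unfolding tail_small_def
proof (intro allI impI)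
  fix \<epsilon> :: real assume "\<epsilon> > 0"
  then obtain R where R: "R > 0" "\<And>K. finite K \<Longrightarrow> separated \<delta> K \<Longrightarrow> (\<forall>t\<in>K. R \<le> \<bar>t\<bar>) \<Longrightarrow> (\<Sum>t\<in>K. 1 / t\<^sup>2) \<le> \<epsilon>"
    using separated_inverse_square_tail[OF assms] by metis
  show "\<exists>R>0. \<forall>K. finite K \<and> separated \<delta> K \<and> (\<forall>t\<in>K. R \<le> \<bar>t\<bar>) \<longrightarrow> (\<Sum>t\<in>K. (cmod (integral {a..b} (expo t)))\<^sup>2) \<le> \<epsilon>"
  proof (intro exI[of _ R] conjI allI impI)
    fix K assume K: "finite K \<and> separated \<delta> K \<and> (\<forall>t\<in>K. R \<le> \<bar>t\<bar>)"
    have "(\<Sum>t\<in>K. (cmod (integral {a..b} (expo t)))\<^sup>2) \<le> (\<Sum>t\<in>K. 1 / t\<^sup>2)"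
    proof (rule sum_mono)
      fix t assume "t \<in> K"
      then have "t \<noteq> 0" using K R(1) by force
      from power_mono[OF integral_expo_interval[OF this, of a b] norm_ge_zero, of 2]
      show "(cmod (integral {a..b} (expo t)))\<^sup>2 \<le> 1 / t\<^sup>2" by (simp add: power_divide)
    qed
    also have "\<dots> \<le> \<epsilon>" using R(2) K by blast
    finally show "(\<Sum>t\<in>K. (cmod (integral {a..b} (expo t)))\<^sup>2) \<le> \<epsilon>" .
  qed (rule R(1))
qed

lemma expo_integrable_on:
  assumes "S \<in> lmeasurable"
  shows "expo t integrable_on S"
  using assms by (intro integrable_on_continuous_bounded[OF _ expo_continuous integrable_on_const[of S 1]])
    (auto simp: expo_simps fmeasurableD)

lemma inn_1_expo:
  assumes "S \<in> lmeasurable"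
  shows "inn (lebesgue_on S) (\<lambda>x. 1) (expo t) = integral S (expo (- t))"
proof -
  have "inn (lebesgue_on S) (\<lambda>x. 1) (expo t) = (LINT x|lebesgue_on S. expo (- t) x)"
    by (simp add: inn_def expo_simps)
  also have "\<dots> = integral S (expo (- t))"
    using assms by (intro lebesgue_integral_eq_integral bounded_meas_integrable finite_measure_lebesgue_on bounded_meas_expo)
      (auto simp: fmeasurableD)
  finally show ?thesis .
qed

text \<open>Explicit integration settles intervals. The large sieve bounds the effect of removing a set of
  small measure, so the class of sets with small tails is closed under countable disjoint unions.\<close>

lemma tail_small_lmeasurable:
  assumes "\<delta> > 0" "L > 0" "S \<in> sets lebesgue" "S \<subseteq> {- L..L}"
  shows "tail_small \<delta> S"
proof -
  obtain C where C: "C > 0" "\<And>K S f. finite K \<Longrightarrow> separated \<delta> K \<Longrightarrow> S \<in> sets lebesgue \<Longrightarrow> S \<subseteq> {- L..L} \<Longrightarrow> bounded_meas (lebesgue_on S) f \<Longrightarrow>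
    (\<Sum>k\<in>K. (cmod (inn (lebesgue_on S) f (expo k)))\<^sup>2) \<le> C * nsq (lebesgue_on S) f"
    using large_sieve[OF assms(1,2)] by metis
  have lmI: "T \<in> lmeasurable" if "T \<in> sets lebesgue" "T \<subseteq> {- L..L}" for T
    using that bounded_subset[OF bounded_closed_interval] by (intro bounded_set_imp_lmeasurable) auto
  have sieve: "(\<Sum>t\<in>K. (cmod (integral T (expo t)))\<^sup>2) \<le> C * measure lebesgue T"
    if "finite K" "separated \<delta> K" "T \<in> sets lebesgue" "T \<subseteq> {- L..L}" for K T
  proof -
    have T: "T \<in> lmeasurable" using that lmI by blast
    have "(\<Sum>t\<in>K. (cmod (integral T (expo t)))\<^sup>2) = (\<Sum>t\<in>uminus ` K. (cmod (inn (lebesgue_on T) (\<lambda>x. 1) (expo t)))\<^sup>2)"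
      by (subst sum.reindex) (auto simp: inn_1_expo[OF T])
    also have "\<dots> \<le> C * nsq (lebesgue_on T) (\<lambda>x. 1)"
      using that by (intro C(2) bounded_meas_const) (auto simp: separated_def abs_minus_commute)
    also have "nsq (lebesgue_on T) (\<lambda>x. 1) = measure lebesgue T"
      using T by (simp add: nsq_def measure_restrict_space fmeasurableD)
    finally show ?thesis .
  qed
  let ?I = "{- L..L}"
  have add: "integral (A \<union> B) (expo t) = integral A (expo t) + integral B (expo t)"
    if "A \<in> sets lebesgue" "B \<in> sets lebesgue" "A \<subseteq> ?I" "B \<subseteq> ?I" "A \<inter> B = {}" for A B t
    using that by (intro integral_Un expo_integrable_on lmI) auto
  \<comment> \<open>Dynkin's lemma: the half-lines are stable under intersection and generate the
    Borel sets. Cutting with the interval keeps every set within reach of the large sieve.\<close>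
  have P: "tail_small \<delta> (B \<inter> ?I)" if "B \<in> sigma_sets UNIV (range (\<lambda>a::real. {..a}))" for B
  proof -
    have bor: "A \<in> sets lebesgue" if "A \<in> sigma_sets UNIV (range (\<lambda>a::real. {..a}))" for A
      using that borel_eq_atMost[where 'a = real] by (metis sets_measure_of_conv Pow_UNIV subset_UNIV sets_completionI_sets sets_lborel space_borel)
    have int: "Int_stable (range (\<lambda>a::real. {..a}))" by (auto simp: Int_stable_def)
    have "range (\<lambda>a::real. {..a}) \<subseteq> Pow UNIV" by simp
    from int this that show ?thesis
    proof (induction rule: sigma_sets_induct_disjoint)
      case (basic A)
      then obtain a where "A = {..a}" by auto
      then have "A \<inter> ?I = {- L..min a L}" by auto
      then show ?case using tail_small_interval[OF assms(1)] by simp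
    next
      case empty
      then show ?case by (auto simp: tail_small_def intro: exI[of _ 1])
    next
      case (compl A)
      have "(UNIV - A) \<inter> ?I = ?I - A" by auto
      moreover have I: "?I \<in> sets lebesgue" by simp
      ultimately have D: "(UNIV - A) \<inter> ?I \<in> sets lebesgue" using sets.Diff[OF I bor[OF compl(1)]] by simp
      have "(A \<inter> ?I) \<union> ((UNIV - A) \<inter> ?I) = ?I" "(A \<inter> ?I) \<inter> ((UNIV - A) \<inter> ?I) = {}" by auto
      then have "integral ?I (expo t) = integral (A \<inter> ?I) (expo t) + integral ((UNIV - A) \<inter> ?I) (expo t)" for t
        using add[OF sets.Int[OF bor[OF compl(1)] I] D Int_lower2 Int_lower2, of t] by simp
      then have "integral ((UNIV - A) \<inter> ?I) (expo t) = integral ?I (expo t) - integral (A \<inter> ?I) (expo t)" for t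
        by (simp add: algebra_simps)
      then show ?case
        by (intro tail_small_add[OF tail_small_interval[OF assms(1), of "- L" L] compl(2)]) (metis norm_triangle_ineq4)
    next
      case (union A)
      define B where "B = (\<lambda>n. (\<Union>i<n. A i) \<inter> ?I)"
      define V where "V = (\<Union>i. A i) \<inter> ?I"
      have Am: "A i \<in> sets lebesgue" for i using bor union(2) by auto
      have I: "?I \<in> sets lebesgue" by simp
      have Bm: "B n \<in> sets lebesgue" "B n \<subseteq> ?I" for n
        unfolding B_def by (intro sets.Int[OF _ I] sets.countable_UN'' Am, auto)
      have Vm: "V \<in> sets lebesgue" "V \<subseteq> ?I"
        unfolding V_def by (intro sets.Int[OF _ I] sets.countable_UN'' Am, auto)
      have tB: "tail_small \<delta> (B n)" for n
      proof (induction n)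
        case 0
        then show ?case by (auto simp: B_def tail_small_def intro: exI[of _ 1])
      next
        case (Suc n)
        have "B (Suc n) = B n \<union> (A n \<inter> ?I)" by (auto simp: B_def lessThan_Suc)
        moreover have "A i \<inter> A n = {}" if "i < n" for i
          using disjoint_family_onD[OF union(1), of i n] that by simp
        then have "B n \<inter> (A n \<inter> ?I) = {}" unfolding B_def by blast
        ultimately have "integral (B (Suc n)) (expo t) = integral (B n) (expo t) + integral (A n \<inter> ?I) (expo t)" for t
          using add[OF Bm(1) sets.Int[OF Am I] Bm(2) Int_lower2, of n n t] by simp
        then show ?case by (intro tail_small_add[OF Suc union(3)[of n]]) (metis norm_triangle_ineq)
      qed
      have lim: "(\<lambda>n. measure lebesgue (B n)) \<longlonglongrightarrow> measure lebesgue V"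
      proof -
        have "(\<lambda>n. measure lebesgue (B n)) \<longlonglongrightarrow> measure lebesgue (\<Union>n. B n)"
        proof (rule measure_nested_Union)
          show "B n \<in> lmeasurable" for n using Bm by (intro lmI)
          show "measure lebesgue (B n) \<le> measure lebesgue ?I" for n
            using Bm by (intro measure_mono_fmeasurable) auto
          show "B n \<subseteq> B (Suc n)" for n by (auto simp: B_def lessThan_Suc)
        qed
        moreover have "(\<Union>n. B n) = V" by (auto simp: B_def V_def)
        ultimately show ?thesis by simp
      qed
      show ?case unfolding V_def[symmetric] tail_small_def
      proof (intro allI impI)
        fix \<epsilon> :: real assume e: "\<epsilon> > 0"
        \<comment> \<open>The set \<open>V - B n\<close> is made so small that the sieve bounds its
          contribution by \<open>\<epsilon> / 4\<close> for every \<open>K\<close>; the threshold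
          \<open>R\<close> is then dictated by \<open>B n\<close> alone.\<close>
        then have "\<epsilon> / (4 * C) > 0" using C(1) by simp
        from LIMSEQ_D[OF lim this] obtain n where n: "\<bar>measure lebesgue (B n) - measure lebesgue V\<bar> < \<epsilon> / (4 * C)"
          unfolding real_norm_def by blast
        have BV: "B n \<subseteq> V" by (auto simp: B_def V_def)
        have DV: "V - B n \<in> sets lebesgue" "V - B n \<subseteq> ?I" using Vm Bm by auto
        have "measure lebesgue (V - B n) = measure lebesgue V - measure lebesgue (B n)"
          by (rule measurable_measure_Diff[OF lmI[OF Vm] Bm(1) BV])
        also have "\<dots> \<le> \<epsilon> / (4 * C)" using n by linarith
        finally have "C * measure lebesgue (V - B n) \<le> C * (\<epsilon> / (4 * C))" using C(1) by (intro mult_left_mono) auto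
        then have Cm: "C * measure lebesgue (V - B n) \<le> \<epsilon> / 4" using C(1) by simp
        obtain R where R: "R > 0" "\<And>K. finite K \<Longrightarrow> separated \<delta> K \<Longrightarrow> (\<forall>t\<in>K. R \<le> \<bar>t\<bar>) \<Longrightarrow> (\<Sum>t\<in>K. (cmod (integral (B n) (expo t)))\<^sup>2) \<le> \<epsilon> / 4"
        proof -
          have "\<epsilon> / 4 > 0" using e by simp
          then show thesis using tail_smallE[OF tB[of n]] that by metis
        qed
        show "\<exists>R>0. \<forall>K. finite K \<and> separated \<delta> K \<and> (\<forall>t\<in>K. R \<le> \<bar>t\<bar>) \<longrightarrow> (\<Sum>t\<in>K. (cmod (integral V (expo t)))\<^sup>2) \<le> \<epsilon>"
        proof (intro exI[of _ R] conjI allI impI)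
          fix K assume K: "finite K \<and> separated \<delta> K \<and> (\<forall>t\<in>K. R \<le> \<bar>t\<bar>)"
          have pt: "(cmod (integral V (expo t)))\<^sup>2 \<le> 2 * (cmod (integral (B n) (expo t)))\<^sup>2 + 2 * (cmod (integral (V - B n) (expo t)))\<^sup>2" for t
          proof -
            define a b where "a = cmod (integral (B n) (expo t))" and "b = cmod (integral (V - B n) (expo t))"
            have "B n \<union> (V - B n) = V" using BV by auto
            then have "integral V (expo t) = integral (B n) (expo t) + integral (V - B n) (expo t)"
              using add[of "B n" "V - B n" t] Bm[of n] DV by auto
            then have "(cmod (integral V (expo t)))\<^sup>2 \<le> (a + b)\<^sup>2" by (intro power_mono) (auto simp: a_def b_def norm_triangle_ineq)
            also have "\<dots> \<le> 2 * a\<^sup>2 + 2 * b\<^sup>2" using zero_le_power2[of "a - b"] by (simp add: power2_eq_square algebra_simps)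
            finally show ?thesis by (simp add: a_def b_def)
          qed
          have "(\<Sum>t\<in>K. (cmod (integral V (expo t)))\<^sup>2) \<le> 2 * (\<Sum>t\<in>K. (cmod (integral (B n) (expo t)))\<^sup>2) + 2 * (\<Sum>t\<in>K. (cmod (integral (V - B n) (expo t)))\<^sup>2)"
            unfolding sum_distrib_left sum.distrib[symmetric] by (intro sum_mono pt)
          also have "\<dots> \<le> 2 * (\<epsilon> / 4) + 2 * (\<epsilon> / 4)"
            using K R(2)[of K] sieve[of K "V - B n"] DV Cm by (intro add_mono mult_left_mono) auto
          finally show "(\<Sum>t\<in>K. (cmod (integral V (expo t)))\<^sup>2) \<le> \<epsilon>" by simp
        qed (rule R(1))
      qed
    qed
  qed
  \<comment> \<open>A Lebesgue measurable set is an F-sigma set up to a null set, which does not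
    affect the integrals.\<close>
  obtain C' T where CT: "fsigma C'" "negligible T" "C' \<union> T = S" "disjnt C' T"
    using lebesgue_set_almost_fsigma[OF assms(3)] by (metis negligible_iff_null_sets)
  have "C' \<in> sets borel" using CT(1) by cases auto
  then have "C' \<in> sigma_sets UNIV (range (\<lambda>a::real. {..a}))"
    using borel_eq_atMost[where 'a = real] by (metis sets_measure_of_conv Pow_UNIV subset_UNIV)
  from P[OF this] have "tail_small \<delta> (C' \<inter> ?I)" .
  moreover have "C' \<inter> ?I = C'" using CT(3) assms(4) by auto
  moreover have "integral S f = integral C' f" for f :: "real \<Rightarrow> complex"
    using CT by (intro integral_spike_set negligible_subset[OF CT(2)]) auto
  ultimately show ?thesis by (simp add: tail_small_def)
qed

section \<open>Periodicity of spectra\<close>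

locale unit_domain =
  fixes \<Omega> :: "real set"
  assumes bdd: "bounded \<Omega>" and lm: "\<Omega> \<in> sets lebesgue" and m1: "emeasure lebesgue \<Omega> = 1"
begin

definition U :: "real \<Rightarrow> complex" where "U t = integral \<Omega> (expo t)"

lemma lmeas: "\<Omega> \<in> lmeasurable" using bdd lm by (rule bounded_set_imp_lmeasurable)

lemma fm: "finite_measure (lebesgue_on \<Omega>)" using lmeas by (rule finite_measure_lebesgue_on)

lemma measure_1: "measure lebesgue \<Omega> = 1" using m1 by (simp add: measure_def)

lemma expo_bm: "bounded_meas (lebesgue_on \<Omega>) (expo k)" using lm by (rule bounded_meas_expo)

lemma U_lint: "U t = (LINT x|lebesgue_on \<Omega>. expo t x)"
  unfolding U_def by (rule lebesgue_integral_eq_integral[OF bounded_meas_integrable[OF fm expo_bm] lm, symmetric])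

lemma inn_expo: "inn (lebesgue_on \<Omega>) (expo k) (expo l) = U (k - l)"
  by (simp add: inn_def U_lint expo_simps)

lemma U_0: "U 0 = 1"
  using lm by (simp add: U_lint expo_simps measure_restrict_space measure_1)

lemma U_minus: "U (- t) = cnj (U t)"
proof -
  have "(LINT x|lebesgue_on \<Omega>. cnj (expo t x)) = cnj (U t)" unfolding U_lint by (rule Bochner_Integration.integral_cnj)
  then show ?thesis by (simp add: U_lint expo_simps)
qed

lemma nsq_expo: "nsq (lebesgue_on \<Omega>) (expo k) = 1"
  using lm by (simp add: nsq_def expo_simps measure_restrict_space measure_1)

text \<open>The orthogonality and Parseval relations of a spectrum, tested on exponentials only. This
  form is invariant under translation and reflection.\<close>

definition exp_basis :: "real set \<Rightarrow> bool" where
  "exp_basis \<Lambda> \<longleftrightarrow> (\<forall>l\<in>\<Lambda>. \<forall>m\<in>\<Lambda>. l \<noteq> m \<longrightarrow> U (l - m) = 0) \<and>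
     (\<forall>\<xi>. \<forall>\<epsilon>>0. \<exists>F. finite F \<and> F \<subseteq> \<Lambda> \<and> 1 - \<epsilon> < (\<Sum>l\<in>F. (cmod (U (\<xi> - l)))\<^sup>2))"

lemma exp_basis_orth: "exp_basis \<Lambda> \<Longrightarrow> l \<in> \<Lambda> \<Longrightarrow> m \<in> \<Lambda> \<Longrightarrow> l \<noteq> m \<Longrightarrow> U (l - m) = 0"
  by (simp add: exp_basis_def)

lemma exp_basis_parseval:
  assumes "exp_basis \<Lambda>" "0 < \<epsilon>"
  obtains F where "finite F" "F \<subseteq> \<Lambda>" "1 - \<epsilon> < (\<Sum>l\<in>F. (cmod (U (\<xi> - l)))\<^sup>2)"
  using assms unfolding exp_basis_def by metis

lemma exp_basis_translate:
  assumes "exp_basis \<Lambda>"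
  shows "exp_basis {y. y + a \<in> \<Lambda>}"
  unfolding exp_basis_def
proof (intro conjI ballI impI allI)
  fix l m assume "l \<in> {y. y + a \<in> \<Lambda>}" "m \<in> {y. y + a \<in> \<Lambda>}" "l \<noteq> m"
  then show "U (l - m) = 0" using exp_basis_orth[OF assms, of "l + a" "m + a"] by simp
next
  fix \<xi> \<epsilon> :: real assume "0 < \<epsilon>"
  then obtain F where F: "finite F" "F \<subseteq> \<Lambda>" "1 - \<epsilon> < (\<Sum>l\<in>F. (cmod (U (\<xi> + a - l)))\<^sup>2)"
    using exp_basis_parseval[OF assms] by metis
  have "(\<Sum>l\<in>(\<lambda>l. l - a) ` F. (cmod (U (\<xi> - l)))\<^sup>2) = (\<Sum>l\<in>F. (cmod (U (\<xi> + a - l)))\<^sup>2)"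
    by (subst sum.reindex) (auto simp: algebra_simps inj_on_def)
  then show "\<exists>F. finite F \<and> F \<subseteq> {y. y + a \<in> \<Lambda>} \<and> 1 - \<epsilon> < (\<Sum>l\<in>F. (cmod (U (\<xi> - l)))\<^sup>2)"
    using F by (intro exI[of _ "(\<lambda>l. l - a) ` F"]) auto
qed

lemma exp_basis_reflect:
  assumes "exp_basis \<Lambda>"
  shows "exp_basis {y. - y \<in> \<Lambda>}"
  unfolding exp_basis_def
proof (intro conjI ballI impI allI)
  fix l m assume "l \<in> {y. - y \<in> \<Lambda>}" "m \<in> {y. - y \<in> \<Lambda>}" "l \<noteq> m"
  then show "U (l - m) = 0" using exp_basis_orth[OF assms, of "- m" "- l"] by simp
next
  fix \<xi> \<epsilon> :: real assume "0 < \<epsilon>"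
  then obtain F where F: "finite F" "F \<subseteq> \<Lambda>" "1 - \<epsilon> < (\<Sum>l\<in>F. (cmod (U (- \<xi> - l)))\<^sup>2)"
    using exp_basis_parseval[OF assms] by metis
  have "cmod (U (\<xi> + l)) = cmod (U (- \<xi> - l))" for l
    using U_minus[of "\<xi> + l"] by simp
  then have "(\<Sum>l\<in>uminus ` F. (cmod (U (\<xi> - l)))\<^sup>2) = (\<Sum>l\<in>F. (cmod (U (- \<xi> - l)))\<^sup>2)"
    by (subst sum.reindex) (auto simp: algebra_simps)
  then show "\<exists>F. finite F \<and> F \<subseteq> {y. - y \<in> \<Lambda>} \<and> 1 - \<epsilon> < (\<Sum>l\<in>F. (cmod (U (\<xi> - l)))\<^sup>2)"
    using F by (intro exI[of _ "uminus ` F"]) auto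
qed

text \<open>Boundedness of \<Omega> extends \<open>U\<close> holomorphically to complex arguments.
  As \<open>U 0 = 1\<close>, the extension is not identically zero, so a compact disc contains only
  finitely many of its zeros.\<close>

lemma finite_zeros: "finite {t. U t = 0 \<and> \<bar>t\<bar> \<le> B}"
proof -
  obtain L where L: "\<And>x. x \<in> \<Omega> \<Longrightarrow> \<bar>x\<bar> \<le> L" using bdd by (auto simp: bounded_iff)
  define f where "f = (\<lambda>z x. exp (2 * of_real pi * \<i> * z * of_real x))"
  define g where "g = (\<lambda>z. LINT x|lebesgue_on \<Omega>. f z x)"
  define S where "S = ball (0::complex) (\<bar>B\<bar> + 1)"
  have gU: "g (of_real t) = U t" for t by (simp add: g_def f_def U_lint expo_def)
  have "g holomorphic_on S" unfolding g_def
  proof (rule holomorphic_on_integral[OF fm, where B = "exp (2 * pi * (\<bar>B\<bar> + 1) * \<bar>L\<bar>)"])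
    show "open S" by (simp add: S_def)
    show "(\<lambda>z. f z x) holomorphic_on S" for x unfolding f_def by (intro holomorphic_intros)
    show "f z \<in> borel_measurable (lebesgue_on \<Omega>)" for z
      unfolding f_def by (intro continuous_imp_measurable_on_sets_lebesgue lm continuous_intros)
    fix z x assume z: "z \<in> S" and "x \<in> space (lebesgue_on \<Omega>)"
    then have x: "\<bar>x\<bar> \<le> L" using L by simp
    have "- (Im z * x) \<le> \<bar>Im z\<bar> * \<bar>x\<bar>" by (metis abs_ge_minus_self abs_mult)
    also have "\<dots> \<le> (\<bar>B\<bar> + 1) * \<bar>L\<bar>"
      using z x abs_Im_le_cmod[of z] by (intro mult_mono) (auto simp: S_def)
    finally have "2 * pi * - (Im z * x) \<le> 2 * pi * ((\<bar>B\<bar> + 1) * \<bar>L\<bar>)" by (intro mult_left_mono) auto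
    moreover have "cmod (f z x) = exp (2 * pi * - (Im z * x))" by (simp add: f_def algebra_simps)
    ultimately show "cmod (f z x) \<le> exp (2 * pi * (\<bar>B\<bar> + 1) * \<bar>L\<bar>)" by (simp add: mult.assoc)
  qed
  have fin: "finite {z \<in> cball 0 \<bar>B\<bar>. g z = 0}"
  proof (cases "g constant_on S")
    case True
    then have "g z = 1" if "z \<in> S" for z
      using that gU[of 0] U_0 by (auto simp: constant_on_def S_def)
    then have "{z \<in> cball 0 \<bar>B\<bar>. g z = 0} = {}" by (auto simp: S_def)
    then show ?thesis by (metis finite.emptyI)
  next
    case False
    then show ?thesis using \<open>g holomorphic_on S\<close>
      by (intro holomorphic_compact_finite_zeros[of g S]) (auto simp: S_def)
  qed
  have "of_real ` {t. U t = 0 \<and> \<bar>t\<bar> \<le> B} \<subseteq> {z \<in> cball 0 \<bar>B\<bar>. g z = 0}"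
    using gU by auto
  then have "finite (complex_of_real ` {t. U t = 0 \<and> \<bar>t\<bar> \<le> B})" using fin finite_subset by blast
  then show ?thesis by (rule finite_imageD) (auto simp: inj_on_def)
qed

text \<open>Differences of distinct elements are zeros of \<open>U\<close>, and 0 is not a zero. The
  least modulus of the zeros in \<open>[-1, 1]\<close>, capped by 1, depends on \<Omega> only and so
  serves all bases.\<close>

lemma uniform_gap: "\<exists>\<delta>>0. \<forall>\<Lambda>. exp_basis \<Lambda> \<longrightarrow> separated \<delta> \<Lambda>"
proof -
  define Z where "Z = {t. U t = 0 \<and> \<bar>t\<bar> \<le> 1}"
  define \<delta> where "\<delta> = Min (insert 1 (abs ` Z))"
  have fZ: "finite (insert 1 (abs ` Z))" using finite_zeros[of 1] by (simp add: Z_def)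
  have "0 \<notin> Z" using U_0 by (auto simp: Z_def)
  then have "\<delta> > 0" unfolding \<delta>_def using fZ by (subst Min_gr_iff) auto
  moreover have "separated \<delta> \<Lambda>" if "exp_basis \<Lambda>" for \<Lambda>
    unfolding separated_def
  proof (intro ballI impI)
    fix x y assume "x \<in> \<Lambda>" "y \<in> \<Lambda>" "x \<noteq> y"
    then have z: "U (x - y) = 0" using exp_basis_orth that by blast
    show "\<delta> \<le> \<bar>x - y\<bar>"
    proof (cases "\<bar>x - y\<bar> \<le> 1")
      case True
      then show ?thesis unfolding \<delta>_def using z fZ by (intro Min_le) (auto simp: Z_def)
    next
      case False
      moreover have "\<delta> \<le> 1" unfolding \<delta>_def using fZ by (intro Min_le) auto
      ultimately show ?thesis by linarith
    qed
  qed
  ultimately show ?thesis by blast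
qed

lemma tail_small_domain: "\<delta> > 0 \<Longrightarrow> tail_small \<delta> \<Omega>"
proof -
  assume d: "\<delta> > 0"
  obtain L where L: "\<And>x. x \<in> \<Omega> \<Longrightarrow> \<bar>x\<bar> \<le> L" using bdd by (auto simp: bounded_iff)
  have "\<Omega> \<subseteq> {- (\<bar>L\<bar> + 1)..\<bar>L\<bar> + 1}" using L by force
  then show ?thesis using d lm by (intro tail_small_lmeasurable[of \<delta> "\<bar>L\<bar> + 1"]) auto
qed

lemma separated_reflect: "separated \<delta> K \<Longrightarrow> separated \<delta> ((\<lambda>l. \<xi> - l) ` K)"
  by (auto simp: separated_def abs_minus_commute)

text \<open>If no element came within \<open>R\<close> of \<xi>, the whole Parseval sum of
  \<open>expo \<xi>\<close>, which comes arbitrarily close to 1, would lie in the tail, and the tail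
  is at most \<open>1 / 2\<close>.\<close>

lemma uniform_density: "\<exists>G>0. \<forall>\<Lambda> \<xi>. exp_basis \<Lambda> \<longrightarrow> (\<exists>l\<in>\<Lambda>. \<bar>\<xi> - l\<bar> < G)"
proof -
  obtain \<delta> where d: "\<delta> > 0" "\<And>\<Lambda>. exp_basis \<Lambda> \<Longrightarrow> separated \<delta> \<Lambda>" using uniform_gap by metis
  obtain R where R: "R > 0" "\<And>K. finite K \<Longrightarrow> separated \<delta> K \<Longrightarrow> (\<forall>t\<in>K. R \<le> \<bar>t\<bar>) \<Longrightarrow> (\<Sum>t\<in>K. (cmod (integral \<Omega> (expo t)))\<^sup>2) \<le> 1 / 2"
    using tail_smallE[OF tail_small_domain[OF d(1)], of "1 / 2"] by (metis half_gt_zero zero_less_one)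
  have "\<exists>l\<in>\<Lambda>. \<bar>\<xi> - l\<bar> < R" if eb: "exp_basis \<Lambda>" for \<Lambda> \<xi>
  proof (rule ccontr)
    assume far: "\<not> (\<exists>l\<in>\<Lambda>. \<bar>\<xi> - l\<bar> < R)"
    obtain F where F: "finite F" "F \<subseteq> \<Lambda>" "1 - 1 / 2 < (\<Sum>l\<in>F. (cmod (U (\<xi> - l)))\<^sup>2)"
      using exp_basis_parseval[OF eb, of "1 / 2" \<xi>] by auto
    have "(\<Sum>l\<in>F. (cmod (U (\<xi> - l)))\<^sup>2) = (\<Sum>t\<in>(\<lambda>l. \<xi> - l) ` F. (cmod (integral \<Omega> (expo t)))\<^sup>2)"
      by (subst sum.reindex) (auto simp: U_def inj_on_def)
    also have "\<dots> \<le> 1 / 2"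
    proof (rule R(2))
      show "separated \<delta> ((\<lambda>l. \<xi> - l) ` F)"
        using separated_subset[OF d(2)[OF eb] F(2)] by (rule separated_reflect)
    qed (use F far in force)+
    finally show False using F(3) by simp
  qed
  then show ?thesis using R(1) by blast
qed

lemma nsq_diff_parseval:
  assumes "exp_basis \<Lambda>" "finite F" "F \<subseteq> \<Lambda>"
  shows "nsq (lebesgue_on \<Omega>) (\<lambda>x. expo \<xi> x - (\<Sum>l\<in>F. U (\<xi> - l) * expo l x)) = 1 - (\<Sum>l\<in>F. (cmod (U (\<xi> - l)))\<^sup>2)"
proof -
  have "inn (lebesgue_on \<Omega>) (expo k) (expo l) = (if k = l then 1 else 0)" if "k \<in> F" "l \<in> F" for k l
    using that assms exp_basis_orth[OF assms(1), of k l] U_0 by (auto simp: inn_expo)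
  from nsq_diff_orthonormal_sum[OF fm assms(2) expo_bm expo_bm this, of \<xi> "\<lambda>l. U (\<xi> - l)"]
  show ?thesis by (simp add: inn_expo nsq_expo)
qed

text \<open>A window of fixed length determines everything to its right: if \<open>y\<close> were the first
  discrepancy, then the expansion of \<open>expo y\<close> in the other basis would use, up to a small
  error, only frequencies greater than \<open>y\<close>.\<close>

lemma window_step:
  obtains R where "R > 0" "\<And>A B x y. exp_basis A \<Longrightarrow> exp_basis B \<Longrightarrow> x \<in> A \<Longrightarrow> x \<in> B \<Longrightarrow> x < y \<Longrightarrow>
    (\<And>z. x - R \<le> z \<Longrightarrow> z < y \<Longrightarrow> z \<in> A \<longleftrightarrow> z \<in> B) \<Longrightarrow> y \<in> A \<Longrightarrow> y \<in> B"
proof -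
  obtain \<delta> where d: "\<delta> > 0" "\<And>\<Lambda>. exp_basis \<Lambda> \<Longrightarrow> separated \<delta> \<Lambda>" using uniform_gap by metis
  obtain G where G: "G > 0" "\<And>\<Lambda> \<xi>. exp_basis \<Lambda> \<Longrightarrow> \<exists>l\<in>\<Lambda>. \<bar>\<xi> - l\<bar> < G" using uniform_density by metis
  \<comment> \<open>The point \<open>y\<close> will lie outside \<open>B\<close>, so
    \<open>uniform_gap\<close> does not separate it from the elements of \<open>B\<close> to its
    right. Instead both are compared with a common point \<open>q\<close> at distance less than
    \<open>2 * G\<close> from \<open>y\<close>: for \<open>l\<close> within 1 of \<open>y\<close>,
    \<open>l - q\<close> and \<open>y - q\<close> are distinct zeros of \<open>U\<close> of modulus
    at most \<open>2 * G + 1\<close>, and \<delta>0 bounds the differences of such zeros from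
    below.\<close>
  define Z where "Z = {t. U t = 0 \<and> \<bar>t\<bar> \<le> 2 * G + 1}"
  define P where "P = {(s, t). s \<in> Z \<and> t \<in> Z \<and> s \<noteq> t}"
  define \<delta>0 where "\<delta>0 = min \<delta> (Min (insert 1 ((\<lambda>(s, t). \<bar>s - t\<bar>) ` P)))"
  have "finite Z" using finite_zeros by (simp add: Z_def)
  have "P \<subseteq> Z \<times> Z" by (auto simp: P_def)
  then have "finite P" using \<open>finite Z\<close> by (meson finite_SigmaI finite_subset)
  then have fP: "finite (insert 1 ((\<lambda>(s, t). \<bar>s - t\<bar>) ` P))" by simp
  have d0: "\<delta>0 > 0" unfolding \<delta>0_def using d(1) fP by (auto simp: P_def)
  have d0le: "\<delta>0 \<le> \<delta>" by (simp add: \<delta>0_def)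
  have d01: "\<delta>0 \<le> 1" unfolding \<delta>0_def using fP by (intro min.coboundedI2 Min_le) auto
  have d0Z: "\<delta>0 \<le> \<bar>s - t\<bar>" if "s \<in> Z" "t \<in> Z" "s \<noteq> t" for s t
    unfolding \<delta>0_def using fP that by (intro min.coboundedI2 Min_le) (force simp: P_def)+
  have sep0: "separated \<delta>0 \<Lambda>" if "exp_basis \<Lambda>" for \<Lambda>
    using d(2)[OF that] d0le by (force simp: separated_def)
  have m0: "0 < emeasure lebesgue \<Omega>" using m1 by simp
  obtain \<epsilon> where e0: "\<epsilon> > 0" "\<forall>K c. finite K \<and> separated \<delta>0 K \<and> K \<subseteq> {\<delta>0..} \<and> (\<Sum>k\<in>K. (cmod (c k))\<^sup>2) \<le> 1 \<longrightarrow>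
    \<epsilon> \<le> (LINT x|lebesgue_on \<Omega>. (cmod (1 + (\<Sum>k\<in>K. c k * expo k x)))\<^sup>2)"
    using exp_sum_lower_bound[OF bdd lm m0 d0] by (elim exE conjE)
  have e: "\<epsilon> > 0" "\<And>K c. finite K \<Longrightarrow> separated \<delta>0 K \<Longrightarrow> K \<subseteq> {\<delta>0..} \<Longrightarrow> (\<Sum>k\<in>K. (cmod (c k))\<^sup>2) \<le> 1 \<Longrightarrow>
    \<epsilon> \<le> (LINT x|lebesgue_on \<Omega>. (cmod (1 + (\<Sum>k\<in>K. c k * expo k x)))\<^sup>2)"
    using e0(1) e0(2)[rule_format, OF conjI[OF _ conjI[OF _ conjI]]] by simp_all
  \<comment> \<open>Two errors of square norm about \<open>\<epsilon> / 4\<close> are combined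
    below: the truncation of the expansion and the part to the left of the window. The inequality
    \<open>(a + b)\<^sup>2 \<le> 2 a\<^sup>2 + 2 b\<^sup>2\<close> brings their sum below
    \<epsilon>.\<close>
  have e4: "\<epsilon> / 4 > 0" using e(1) by simp
  obtain R where R: "R > 0" "\<And>K. finite K \<Longrightarrow> separated \<delta>0 K \<Longrightarrow> (\<forall>t\<in>K. R \<le> \<bar>t\<bar>) \<Longrightarrow> (\<Sum>t\<in>K. (cmod (integral \<Omega> (expo t)))\<^sup>2) \<le> \<epsilon> / 4"
    using tail_smallE[OF tail_small_domain[OF d0] e4] by metis
  show thesis
  proof (rule that[OF R(1)], rule ccontr)
    fix A B x y
    assume A: "exp_basis A" and B: "exp_basis B" and x: "x \<in> A" "x \<in> B" "x < y" and y: "y \<in> A" "y \<notin> B"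
      and agree: "\<And>z. x - R \<le> z \<Longrightarrow> z < y \<Longrightarrow> z \<in> A \<longleftrightarrow> z \<in> B"
    obtain q where q: "q \<in> A" "q \<in> B" "q < y" "y - q < 2 * G"
    proof -
      obtain l where l: "l \<in> A" "\<bar>(y - G) - l\<bar> < G" using G(2)[OF A] by blast
      show thesis
      proof (cases "x \<le> l")
        case True
        then have "l \<in> B" using agree[of l] l R(1) by auto
        then show ?thesis using that[of l] l by auto
      next
        case False
        then show ?thesis using that[of x] x l by auto
      qed
    qed
    have Uq: "U (y - q) = 0" using exp_basis_orth[OF A y(1) q(1)] q(3) by simp
    obtain F where F: "finite F" "F \<subseteq> B" "1 - \<epsilon> / 4 < (\<Sum>l\<in>F. (cmod (U (y - l)))\<^sup>2)"
      using exp_basis_parseval[OF B e4] by metis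
    define Fp where "Fp = {l\<in>F. y < l}"
    define Fm where "Fm = {l\<in>F. l < x - R}"
    \<comment> \<open>Inside the window the two bases agree, so these frequencies belong to
      \<open>A\<close>, as \<open>y\<close> does; orthogonality of \<open>A\<close> removes their
      coefficients.\<close>
    have Fz: "U (y - l) = 0" if "l \<in> F" "l \<notin> Fp" "l \<notin> Fm" for l
    proof -
      have "l \<noteq> y" using that(1) F(2) y(2) by auto
      then have "x - R \<le> l" "l < y" using that by (auto simp: Fp_def Fm_def)
      then have "l \<in> A" using agree[of l] that(1) F(2) by auto
      then show ?thesis using exp_basis_orth[OF A y(1), of l] \<open>l \<noteq> y\<close> by auto
    qed
    let ?M = "lebesgue_on \<Omega>"
    let ?c = "\<lambda>l. U (y - l)"
    have fin: "finite Fp" "finite Fm" "Fp \<inter> Fm = {}" using F(1) x(3) R(1) by (auto simp: Fp_def Fm_def)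
    have split: "(\<Sum>l\<in>F. ?c l * expo l s) = (\<Sum>l\<in>Fp. ?c l * expo l s) + (\<Sum>l\<in>Fm. ?c l * expo l s)" for s
    proof -
      have "(\<Sum>l\<in>F. ?c l * expo l s) = (\<Sum>l\<in>Fp \<union> Fm. ?c l * expo l s)"
        using Fz F(1) by (intro sum.mono_neutral_right) (auto simp: Fp_def Fm_def)
      then show ?thesis using fin by (simp add: sum.union_disjoint)
    qed
    have bm: "bounded_meas ?M (\<lambda>s. \<Sum>l\<in>H. ?c l * expo l s)" for H
      by (rule bounded_meas_sum, rule bounded_meas_mult[OF bounded_meas_const expo_bm])
    have nm: "nsq ?M (\<lambda>s. \<Sum>l\<in>Fm. ?c l * expo l s) \<le> \<epsilon> / 4"
    proof -
      have "nsq ?M (\<lambda>s. \<Sum>l\<in>Fm. ?c l * expo l s) = 1 * (\<Sum>l\<in>Fm. (cmod (?c l))\<^sup>2)"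
      proof (rule nsq_orthonormal_sum[OF fm fin(2) expo_bm])
        fix k l assume "k \<in> Fm" "l \<in> Fm"
        then show "inn ?M (expo k) (expo l) = (if k = l then complex_of_real 1 else 0)"
          using exp_basis_orth[OF B, of k l] F(2) U_0 by (auto simp: inn_expo Fm_def)
      qed
      also have "\<dots> = (\<Sum>t\<in>(\<lambda>l. y - l) ` Fm. (cmod (integral \<Omega> (expo t)))\<^sup>2)"
        by (subst sum.reindex) (auto simp: U_def inj_on_def)
      also have "\<dots> \<le> \<epsilon> / 4"
      proof (rule R(2))
        have "Fm \<subseteq> B" using F(2) by (auto simp: Fm_def)
        then show "separated \<delta>0 ((\<lambda>l. y - l) ` Fm)" using separated_subset[OF sep0[OF B]] separated_reflect by blast
        show "\<forall>t\<in>(\<lambda>l. y - l) ` Fm. R \<le> \<bar>t\<bar>" using x(3) by (auto simp: Fm_def)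
      qed (use fin in auto)
      finally show ?thesis .
    qed
    have nF: "nsq ?M (\<lambda>s. expo y s - (\<Sum>l\<in>F. ?c l * expo l s)) < \<epsilon> / 4"
      using nsq_diff_parseval[OF B F(1,2), of y] F(3) by simp
    have up: "nsq ?M (\<lambda>s. expo y s - (\<Sum>l\<in>Fp. ?c l * expo l s)) < \<epsilon>"
    proof -
      define a b where "a = (\<lambda>s. expo y s - (\<Sum>l\<in>F. ?c l * expo l s))" and "b = (\<lambda>s. \<Sum>l\<in>Fm. ?c l * expo l s)"
      have ab: "bounded_meas ?M a" "bounded_meas ?M b"
        unfolding a_def b_def by (rule bounded_meas_diff[OF expo_bm bm], rule bm)
      have sqi: "integrable ?M (\<lambda>s. (cmod (a s))\<^sup>2)" "integrable ?M (\<lambda>s. (cmod (b s))\<^sup>2)"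
        using bounded_meas_sq_integrable[OF fm] ab by auto
      have "nsq ?M (\<lambda>s. expo y s - (\<Sum>l\<in>Fp. ?c l * expo l s)) \<le> (LINT s|?M. 2 * (cmod (a s))\<^sup>2 + 2 * (cmod (b s))\<^sup>2)"
        unfolding nsq_def
      proof (rule integral_mono)
        show "integrable ?M (\<lambda>s. (cmod (expo y s - (\<Sum>l\<in>Fp. ?c l * expo l s)))\<^sup>2)"
          by (rule bounded_meas_sq_integrable[OF fm bounded_meas_diff[OF expo_bm bm]])
        show "integrable ?M (\<lambda>s. 2 * (cmod (a s))\<^sup>2 + 2 * (cmod (b s))\<^sup>2)" using sqi by simp
        fix s
        have "expo y s - (\<Sum>l\<in>Fp. ?c l * expo l s) = a s + b s" by (simp add: a_def b_def split)
        then have "(cmod (expo y s - (\<Sum>l\<in>Fp. ?c l * expo l s)))\<^sup>2 \<le> (cmod (a s) + cmod (b s))\<^sup>2"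
          by (intro power_mono) (auto simp: norm_triangle_ineq)
        also have "\<dots> \<le> 2 * (cmod (a s))\<^sup>2 + 2 * (cmod (b s))\<^sup>2"
          using zero_le_power2[of "cmod (a s) - cmod (b s)"] by (simp add: power2_eq_square algebra_simps)
        finally show "(cmod (expo y s - (\<Sum>l\<in>Fp. ?c l * expo l s)))\<^sup>2 \<le> 2 * (cmod (a s))\<^sup>2 + 2 * (cmod (b s))\<^sup>2" .
      qed
      also have "\<dots> = 2 * nsq ?M a + 2 * nsq ?M b" using sqi by (simp add: nsq_def)
      also have "\<dots> < \<epsilon>" using nm nF by (simp add: a_def b_def)
      finally show ?thesis .
    qed
    \<comment> \<open>Division by the unimodular factor \<open>expo y\<close> shifts the remaining
      frequencies to \<open>l - y\<close>, which are at least \<delta>0, and turns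
      \<open>expo y\<close> into the constant term.\<close>
    have "\<epsilon> \<le> (LINT s|?M. (cmod (1 + (\<Sum>k\<in>(\<lambda>l. l - y) ` Fp. - U (- k) * expo k s)))\<^sup>2)"
    proof (rule e(2))
      have sub: "Fp \<subseteq> B" using F(2) by (auto simp: Fp_def)
      show "separated \<delta>0 ((\<lambda>l. l - y) ` Fp)"
        using separated_subset[OF sep0[OF B] sub] by (auto simp: separated_def)
      show "(\<lambda>l. l - y) ` Fp \<subseteq> {\<delta>0..}"
      proof
        fix t assume "t \<in> (\<lambda>l. l - y) ` Fp"
        then obtain l where l: "l \<in> Fp" "t = l - y" by auto
        have ly: "y < l" "l \<in> B" using l(1) sub by (auto simp: Fp_def)
        have Ul: "U (l - q) = 0" using exp_basis_orth[OF B ly(2) q(2)] ly q(3) by auto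
        show "t \<in> {\<delta>0..}"
        proof (cases "l - y \<le> 1")
          case True
          then have "l - q \<in> Z" "y - q \<in> Z" using Ul Uq q ly by (auto simp: Z_def)
          then have "\<delta>0 \<le> \<bar>(l - q) - (y - q)\<bar>" using ly by (intro d0Z) auto
          then show ?thesis using ly l by simp
        next
          case False
          then show ?thesis using d01 l by simp
        qed
      qed
      have "(\<Sum>k\<in>(\<lambda>l. l - y) ` Fp. (cmod (- U (- k)))\<^sup>2) = (\<Sum>l\<in>Fp. (cmod (?c l))\<^sup>2)"
        by (subst sum.reindex) (auto simp: inj_on_def)
      also have "\<dots> \<le> (\<Sum>l\<in>F. (cmod (?c l))\<^sup>2)" using F(1) by (intro sum_mono2) (auto simp: Fp_def)
      also have "\<dots> \<le> 1"
        using nsq_diff_parseval[OF B F(1,2), of y] nsq_nonneg[of ?M "\<lambda>s. expo y s - (\<Sum>l\<in>F. ?c l * expo l s)"] by linarith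
      finally show "(\<Sum>k\<in>(\<lambda>l. l - y) ` Fp. (cmod (- U (- k)))\<^sup>2) \<le> 1" .
    qed (use fin in auto)
    also have "\<dots> = nsq ?M (\<lambda>s. expo y s - (\<Sum>l\<in>Fp. ?c l * expo l s))"
      unfolding nsq_def
    proof (intro Bochner_Integration.integral_cong refl)
      fix s
      have "(\<Sum>k\<in>(\<lambda>l. l - y) ` Fp. - U (- k) * expo k s) = (\<Sum>l\<in>Fp. - ?c l * expo (l - y) s)"
        by (subst sum.reindex) (auto simp: inj_on_def)
      then have "expo y s * (1 + (\<Sum>k\<in>(\<lambda>l. l - y) ` Fp. - U (- k) * expo k s)) = expo y s + (\<Sum>l\<in>Fp. - ?c l * (expo y s * expo (l - y) s))"
        by (simp add: distrib_left sum_distrib_left mult_ac)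
      also have "\<dots> = expo y s - (\<Sum>l\<in>Fp. ?c l * expo l s)"
        by (simp add: expo_simps(3)[symmetric] sum_negf)
      finally have eq: "expo y s * (1 + (\<Sum>k\<in>(\<lambda>l. l - y) ` Fp. - U (- k) * expo k s)) = expo y s - (\<Sum>l\<in>Fp. ?c l * expo l s)" .
      show "(cmod (1 + (\<Sum>k\<in>(\<lambda>l. l - y) ` Fp. - U (- k) * expo k s)))\<^sup>2 = (cmod (expo y s - (\<Sum>l\<in>Fp. ?c l * expo l s)))\<^sup>2"
        by (simp only: eq[symmetric] norm_mult expo_simps(2) mult_1)
    qed
    finally show False using up by linarith
  qed
qed

lemma exp_basis_locally_finite:
  assumes "exp_basis A"
  shows "finite (A \<inter> {a..b})"
proof (cases "A \<inter> {a..b} = {}")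
  case False
  then obtain q where q: "q \<in> A" "a \<le> q" "q \<le> b" by auto
  have "(\<lambda>l. l - q) ` (A \<inter> {a..b}) \<subseteq> insert 0 {t. U t = 0 \<and> \<bar>t\<bar> \<le> b - a}"
    using exp_basis_orth[OF assms _ q(1)] q by auto
  then have "finite ((\<lambda>l. l - q) ` (A \<inter> {a..b}))" using finite_zeros finite_subset by (metis finite_insert)
  then show ?thesis by (rule finite_imageD) (auto simp: inj_on_def)
qed (metis finite.emptyI)

text \<open>Local finiteness provides a least discrepancy. Since \<open>window_step\<close> carries
  membership from one basis to the other, it is applied in both directions there.\<close>

lemma window_determines:
  obtains R where "R > 0" "\<And>A B x y. exp_basis A \<Longrightarrow> exp_basis B \<Longrightarrow> x \<in> A \<Longrightarrow> x \<in> B \<Longrightarrow>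
    (\<And>z. x - R \<le> z \<Longrightarrow> z \<le> x \<Longrightarrow> z \<in> A \<longleftrightarrow> z \<in> B) \<Longrightarrow> x \<le> y \<Longrightarrow> y \<in> A \<longleftrightarrow> y \<in> B"
proof -
  obtain R where R: "R > 0" "\<And>A B x y. exp_basis A \<Longrightarrow> exp_basis B \<Longrightarrow> x \<in> A \<Longrightarrow> x \<in> B \<Longrightarrow> x < y \<Longrightarrow>
    (\<And>z. x - R \<le> z \<Longrightarrow> z < y \<Longrightarrow> z \<in> A \<longleftrightarrow> z \<in> B) \<Longrightarrow> y \<in> A \<Longrightarrow> y \<in> B" using window_step by metis
  show thesis
  proof (rule that[OF R(1)], rule ccontr)
    fix A B x y
    assume A: "exp_basis A" and B: "exp_basis B" and x: "x \<in> A" "x \<in> B" and y: "x \<le> y" "\<not> (y \<in> A \<longleftrightarrow> y \<in> B)"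
      and agree: "\<And>z. x - R \<le> z \<Longrightarrow> z \<le> x \<Longrightarrow> z \<in> A \<longleftrightarrow> z \<in> B"
    define D where "D = {z. x \<le> z \<and> z \<le> y \<and> \<not> (z \<in> A \<longleftrightarrow> z \<in> B)}"
    have "D \<subseteq> (A \<inter> {x..y}) \<union> (B \<inter> {x..y})" by (auto simp: D_def)
    then have fD: "finite D" using exp_basis_locally_finite A B by (meson finite_UnI finite_subset)
    have "y \<in> D" using y by (simp add: D_def)
    define z0 where "z0 = Min D"
    have z0: "z0 \<in> D" "\<And>z. z \<in> D \<Longrightarrow> z0 \<le> z" using fD \<open>y \<in> D\<close> by (auto simp: z0_def intro: Min_in)
    have ag: "z \<in> A \<longleftrightarrow> z \<in> B" if "x - R \<le> z" "z < z0" for z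
    proof (cases "z \<le> x")
      case True
      then show ?thesis using agree that by blast
    next
      case False
      then have "z \<notin> D" using z0(2)[of z] that by auto
      then show ?thesis using False that z0(1) by (auto simp: D_def)
    qed
    have "x < z0" using z0(1) x by (auto simp: D_def less_le)
    then have "z0 \<in> A \<longleftrightarrow> z0 \<in> B"
      using R(2)[OF A B x, of z0] R(2)[OF B A x(2,1), of z0] ag by blast
    then show False using z0(1) by (simp add: D_def)
  qed
qed

text \<open>The pattern of the spectrum on the window to the left of a point of \<Lambda>, taken
  relative to that point, is a subset of a fixed finite set of zeros of \<open>U\<close> together
  with 0. As \<Lambda> is infinite, two points \<open>a < b\<close> share a pattern, and
  \<open>b - a\<close> is a period.\<close>

lemma exp_basis_periodic:
  assumes eb: "exp_basis \<Lambda>"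
  shows "\<exists>p>0. \<forall>y. y + p \<in> \<Lambda> \<longleftrightarrow> y \<in> \<Lambda>"
proof (rule window_determines)
  fix R assume R: "R > 0" "\<And>A B x y. exp_basis A \<Longrightarrow> exp_basis B \<Longrightarrow> x \<in> A \<Longrightarrow> x \<in> B \<Longrightarrow>
    (\<And>z. x - R \<le> z \<Longrightarrow> z \<le> x \<Longrightarrow> z \<in> A \<longleftrightarrow> z \<in> B) \<Longrightarrow> x \<le> y \<Longrightarrow> y \<in> A \<longleftrightarrow> y \<in> B"
  obtain G where G: "G > 0" "\<And>\<xi>. \<exists>l\<in>\<Lambda>. \<bar>\<xi> - l\<bar> < G" using uniform_density eb by metis
  have inf: "infinite \<Lambda>"
  proof
    assume "finite \<Lambda>"
    obtain l where l: "l \<in> \<Lambda>" "\<bar>(Max \<Lambda> + G) - l\<bar> < G" using G(2) by blast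
    then show False using Max_ge[OF \<open>finite \<Lambda>\<close> l(1)] by linarith
  qed
  define Pt where "Pt = (\<lambda>a. {t. - R \<le> t \<and> t \<le> 0 \<and> t + a \<in> \<Lambda>})"
  have "Pt ` \<Lambda> \<subseteq> Pow (insert 0 {t. U t = 0 \<and> \<bar>t\<bar> \<le> R})"
  proof (intro image_subsetI PowI subsetI)
    fix a t assume "a \<in> \<Lambda>" "t \<in> Pt a"
    then show "t \<in> insert 0 {t. U t = 0 \<and> \<bar>t\<bar> \<le> R}"
      using exp_basis_orth[OF eb, of "t + a" a] by (cases "t = 0") (auto simp: Pt_def)
  qed
  then have "finite (Pt ` \<Lambda>)" by (rule finite_subset) (use finite_zeros in simp)
  then obtain a b where ab: "a \<in> \<Lambda>" "b \<in> \<Lambda>" "a < b" "Pt a = Pt b"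
  proof -
    have "\<not> inj_on Pt \<Lambda>" using inf \<open>finite (Pt ` \<Lambda>)\<close> finite_imageD by blast
    then obtain a b where "a \<in> \<Lambda>" "b \<in> \<Lambda>" "a \<noteq> b" "Pt a = Pt b" unfolding inj_on_def by blast
    then show thesis using that[of a b] that[of b a] by (cases "a < b") auto
  qed
  let ?A = "{y. y + a \<in> \<Lambda>}" and ?B = "{y. y + b \<in> \<Lambda>}"
  have A: "exp_basis ?A" and B: "exp_basis ?B" using exp_basis_translate[OF eb] by auto
  have win: "z + a \<in> \<Lambda> \<longleftrightarrow> z + b \<in> \<Lambda>" if "- R \<le> z" "z \<le> 0" for z
    using ab(4) that by (auto simp: Pt_def set_eq_iff)
  have right: "y + a \<in> \<Lambda> \<longleftrightarrow> y + b \<in> \<Lambda>" if "0 \<le> y" for y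
    using R(2)[OF A B, of 0 y] win ab that by auto
  \<comment> \<open>Reflection exchanges the two directions. The half-line already settled then
    contains the window needed to determine the other one.\<close>
  have left: "y + a \<in> \<Lambda> \<longleftrightarrow> y + b \<in> \<Lambda>" if "y \<le> 0" for y
  proof -
    have "a - z \<in> \<Lambda> \<longleftrightarrow> b - z \<in> \<Lambda>" if "z \<le> 0" for z using right[of "- z"] that by (simp add: add.commute)
    then show ?thesis
      using R(2)[OF exp_basis_reflect[OF A] exp_basis_reflect[OF B], of 0 "- y"] ab that by (simp add: add.commute)
  qed
  have all: "y + a \<in> \<Lambda> \<longleftrightarrow> y + b \<in> \<Lambda>" for y using left right by (cases "0 \<le> y") auto
  show ?thesis
  proof (intro exI[of _ "b - a"] conjI allI)
    fix y show "y + (b - a) \<in> \<Lambda> \<longleftrightarrow> y \<in> \<Lambda>" using all[of "y - a"] by (simp add: algebra_simps)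
  qed (use ab in simp)
qed

end

section \<open>Uniqueness of Fourier coefficients\<close>

inductive trig_poly :: "real \<Rightarrow> (real \<Rightarrow> complex) \<Rightarrow> bool" for p where
  monomial: "trig_poly p (\<lambda>x. c * expo (of_int k * p) x)"
| add: "trig_poly p f \<Longrightarrow> trig_poly p g \<Longrightarrow> trig_poly p (\<lambda>x. f x + g x)"

lemma trig_poly_mult_monomial:
  assumes "trig_poly p f"
  shows "trig_poly p (\<lambda>x. c * expo (of_int k * p) x * f x)"
  using assms
proof induction
  case (monomial d j)
  have "(\<lambda>x. c * expo (of_int k * p) x * (d * expo (of_int j * p) x)) = (\<lambda>x. c * d * expo (of_int (k + j) * p) x)"
  proof
    fix x
    have "expo (of_int (k + j) * p) x = expo (of_int k * p) x * expo (of_int j * p) x"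
      unfolding expo_simps(3)[symmetric] by (simp add: algebra_simps)
    then show "c * expo (of_int k * p) x * (d * expo (of_int j * p) x) = c * d * expo (of_int (k + j) * p) x"
      by (simp only: mult_ac)
  qed
  then show ?case by (simp only: trig_poly.monomial)
next
  case (add f g)
  then show ?case using trig_poly.add[OF add.IH] by (simp add: distrib_left)
qed

lemma trig_poly_mult:
  assumes "trig_poly p f" "trig_poly p g"
  shows "trig_poly p (\<lambda>x. f x * g x)"
  using assms(1)
proof induction
  case (monomial c k)
  then show ?case using trig_poly_mult_monomial[OF assms(2)] by simp
next
  case (add f1 f2)
  then show ?case using trig_poly.add[OF add.IH] by (simp add: distrib_right)
qed

text \<open>A real-linear function of \<open>z\<close> is a combination of \<open>z\<close> and its
  conjugate, and at \<open>z = expo p x\<close> these have frequencies \<open>p\<close> and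
  \<open>- p\<close>.\<close>

lemma trig_poly_real_polynomial:
  assumes "real_polynomial_function (h :: complex \<Rightarrow> real)"
  shows "trig_poly p (\<lambda>x. of_real (h (expo p x)))"
  using assms
proof induction
  case (linear h)
  define u v where "u = complex_of_real (h 1)" and "v = complex_of_real (h \<i>)"
  have e: "of_real (h (expo p x)) = (u - \<i> * v) / 2 * expo (of_int 1 * p) x + (u + \<i> * v) / 2 * expo (of_int (- 1) * p) x" for x
  proof -
    define z where "z = expo p x"
    interpret bounded_linear h by fact
    have "z = Re z *\<^sub>R 1 + Im z *\<^sub>R \<i>" by (simp add: complex_eq_iff)
    then have "h z = Re z * h 1 + Im z * h \<i>" using add[of "Re z *\<^sub>R 1" "Im z *\<^sub>R \<i>"] scaleR by (metis real_scaleR_def)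
    moreover have "complex_of_real (Re z) = (z + cnj z) / 2" by (simp add: complex_add_cnj)
    moreover have "complex_of_real (Im z) = (z - cnj z) / (2 * \<i>)" by (simp add: complex_eq_iff)
    ultimately have "of_real (h z) = (z + cnj z) / 2 * u + (z - cnj z) / (2 * \<i>) * v" by (simp add: u_def v_def)
    also have "\<dots> = (u - \<i> * v) / 2 * z + (u + \<i> * v) / 2 * cnj z" by (simp add: field_simps)
    finally show ?thesis by (simp add: z_def expo_simps)
  qed
  show ?case unfolding e by (intro trig_poly.intros)
next
  case (const c)
  show ?case using trig_poly.monomial[of p "of_real c" 0] by (simp add: expo_simps)
next
  case (add f g)
  then show ?case using trig_poly.add[OF add.IH] by simp
next
  case (mult f g)
  then show ?case using trig_poly_mult[OF mult.IH] by simp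
qed

lemma expo_eq_1_iff: "expo k x = 1 \<longleftrightarrow> k * x \<in> \<int>"
proof -
  have "expo k x = 1 \<longleftrightarrow> (\<exists>n::int. k * x = of_int n)"
    by (simp add: expo_def exp_eq_1 algebra_simps)
  then show ?thesis by (auto elim: Ints_cases)
qed

lemma expo_eq_iff: "expo k x = expo l x \<longleftrightarrow> (k - l) * x \<in> \<int>"
proof -
  have "expo k x = expo (k - l) x * expo l x" by (simp add: expo_simps(3)[symmetric])
  then show ?thesis using expo_eq_1_iff[of "k - l" x] expo_simps(7)[of l x] by auto
qed

lemma expo_commute: "expo k x = expo x k"
  by (simp add: expo_def mult_ac)

lemma inj_on_expo_period:
  assumes "p > 0" "x \<in> {0..<1 / p}" "y \<in> {0..<1 / p}" "expo p x = expo p y"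
  shows "x = y"
proof -
  obtain n where n: "(x - y) * p = of_int n" using assms(4) by (metis Ints_cases expo_commute expo_eq_iff)
  have "0 \<le> x * p" "x * p < 1" "0 \<le> y * p" "y * p < 1" using assms by (auto simp: field_simps)
  then have "\<bar>real_of_int n\<bar> < 1" using n by (simp add: left_diff_distrib)
  then have "n = 0" by linarith
  then show ?thesis using n assms(1) by simp
qed

text \<open>Stone--Weierstrass gives orthogonality to all continuous functions of \<open>expo p\<close>, and these
  approximate indicators of compact sets. A real or imaginary part that is positive
  on a set of positive measure would be so on a compact set of positive measure.\<close>

lemma fourier_unique:
  fixes \<psi> :: "real \<Rightarrow> complex"
  assumes p: "p > 0" and bm: "bounded_meas (lebesgue_on {0<..<1 / p}) \<psi>"
    and zero: "\<And>k::int. (LINT x|lebesgue_on {0<..<1 / p}. expo (of_int k * p) x * \<psi> x) = 0"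
  shows "AE x in lebesgue_on {0<..<1 / p}. \<psi> x = 0"
proof -
  let ?I = "{0<..<1 / p}" and ?M = "lebesgue_on {0<..<1 / p}"
  have Im: "?I \<in> sets lebesgue" by simp
  have Il: "?I \<in> lmeasurable" by (simp add: bounded_set_imp_lmeasurable)
  have M: "finite_measure ?M" using Il by (rule finite_measure_lebesgue_on)
  obtain B where "\<forall>x\<in>space ?M. cmod (\<psi> x) \<le> B" using bm unfolding bounded_meas_def by (elim conjE exE)
  then have B: "cmod (\<psi> x) \<le> B" if "x \<in> ?I" for x using that by (auto simp del: greaterThanLessThan_iff)
  have psim: "\<psi> \<in> borel_measurable ?M" using bm by (simp add: bounded_meas_def)
  have trig: "integrable ?M (\<lambda>x. f x * \<psi> x) \<and> (LINT x|?M. f x * \<psi> x) = 0" if "trig_poly p f" for f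
    using that
  proof induction
    case (monomial c k)
    have "integrable ?M (\<lambda>x. expo (of_int k * p) x * \<psi> x)"
      by (rule bounded_meas_integrable[OF M bounded_meas_mult[OF bounded_meas_expo[OF Im] bm]])
    then show ?case using zero[of k] by (simp add: mult.assoc)
  next
    case (add f g)
    then show ?case by (simp add: distrib_right)
  qed
  have cont: "(LINT x|?M. of_real (h (expo p x)) * \<psi> x) = 0" if h: "continuous_on UNIV h" for h :: "complex \<Rightarrow> real"
  proof -
    have hc: "continuous_on ?I (\<lambda>x. complex_of_real (h (expo p x)))"
      by (intro continuous_on_of_real continuous_on_compose2[OF h expo_continuous]) auto
    have "compact (h ` sphere 0 1)" using h by (intro compact_continuous_image) (auto intro: continuous_on_subset)
    then obtain C where C: "\<And>z. cmod z = 1 \<Longrightarrow> \<bar>h z\<bar> \<le> C" using compact_imp_bounded by (force simp: bounded_iff)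
    have hb: "bounded_meas ?M (\<lambda>x. complex_of_real (h (expo p x)))"
      using C by (intro bounded_measI[where B = C] continuous_imp_measurable_on_sets_lebesgue[OF hc Im]) (auto simp: expo_simps)
    have hi: "integrable ?M (\<lambda>x. of_real (h (expo p x)) * \<psi> x)"
      by (rule bounded_meas_integrable[OF M bounded_meas_mult[OF hb bm]])
    have small: "cmod (LINT x|?M. of_real (h (expo p x)) * \<psi> x) \<le> e * (\<bar>B\<bar> * measure lebesgue ?I)" if "e > 0" for e
    proof -
      obtain g where g: "real_polynomial_function g" "\<And>z. z \<in> sphere 0 1 \<Longrightarrow> \<bar>h z - g z\<bar> < e"
        using Stone_Weierstrass_real_polynomial_function[of "sphere 0 1" h e] h \<open>e > 0\<close>
        by (metis compact_sphere continuous_on_subset subset_UNIV)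
      note tg = trig[OF trig_poly_real_polynomial[OF g(1)]]
      have "(LINT x|?M. of_real (h (expo p x)) * \<psi> x) = (LINT x|?M. of_real (h (expo p x)) * \<psi> x - of_real (g (expo p x)) * \<psi> x)"
        using tg hi by simp
      also have "cmod \<dots> \<le> (LINT x|?M. cmod (of_real (h (expo p x)) * \<psi> x - of_real (g (expo p x)) * \<psi> x))"
        by (rule integral_norm_bound)
      also have "\<dots> \<le> (LINT x|?M. e * \<bar>B\<bar>)"
      proof (rule integral_mono)
        show "integrable ?M (\<lambda>x. cmod (of_real (h (expo p x)) * \<psi> x - of_real (g (expo p x)) * \<psi> x))"
          using tg hi by (intro integrable_norm Bochner_Integration.integrable_diff) auto
        show "integrable ?M (\<lambda>x. e * \<bar>B\<bar>)" using M by (simp add: finite_measure.integrable_const)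
        fix x assume "x \<in> space ?M"
        then have "x \<in> ?I" by simp
        have "of_real (h (expo p x)) * \<psi> x - of_real (g (expo p x)) * \<psi> x = of_real (h (expo p x) - g (expo p x)) * \<psi> x"
          by (simp add: algebra_simps)
        also have "cmod \<dots> \<le> e * \<bar>B\<bar>"
          unfolding norm_mult using g(2)[of "expo p x"] B[OF \<open>x \<in> ?I\<close>] by (intro mult_mono) (auto simp: expo_simps simp del: of_real_diff)
        finally show "cmod (of_real (h (expo p x)) * \<psi> x - of_real (g (expo p x)) * \<psi> x) \<le> e * \<bar>B\<bar>" .
      qed
      also have "\<dots> = e * (\<bar>B\<bar> * measure lebesgue ?I)" by (simp add: measure_restrict_space)
      finally show ?thesis .
    qed
    show ?thesis
    proof (rule ccontr)
      define a where "a = cmod (LINT x|?M. of_real (h (expo p x)) * \<psi> x)"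
      define b where "b = \<bar>B\<bar> * measure lebesgue ?I + 1"
      assume "\<not> ?thesis"
      then have "a > 0" by (simp add: a_def)
      have b: "b > 0" unfolding b_def by (intro add_nonneg_pos mult_nonneg_nonneg) auto
      have "a \<le> a / (2 * b) * (b - 1)" using small[of "a / (2 * b)"] \<open>a > 0\<close> b by (simp add: a_def b_def)
      also have "\<dots> \<le> a / (2 * b) * b" using \<open>a > 0\<close> b by (intro mult_left_mono) auto
      also have "\<dots> = a / 2" using b by simp
      finally show False using \<open>a > 0\<close> by simp
    qed
  qed
  have comp: "(LINT x|?M. indicator K x * \<psi> x) = 0" if K: "compact K" "K \<subseteq> ?I" for K
  proof (cases "K = {}")
    case False
    define C where "C = expo p ` K"
    have C: "closed C" "C \<noteq> {}"
      using compact_continuous_image[OF expo_continuous K(1)] False by (auto simp: C_def compact_imp_closed)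
    \<comment> \<open>Continuous tent functions that are 1 on \<open>C\<close> and tend to 0 off
      \<open>C\<close>. As \<open>expo p\<close> is injective on one period, their compositions with
      it tend to the indicator of \<open>K\<close>.\<close>
    define h where "h = (\<lambda>n z. max 0 (1 - real n * infdist z C))"
    have hc: "continuous_on UNIV (h n)" for n unfolding h_def by (intro continuous_intros)
    have h01: "0 \<le> h n z" "h n z \<le> 1" for n z by (auto simp: h_def infdist_nonneg)
    have "(\<lambda>n. LINT x|?M. of_real (h n (expo p x)) * \<psi> x) \<longlonglongrightarrow> (LINT x|?M. indicator K x * \<psi> x)"
    proof (rule integral_dominated_convergence[where w = "\<lambda>_. \<bar>B\<bar>"])
      have Ks: "K \<in> sets ?M" using K(2) fmeasurableD[OF lmeasurable_compact[OF K(1)]] by (simp add: sets_restrict_space_iff)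
      show "(\<lambda>x. indicator K x * \<psi> x) \<in> borel_measurable ?M" using Ks psim by (intro borel_measurable_times borel_measurable_indicator)
      show "(\<lambda>x. of_real (h n (expo p x)) * \<psi> x) \<in> borel_measurable ?M" for n
        by (intro borel_measurable_times psim continuous_imp_measurable_on_sets_lebesgue Im continuous_on_of_real
            continuous_on_compose2[OF hc expo_continuous]) auto
      show "integrable ?M (\<lambda>_. \<bar>B\<bar>)" using M by (simp add: finite_measure.integrable_const)
      show "AE x in ?M. (\<lambda>n. of_real (h n (expo p x)) * \<psi> x) \<longlonglongrightarrow> indicator K x * \<psi> x"
      proof (rule AE_I2)
        fix x assume "x \<in> space ?M"
        then have x: "x \<in> ?I" by simp
        have "(\<lambda>n. h n (expo p x)) \<longlonglongrightarrow> indicator K x"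
        proof (cases "x \<in> K")
          case True
          then have "h n (expo p x) = 1" for n by (simp add: h_def C_def)
          then show ?thesis using True by simp
        next
          case False
          have "expo p x \<notin> C"
          proof
            assume "expo p x \<in> C"
            then obtain y where "y \<in> K" "expo p x = expo p y" by (auto simp: C_def)
            then show False using inj_on_expo_period[OF p, of x y] x K(2) False by force
          qed
          then have d: "infdist (expo p x) C > 0"
            using C by (metis in_closed_iff_infdist_zero infdist_nonneg order_le_less)
          obtain n0 :: nat where n0: "1 / infdist (expo p x) C < real n0" using reals_Archimedean2 by blast
          have "h n (expo p x) = 0" if "n \<ge> n0" for n
          proof -
            have "1 < real n0 * infdist (expo p x) C" using n0 d by (simp add: field_simps)
            also have "\<dots> \<le> real n * infdist (expo p x) C" using that d by (intro mult_right_mono) auto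
            finally show ?thesis by (simp add: h_def)
          qed
          then have "eventually (\<lambda>n. h n (expo p x) = 0) sequentially" by (auto simp: eventually_sequentially)
          then show ?thesis using False by (simp add: tendsto_eventually)
        qed
        then have "(\<lambda>n. complex_of_real (h n (expo p x)) * \<psi> x) \<longlonglongrightarrow> complex_of_real (indicator K x) * \<psi> x"
          by (intro tendsto_intros)
        then show "(\<lambda>n. of_real (h n (expo p x)) * \<psi> x) \<longlonglongrightarrow> indicator K x * \<psi> x"
          by (simp add: indicator_def of_bool_def split: if_splits)
      qed
      show "AE x in ?M. cmod (of_real (h n (expo p x)) * \<psi> x) \<le> \<bar>B\<bar>" for n
      proof (rule AE_I2)
        fix x assume "x \<in> space ?M"
        then have "cmod (\<psi> x) \<le> \<bar>B\<bar>" using B by force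
        then have "\<bar>h n (expo p x)\<bar> * cmod (\<psi> x) \<le> 1 * \<bar>B\<bar>" using h01[of n "expo p x"] by (intro mult_mono) auto
        then show "cmod (of_real (h n (expo p x)) * \<psi> x) \<le> \<bar>B\<bar>" by (simp add: norm_mult)
      qed
    qed
    then show ?thesis using cont[OF hc] by (simp add: LIMSEQ_const_iff)
  qed simp
  \<comment> \<open>An arbitrary real-linear functional treats the real part, the imaginary part and
    their negatives at once.\<close>
  have half: "AE x in ?M. L (\<psi> x) \<le> 0" if L: "bounded_linear L" for L :: "complex \<Rightarrow> real"
  proof (rule ccontr)
    define V where "V = {x\<in>?I. L (\<psi> x) > 0}"
    have Lm: "(\<lambda>x. L (\<psi> x)) \<in> borel_measurable ?M"
      using borel_measurable_continuous_onI[OF linear_continuous_on[OF L]] psim by (rule measurable_compose[rotated])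
    have "{x \<in> space ?M. L (\<psi> x) > 0} \<in> sets ?M" using Lm by measurable
    then have Vm: "V \<in> sets lebesgue" by (simp add: V_def sets_restrict_space_iff)
    assume nAE: "\<not> (AE x in ?M. L (\<psi> x) \<le> 0)"
    have "V \<notin> null_sets lebesgue"
    proof
      assume "V \<in> null_sets lebesgue"
      then have "AE x in lebesgue. x \<notin> V" by (rule AE_not_in)
      then have "AE x in lebesgue. x \<in> ?I \<longrightarrow> L (\<psi> x) \<le> 0" by eventually_elim (auto simp: V_def not_less)
      then show False using nAE by (simp add: AE_restrict_space_iff)
    qed
    then have "0 < emeasure lebesgue V" using Vm by (simp add: null_sets_def zero_less_iff_neq_zero)
    have Vb: "bounded V" by (rule bounded_subset[of ?I]) (auto simp: V_def)
    have Vl: "V \<in> lmeasurable" using Vb Vm by (rule bounded_set_imp_lmeasurable)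
    have Vpos: "0 < measure lebesgue V" using \<open>0 < emeasure lebesgue V\<close> emeasure_eq_measure2[OF Vl] by simp
    obtain K where K: "closed K" "K \<subseteq> V" "V - K \<in> lmeasurable" "emeasure lebesgue (V - K) < ennreal (measure lebesgue V / 2)"
      using sets_lebesgue_inner_closed[OF Vm, of "measure lebesgue V / 2"] Vpos by auto
    have Kb: "K \<subseteq> ?I" using K(2) by (auto simp: V_def)
    then have Kc: "compact K" using K(1) bounded_subset[of ?I K] by (simp add: compact_eq_bounded_closed)
    have Kl: "K \<in> lmeasurable" using Kc by (rule lmeasurable_compact)
    have Kpos: "0 < measure lebesgue K"
    proof -
      have "measure lebesgue (V - K) < measure lebesgue V / 2" using K(4) Vpos emeasure_eq_measure2[OF K(3)] by (simp add: ennreal_less_iff)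
      moreover have "measure lebesgue (V - K) = measure lebesgue V - measure lebesgue K"
        by (rule measurable_measure_Diff[OF Vl fmeasurableD[OF Kl] K(2)])
      ultimately show ?thesis using Vpos by linarith
    qed
    have Ks: "K \<in> sets ?M" using Kb fmeasurableD[OF Kl] by (simp add: sets_restrict_space_iff)
    have bmK: "bounded_meas ?M (\<lambda>x. indicator K x * \<psi> x)"
      by (rule bounded_meas_mult[OF bounded_measI[where B = 1] bm]) (use Ks in \<open>auto simp: indicator_def\<close>)
    have Ki: "integrable ?M (\<lambda>x. indicator K x * \<psi> x)" by (rule bounded_meas_integrable[OF M bmK])
    have "(LINT x|?M. L (indicator K x * \<psi> x)) = L (LINT x|?M. indicator K x * \<psi> x)"
      by (rule integral_bounded_linear[OF L Ki])
    also have "\<dots> = 0" using comp[OF Kc Kb] L by (simp add: bounded_linear.linear linear_0)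
    finally have z: "(LINT x|?M. L (indicator K x * \<psi> x)) = 0" .
    have Lin: "L (indicator K x * \<psi> x) = indicator K x * L (\<psi> x)" for x
      using L by (simp add: indicator_def bounded_linear.linear linear_0)
    have "integrable ?M (\<lambda>x. L (indicator K x * \<psi> x))" by (rule integrable_bounded_linear[OF L Ki])
    moreover have "AE x in ?M. 0 \<le> L (indicator K x * \<psi> x)"
      unfolding Lin using K(2) by (intro AE_I2) (auto simp: indicator_def V_def)
    ultimately have "AE x in ?M. L (indicator K x * \<psi> x) = 0" using integral_nonneg_eq_0_iff_AE z by blast
    then have "AE x in ?M. x \<notin> K" unfolding Lin by eventually_elim (use K(2) in \<open>auto simp: indicator_def V_def\<close>)
    then have "emeasure ?M K = 0" using AE_iff_null_sets[OF Ks] by blast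
    then have "emeasure lebesgue K = 0" using Kb by (simp add: emeasure_restrict_space)
    then show False using Kpos by (simp add: measure_def)
  qed
  have "AE x in ?M. Re (\<psi> x) \<le> 0 \<and> - Re (\<psi> x) \<le> 0 \<and> Im (\<psi> x) \<le> 0 \<and> - Im (\<psi> x) \<le> 0"
    using half[OF bounded_linear_Re] half[OF bounded_linear_minus[OF bounded_linear_Re]]
      half[OF bounded_linear_Im] half[OF bounded_linear_minus[OF bounded_linear_Im]] by eventually_elim simp
  then show ?thesis by eventually_elim (simp add: complex_eq_iff)
qed

lemma integral_expo_period:
  assumes "t \<noteq> 0" "a \<le> b" "t * (b - a) \<in> \<int>"
  shows "integral {a..b} (expo t) = 0"
proof -
  have "expo t b = expo t a"
    using assms(3) by (simp add: expo_commute[of t] expo_eq_iff mult.commute)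
  then show ?thesis using integral_unique[OF expo_has_integral[OF assms(1,2)]] by simp
qed

section \<open>Fibres\<close>

lemma measurable_translation_lebesgue: "(\<lambda>x::real. x + c) \<in> lebesgue \<rightarrow>\<^sub>M lebesgue"
  using lebesgue_affine_measurable[where c = "\<lambda>_::real. 1" and t = c] by (simp add: add.commute)

lemma integral_sum_translates:
  fixes g :: "real \<Rightarrow> 'b::euclidean_space"
  assumes g: "\<And>a b. g integrable_on {a..b}" and q: "q \<ge> 0"
  shows "(\<Sum>n<N. integral {0..q} (\<lambda>x. g (x + (s + real n * q)))) = integral {s..s + real N * q} g"
proof (induction N)
  case (Suc N)
  have e: "g \<circ> (+) (s + real N * q) = (\<lambda>x. g (x + (s + real N * q)))" by (simp add: fun_eq_iff add.commute)
  have "integral {0..q} (\<lambda>x. g (x + (s + real N * q))) = integral {s + real N * q..s + real (Suc N) * q} g"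
    unfolding integral_shift_Icc_real[of 0 q g "s + real N * q", unfolded e] by (simp add: algebra_simps)
  then have "(\<Sum>n<Suc N. integral {0..q} (\<lambda>x. g (x + (s + real n * q))))
    = integral {s..s + real N * q} g + integral {s + real N * q..s + real (Suc N) * q} g"
    by (simp add: Suc.IH)
  also have "\<dots> = integral {s..s + real (Suc N) * q} g"
    using q by (intro Henstock_Kurzweil_Integration.integral_combine g) (auto simp: algebra_simps)
  finally show ?case .
qed simp

text \<open>Both sides integrate the conjugate of \<open>g\<close> over the intersection. This moves
  Fourier coefficients from \<Omega> to an interval, where a residue class of exponentials is
  orthogonal.\<close>

lemma inn_indicator_swap:
  fixes A B :: "real set"
  assumes "A \<in> sets lebesgue" "B \<in> sets lebesgue"
  shows "inn (lebesgue_on A) (indicator B) g = inn (lebesgue_on B) (indicator A) g"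
proof -
  have "inn (lebesgue_on A) (indicator B) g = (LINT x|lebesgue. indicator A x *\<^sub>R (indicator B x * cnj (g x)))"
    if "A \<in> sets lebesgue" for A B :: "real set"
    using that by (simp add: inn_def integral_restrict_space)
  note e = this[OF assms(1), of B] this[OF assms(2), of A]
  show ?thesis unfolding e by (rule Bochner_Integration.integral_cong) (auto simp: indicator_def)
qed

lemma nsq_indicator:
  fixes A B :: "real set"
  assumes "A \<in> sets lebesgue" "B \<in> sets lebesgue"
  shows "nsq (lebesgue_on A) (indicator B) = measure lebesgue (A \<inter> B)"
proof -
  have "nsq (lebesgue_on A) (indicator B) = (LINT x|lebesgue. indicator (A \<inter> B) x)"
  proof -
    have "indicat_real A x *\<^sub>R (cmod (indicator B x))\<^sup>2 = indicator (A \<inter> B) x" for x by (auto simp: indicator_def)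
    then show ?thesis using assms by (simp add: nsq_def integral_restrict_space)
  qed
  then show ?thesis using assms by simp
qed

context unit_domain
begin

lemma spectrum_orth: "is_spectrum \<Omega> \<Lambda> \<Longrightarrow> k \<in> \<Lambda> \<Longrightarrow> l \<in> \<Lambda> \<Longrightarrow> inn (lebesgue_on \<Omega>) (expo k) (expo l) = (if k = l then 1 else 0)"
  by (auto simp: is_spectrum_def orthogonal_exponentials_def L2_inner_def inn_def[symmetric] inn_expo U_0)

text \<open>Density yields some approximating combination, and by the Pythagorean identity the
  Fourier coefficients on the same frequencies do at least as well.\<close>

lemma spectrum_parseval:
  assumes "is_spectrum \<Omega> \<Lambda>" and f: "bounded_meas (lebesgue_on \<Omega>) f" and "0 < \<epsilon>"
  obtains F where "finite F" "F \<subseteq> \<Lambda>" "nsq (lebesgue_on \<Omega>) f - \<epsilon> < (\<Sum>l\<in>F. (cmod (inn (lebesgue_on \<Omega>) f (expo l)))\<^sup>2)"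
proof -
  have L2: "L2_fun \<Omega> f" using f bounded_meas_sq_integrable[OF fm f] by (simp add: L2_fun_def bounded_meas_def)
  have "complete_exponentials \<Omega> \<Lambda>" using assms(1) by (simp add: is_spectrum_def)
  moreover have "0 < sqrt \<epsilon>" using assms(3) by simp
  ultimately obtain F c where F: "finite F" "F \<subseteq> \<Lambda>" "L2_norm \<Omega> (\<lambda>x. f x - (\<Sum>l\<in>F. c l * expo l x)) < sqrt \<epsilon>"
    using L2 unfolding complete_exponentials_def by metis
  have "nsq (lebesgue_on \<Omega>) (\<lambda>x. f x - (\<Sum>l\<in>F. c l * expo l x)) < \<epsilon>"
    using F(3) by (simp add: L2_norm_def nsq_def)
  moreover have "nsq (lebesgue_on \<Omega>) (\<lambda>x. f x - (\<Sum>l\<in>F. c l * expo l x)) = nsq (lebesgue_on \<Omega>) f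
      - (\<Sum>l\<in>F. (cmod (inn (lebesgue_on \<Omega>) f (expo l)))\<^sup>2) + (\<Sum>l\<in>F. (cmod (c l - inn (lebesgue_on \<Omega>) f (expo l)))\<^sup>2)"
    by (rule nsq_diff_orthonormal_sum[OF fm F(1) f expo_bm]) (use F(2) spectrum_orth[OF assms(1)] in blast)
  moreover have "0 \<le> (\<Sum>l\<in>F. (cmod (c l - inn (lebesgue_on \<Omega>) f (expo l)))\<^sup>2)" by (intro sum_nonneg) simp
  ultimately have "nsq (lebesgue_on \<Omega>) f - \<epsilon> < (\<Sum>l\<in>F. (cmod (inn (lebesgue_on \<Omega>) f (expo l)))\<^sup>2)" by linarith
  then show thesis by (rule that[OF F(1,2)])
qed

lemma spectrum_exp_basis:
  assumes "is_spectrum \<Omega> \<Lambda>"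
  shows "exp_basis \<Lambda>"
  unfolding exp_basis_def
proof (intro conjI ballI impI allI)
  fix l m assume "l \<in> \<Lambda>" "m \<in> \<Lambda>" "l \<noteq> m"
  then show "U (l - m) = 0" using spectrum_orth[OF assms, of l m] unfolding inn_expo by simp
next
  fix \<xi> \<epsilon> :: real assume "0 < \<epsilon>"
  from spectrum_parseval[OF assms expo_bm[of \<xi>] this]
  show "\<exists>F. finite F \<and> F \<subseteq> \<Lambda> \<and> 1 - \<epsilon> < (\<Sum>l\<in>F. (cmod (U (\<xi> - l)))\<^sup>2)"
    unfolding nsq_expo inn_expo by metis
qed

text \<open>\<open>fibre_sum p m \<theta> x\<close> sums \<open>expo \<theta>\<close> over the points of \<open>\<Omega>\<close> congruent to \<open>x\<close> modulo
  \<open>1 / p\<close>; the parameter \<open>m\<close> only has to be large enough for \<open>\<Omega>\<close>.\<close>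

definition fibre_sum :: "real \<Rightarrow> nat \<Rightarrow> real \<Rightarrow> real \<Rightarrow> complex" where
  "fibre_sum p m \<theta> x = (\<Sum>n<2 * m. if x + (- (real m / p) + real n * (1 / p)) \<in> \<Omega>
     then expo \<theta> (x + (- (real m / p) + real n * (1 / p))) else 0)"

lemma restricted_expo_bm:
  assumes "A \<in> sets lebesgue"
  shows "bounded_meas (lebesgue_on A) (\<lambda>x. if x + c \<in> \<Omega> then expo \<theta> (x + c) else 0)"
proof (rule bounded_measI[where B = 1])
  have "(\<lambda>x. indicator \<Omega> x * expo \<theta> x) \<in> borel_measurable lebesgue"
    using lm continuous_imp_measurable_on_sets_lebesgue[OF expo_continuous, of UNIV \<theta>]
    by (intro borel_measurable_times borel_measurable_indicator) (simp_all add: lebesgue_on_UNIV_eq)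
  then have "(\<lambda>x. indicator \<Omega> (x + c) * expo \<theta> (x + c)) \<in> borel_measurable lebesgue"
    using measurable_translation_lebesgue by (rule measurable_compose[rotated])
  moreover have "(\<lambda>x. indicator \<Omega> (x + c) * expo \<theta> (x + c)) = (\<lambda>x. if x + c \<in> \<Omega> then expo \<theta> (x + c) else 0)"
    by (auto simp: indicator_def)
  ultimately show "(\<lambda>x. if x + c \<in> \<Omega> then expo \<theta> (x + c) else 0) \<in> borel_measurable (lebesgue_on A)"
    by (simp add: measurable_restrict_space1)
qed (simp add: expo_simps(2))

lemma fibre_sum_bm:
  assumes "A \<in> sets lebesgue"
  shows "bounded_meas (lebesgue_on A) (fibre_sum p m \<theta>)"
  unfolding fibre_sum_def[abs_def] by (rule bounded_meas_sum, rule restricted_expo_bm[OF assms])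

text \<open>The \<open>2 * m\<close> translates of an interval of length \<open>1 / p\<close> tile
  \<open>[-m / p, m / p]\<close>, which contains \<Omega>; folding the integral over \<Omega> along
  them gives the fibre sum.\<close>

lemma fibre_sum_integral:
  assumes p: "p > 0" and m: "\<Omega> \<subseteq> {- (real m / p)..real m / p}"
  shows "(LINT x|lebesgue_on {0<..<1 / p}. fibre_sum p m \<theta> x) = U \<theta>"
proof -
  let ?M = "lebesgue_on {0<..<1 / p}" and ?g = "\<lambda>x. if x \<in> \<Omega> then expo \<theta> x else 0"
  have I: "{0<..<1 / p} \<in> lmeasurable" by (simp add: bounded_set_imp_lmeasurable)
  have M: "finite_measure ?M" using I by (rule finite_measure_lebesgue_on)
  have gi: "integrable ?M (\<lambda>x. ?g (x + c))" for c
    by (rule bounded_meas_integrable[OF M restricted_expo_bm]) simp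
  have gab: "?g integrable_on {a..b}" for a b
  proof (rule integrable_on_lebesgue_on[OF bounded_meas_integrable])
    show "finite_measure (lebesgue_on {a..b})" by (rule finite_measure_lebesgue_on) simp
    show "bounded_meas (lebesgue_on {a..b}) ?g" using restricted_expo_bm[of "{a..b}" 0 \<theta>] by (simp cong: if_cong)
  qed simp
  have "(LINT x|?M. fibre_sum p m \<theta> x) = (\<Sum>n<2 * m. LINT x|?M. ?g (x + (- (real m / p) + real n * (1 / p))))"
    unfolding fibre_sum_def by (rule Bochner_Integration.integral_sum) (rule gi)
  also have "\<dots> = (\<Sum>n<2 * m. integral {0..1 / p} (\<lambda>x. ?g (x + (- (real m / p) + real n * (1 / p)))))"
    unfolding integral_open_interval_real by (intro sum.cong refl lebesgue_integral_eq_integral[OF gi]) simp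
  also have "\<dots> = integral {- (real m / p)..- (real m / p) + real (2 * m) * (1 / p)} ?g"
    by (rule integral_sum_translates[OF gab]) (use p in simp)
  also have "{- (real m / p)..- (real m / p) + real (2 * m) * (1 / p)} = {- (real m / p)..real m / p}"
    by (simp add: field_simps)
  also have "integral {- (real m / p)..real m / p} ?g = U \<theta>"
    using m by (simp add: integral_restrict_Int U_def inf.absorb1)
  finally show ?thesis .
qed

text \<open>The points of a fibre differ by multiples of \<open>1 / p\<close>, at which exponentials
  with frequency in \<open>p \<int>\<close> equal 1. Hence the Fourier coefficients of a fibre sum
  are samples of \<open>U\<close> along a residue class modulo \<open>p\<close>.\<close>

lemma fibre_sum_shift:
  assumes p: "p > 0"
  shows "fibre_sum p m (of_int k * p + \<theta>) x = expo (of_int k * p) x * fibre_sum p m \<theta> x"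
proof -
  have "expo (of_int k * p) (- (real m / p) + real n * (1 / p)) = 1" for n
  proof -
    have "of_int k * p * (- (real m / p) + real n * (1 / p)) = of_int (k * (int n - int m))"
      using p by (simp add: field_simps)
    then show ?thesis unfolding expo_eq_1_iff by (metis Ints_of_int)
  qed
  then have "expo (of_int k * p + \<theta>) (x + (- (real m / p) + real n * (1 / p)))
    = expo (of_int k * p) x * expo \<theta> (x + (- (real m / p) + real n * (1 / p)))" for n
    by (simp only: expo_simps(3) expo_simps(4)[of "of_int k * p"] mult_1_right)
  then show ?thesis unfolding fibre_sum_def sum_distrib_left by (intro sum.cong refl) simp
qed

lemma fibre_sum_fourier:
  assumes "p > 0" "\<Omega> \<subseteq> {- (real m / p)..real m / p}"
  shows "(LINT x|lebesgue_on {0<..<1 / p}. expo (of_int k * p) x * fibre_sum p m \<theta> x) = U (of_int k * p + \<theta>)"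
  using fibre_sum_integral[OF assms, of "of_int k * p + \<theta>"] by (simp add: fibre_sum_shift[OF assms(1)])

lemma fibre_sum_eq_0:
  assumes "p > 0" "\<Omega> \<subseteq> {- (real m / p)..real m / p}" "\<And>k::int. U (of_int k * p + \<theta>) = 0"
  shows "AE x in lebesgue_on {0<..<1 / p}. fibre_sum p m \<theta> x = 0"
  using assms by (intro fourier_unique fibre_sum_bm) (auto simp: fibre_sum_fourier)

text \<open>At frequency 0 the fibre sum counts points. All its Fourier coefficients match those of
  the constant \<open>p\<close>: the ones of nonzero index vanish, and the zeroth is
  \<open>U 0 = 1\<close>, the integral of \<open>p\<close> over length \<open>1 / p\<close>.\<close>

lemma fibre_sum_0_eq:
  assumes p: "p > 0" and m: "\<Omega> \<subseteq> {- (real m / p)..real m / p}" and z: "\<And>k::int. k \<noteq> 0 \<Longrightarrow> U (of_int k * p) = 0"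
  shows "AE x in lebesgue_on {0<..<1 / p}. fibre_sum p m 0 x = of_real p"
proof -
  let ?I = "{0<..<1 / p}" and ?M = "lebesgue_on {0<..<1 / p}"
  have I: "?I \<in> lmeasurable" by (simp add: bounded_set_imp_lmeasurable)
  have M: "finite_measure ?M" using I by (rule finite_measure_lebesgue_on)
  have bm: "bounded_meas ?M (fibre_sum p m 0)" by (rule fibre_sum_bm) simp
  have e: "bounded_meas ?M (expo k)" for k by (rule bounded_meas_expo) simp
  have "AE x in ?M. fibre_sum p m 0 x - of_real p = 0"
  proof (rule fourier_unique[OF p])
    show "bounded_meas ?M (\<lambda>x. fibre_sum p m 0 x - of_real p)" by (rule bounded_meas_diff[OF bm bounded_meas_const])
    fix k :: int
    have ie: "(LINT x|?M. expo (of_int k * p) x) = (if k = 0 then 1 / of_real p else 0)"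
    proof -
      have "(LINT x|?M. expo (of_int k * p) x) = integral ?I (expo (of_int k * p))"
        by (rule lebesgue_integral_eq_integral[OF bounded_meas_integrable[OF M e]]) simp
      also have "\<dots> = integral {0..1 / p} (expo (of_int k * p))" by (rule integral_open_interval_real[symmetric])
      also have "\<dots> = (if k = 0 then 1 / of_real p else 0)"
      proof (cases "k = 0")
        case True
        have "expo 0 = (\<lambda>x. 1)" by (simp add: fun_eq_iff expo_simps)
        then show ?thesis using True p by (simp add: scaleR_conv_of_real)
      qed (use p in \<open>simp add: integral_expo_period\<close>)
      finally show ?thesis .
    qed
    have "(LINT x|?M. expo (of_int k * p) x * (fibre_sum p m 0 x - of_real p))
      = (LINT x|?M. expo (of_int k * p) x * fibre_sum p m 0 x) - (LINT x|?M. expo (of_int k * p) x) * of_real p"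
      using bounded_meas_integrable[OF M bounded_meas_mult[OF e bm]] bounded_meas_integrable[OF M e]
      by (simp add: right_diff_distrib)
    also have "\<dots> = 0" using z[of k] p U_0 by (simp add: fibre_sum_fourier[OF p m, of k 0, simplified] ie)
    finally show "(LINT x|?M. expo (of_int k * p) x * (fibre_sum p m 0 x - of_real p)) = 0" .
  qed
  then show ?thesis by simp
qed

end

lemma AE_ex:
  assumes "AE x in M. P x" "emeasure M (space M) \<noteq> 0"
  shows "\<exists>x\<in>space M. P x"
proof (rule ccontr)
  assume "\<not> (\<exists>x\<in>space M. P x)"
  then have "AE x in M. P x \<longrightarrow> False" by (intro AE_I2) blast
  from AE_mp[OF assms(1) this] have "AE x in M. False" .
  then have "ae_filter M = bot" by (simp add: trivial_limit_def)
  then show False using assms(2) by (simp add: ae_filter_eq_bot_iff)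
qed

lemma expo_power: "expo k (real n * x) = expo k x ^ n"
proof (induction n)
  case (Suc n)
  have "real (Suc n) * x = x + real n * x" by (simp add: algebra_simps)
  then show ?case by (simp only: expo_simps(4) Suc.IH power_Suc)
qed (simp add: expo_commute[of k 0] expo_simps(1))

lemma bounded_meas_indicator: "S \<in> sets lebesgue \<Longrightarrow> bounded_meas (lebesgue_on A) (indicator S)"
  by (intro bounded_measI[where B = 1] measurable_restrict_space1 borel_measurable_indicator) (auto simp: indicator_def)

section \<open>Counting residue classes\<close>

lemma residue_class_bessel:
  assumes p: "p > 0" and S: "S \<in> sets lebesgue"
    and F: "finite F" "\<And>k l. k \<in> F \<Longrightarrow> l \<in> F \<Longrightarrow> (k - l) / p \<in> \<int>"
  shows "(\<Sum>l\<in>F. (cmod (inn (lebesgue_on {a..a + 1 / p}) (indicator S) (expo l)))\<^sup>2) \<le> 1 / p * measure lebesgue ({a..a + 1 / p} \<inter> S)"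
proof -
  let ?I = "{a..a + 1 / p}"
  have M: "finite_measure (lebesgue_on ?I)" by (rule finite_measure_lebesgue_on) simp
  have e: "bounded_meas (lebesgue_on ?I) (expo k)" for k by (rule bounded_meas_expo) simp
  have on: "inn (lebesgue_on ?I) (expo k) (expo l) = (if k = l then of_real (1 / p) else 0)" if "k \<in> F" "l \<in> F" for k l
  proof -
    have "inn (lebesgue_on ?I) (expo k) (expo l) = (LINT x|lebesgue_on ?I. expo (k - l) x)"
      by (simp add: inn_def expo_simps)
    also have "\<dots> = integral ?I (expo (k - l))"
      by (rule lebesgue_integral_eq_integral[OF bounded_meas_integrable[OF M e]]) simp
    also have "\<dots> = (if k = l then of_real (1 / p) else 0)"
    proof (cases "k = l")
      case True
      have "expo 0 = (\<lambda>x. 1)" by (simp add: fun_eq_iff expo_simps)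
      then show ?thesis using True p by (simp add: scaleR_conv_of_real)
    qed (use p F(2)[OF that] in \<open>simp add: integral_expo_period\<close>)
    finally show ?thesis .
  qed
  have bS: "bounded_meas (lebesgue_on ?I) (indicator S)" using S by (rule bounded_meas_indicator)
  have "(\<Sum>l\<in>F. (cmod (inn (lebesgue_on ?I) (indicator S) (expo l)))\<^sup>2) \<le> 1 / p * nsq (lebesgue_on ?I) (indicator S)"
  proof (rule dual_sieve[OF M F(1) bS e])
    fix c
    show "nsq (lebesgue_on ?I) (\<lambda>x. \<Sum>k\<in>F. c k * expo k x) \<le> 1 / p * (\<Sum>k\<in>F. (cmod (c k))\<^sup>2)"
      using nsq_orthonormal_sum[OF M F(1) e on, of c] by simp
  qed (use p in simp)
  then show ?thesis using S by (simp add: nsq_indicator)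
qed

context unit_domain
begin

text \<open>Countably many intervals of length \<open>1 / p\<close> cover the line, and they cannot
  all meet \<Omega> in null sets.\<close>

lemma ex_positive_interval:
  assumes p: "p > 0"
  obtains a where "0 < measure lebesgue ({a..a + 1 / p} \<inter> \<Omega>)"
proof -
  let ?I = "\<lambda>n::int. {of_int n / p..of_int n / p + 1 / p}"
  have ml: "?I n \<inter> \<Omega> \<in> lmeasurable" for n using lmeas by (intro fmeasurable_Int_fmeasurable) auto
  have "\<exists>n. ?I n \<inter> \<Omega> \<notin> null_sets lebesgue"
  proof (rule ccontr)
    assume "\<not> ?thesis"
    then have "(\<Union>n. ?I n \<inter> \<Omega>) \<in> null_sets lebesgue" by (intro null_sets_UN) blast
    moreover have "(\<Union>n. ?I n \<inter> \<Omega>) = \<Omega>"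
    proof -
      have "x \<in> ?I \<lfloor>x * p\<rfloor>" for x using p of_int_floor_le[of "x * p"] real_of_int_floor_add_one_ge[of "x * p"] by (simp add: field_simps)
      then show ?thesis by blast
    qed
    ultimately show False using m1 by (simp add: null_sets_def)
  qed
  then obtain n where "?I n \<inter> \<Omega> \<notin> null_sets lebesgue" ..
  then have "measure lebesgue (?I n \<inter> \<Omega>) \<noteq> 0"
    using ml[of n] emeasure_eq_measure2[OF ml[of n]] fmeasurableD[OF ml[of n]] by (auto simp: null_sets_def)
  then have "0 < measure lebesgue (?I n \<inter> \<Omega>)" by (simp add: less_le)
  then show thesis by (rule that)
qed

text \<open>On an interval of length \<open>1 / p\<close> the exponentials of one residue class modulo \<open>p\<close> are orthogonal
  with square norm \<open>1 / p\<close>. Each class thus carries at most the proportion \<open>1 / p\<close> of the norm of an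
  indicator function, while all classes together carry all of it.\<close>

lemma period_le_card_residues:
  assumes sp: "is_spectrum \<Omega> \<Lambda>" and p: "p > 0" and R: "finite R"
    and res: "\<And>l. l \<in> \<Lambda> \<Longrightarrow> r l \<in> R \<and> (l - r l) / p \<in> \<int>"
  shows "p \<le> card R"
proof -
  obtain a where a: "0 < measure lebesgue ({a..a + 1 / p} \<inter> \<Omega>)" using ex_positive_interval[OF p] .
  let ?I = "{a..a + 1 / p}"
  define \<mu> where "\<mu> = measure lebesgue (?I \<inter> \<Omega>)"
  have \<mu>: "\<mu> > 0" using a by (simp add: \<mu>_def)
  have bI: "bounded_meas (lebesgue_on \<Omega>) (indicator ?I)" by (rule bounded_meas_indicator) simp
  have "\<mu> \<le> card R * (1 / p * \<mu>)"
  proof (rule field_le_epsilon)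
    fix \<epsilon> :: real assume "0 < \<epsilon>"
    define h where "h = (\<lambda>l. (cmod (inn (lebesgue_on \<Omega>) (indicator ?I) (expo l)))\<^sup>2)"
    obtain F where F: "finite F" "F \<subseteq> \<Lambda>" "nsq (lebesgue_on \<Omega>) (indicator ?I) - \<epsilon> < (\<Sum>l\<in>F. h l)"
      using spectrum_parseval[OF sp bI \<open>0 < \<epsilon>\<close>] unfolding h_def by blast
    have "(\<Sum>l\<in>F. h l) = (\<Sum>\<rho>\<in>R. \<Sum>l\<in>{l \<in> F. r l = \<rho>}. h l)"
      using res F by (intro sum.group[symmetric] R) auto
    also have "\<dots> \<le> (\<Sum>\<rho>\<in>R. 1 / p * \<mu>)"
    proof (rule sum_mono)
      fix \<rho>
      have h: "h l = (cmod (inn (lebesgue_on ?I) (indicator \<Omega>) (expo l)))\<^sup>2" for l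
        unfolding h_def using lm by (subst inn_indicator_swap) auto
      show "(\<Sum>l\<in>{l \<in> F. r l = \<rho>}. h l) \<le> 1 / p * \<mu>"
        unfolding h \<mu>_def
      proof (rule residue_class_bessel[OF p lm])
        fix k l assume "k \<in> {l \<in> F. r l = \<rho>}" "l \<in> {l \<in> F. r l = \<rho>}"
        then have "(k - \<rho>) / p \<in> \<int>" "(l - \<rho>) / p \<in> \<int>" using res[of k] res[of l] F(2) by auto
        then have "(k - \<rho>) / p - (l - \<rho>) / p \<in> \<int>" by (rule Ints_diff)
        then show "(k - l) / p \<in> \<int>" by (simp add: diff_divide_distrib)
      qed (use F(1) in simp)
    qed
    also have "\<dots> = card R * (1 / p * \<mu>)" by simp
    finally have "(\<Sum>l\<in>F. h l) \<le> card R * (1 / p * \<mu>)" .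
    moreover have "nsq (lebesgue_on \<Omega>) (indicator ?I) = \<mu>" using lm by (simp add: nsq_indicator \<mu>_def Int_commute)
    ultimately show "\<mu> \<le> card R * (1 / p * \<mu>) + \<epsilon>" using F(3) by linarith
  qed
  then have "\<mu> * p \<le> card R * \<mu>" using p by (simp add: field_simps)
  then show ?thesis using \<mu> by (simp add: mult.commute)
qed

section \<open>A common fibre, and rationality\<close>

text \<open>Finitely many conditions, each valid almost everywhere, hold together at some
  \<open>x\<close>. Its fibre is described by integer multiples of \<open>1 / p\<close>, and the
  count of its points equals \<open>p\<close>, so \<open>p\<close> is an integer.\<close>

lemma common_fibre:
  assumes p: "p > 0" and zp: "\<And>k::int. k \<noteq> 0 \<Longrightarrow> U (of_int k * p) = 0"
    and T: "finite T" "\<And>\<theta> k::int. \<theta> \<in> T \<Longrightarrow> U (of_int k * p + \<theta>) = 0"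
  obtains A :: "nat set" where "finite A" "0 \<in> A" "real (card A) = p"
    "\<And>\<theta>. \<theta> \<in> T \<Longrightarrow> (\<Sum>n\<in>A. expo \<theta> (1 / p) ^ n) = 0"
proof -
  obtain L where L: "\<And>x. x \<in> \<Omega> \<Longrightarrow> \<bar>x\<bar> \<le> L" using bdd by (auto simp: bounded_iff)
  define m where "m = nat \<lceil>\<bar>L\<bar> * p\<rceil>"
  have "\<bar>L\<bar> * p \<le> real m" unfolding m_def by (rule real_nat_ceiling_ge)
  then have "\<bar>L\<bar> \<le> real m / p" using p by (simp add: field_simps)
  then have m: "\<Omega> \<subseteq> {- (real m / p)..real m / p}" using L by force
  let ?M = "lebesgue_on {0<..<1 / p}"
  have "AE x in ?M. fibre_sum p m 0 x = of_real p \<and> (\<forall>\<theta>\<in>T. fibre_sum p m \<theta> x = 0)"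
    using fibre_sum_0_eq[OF p m zp] fibre_sum_eq_0[OF p m T(2)] T(1)
    by (intro AE_conjI AE_finite_allI) auto
  moreover have "emeasure ?M (space ?M) \<noteq> 0" using p by (simp add: emeasure_restrict_space)
  ultimately obtain x where x: "fibre_sum p m 0 x = of_real p" "\<And>\<theta>. \<theta> \<in> T \<Longrightarrow> fibre_sum p m \<theta> x = 0"
    using AE_ex by blast
  define x0 where "x0 = x - real m / p"
  define B where "B = {n. n < 2 * m \<and> x0 + real n * (1 / p) \<in> \<Omega>}"
  have fB: "finite B" by (simp add: B_def)
  have fs: "fibre_sum p m \<theta> x = (\<Sum>n\<in>B. expo \<theta> (x0 + real n * (1 / p)))" for \<theta>
  proof -
    have "x + (- (real m / p) + real n * (1 / p)) = x0 + real n * (1 / p)" for n by (simp add: x0_def)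
    then have "fibre_sum p m \<theta> x = (\<Sum>n<2 * m. if x0 + real n * (1 / p) \<in> \<Omega> then expo \<theta> (x0 + real n * (1 / p)) else 0)"
      by (simp only: fibre_sum_def)
    also have "\<dots> = (\<Sum>n\<in>{n \<in> {..<2 * m}. x0 + real n * (1 / p) \<in> \<Omega>}. expo \<theta> (x0 + real n * (1 / p)))"
      by (rule sum.inter_filter[symmetric]) simp
    finally show ?thesis by (simp add: B_def)
  qed
  have "complex_of_real (real (card B)) = of_real p" using x(1) unfolding fs by (simp add: expo_simps(1))
  then have cB: "real (card B) = p" using of_real_eq_iff by blast
  then have "B \<noteq> {}" using p by auto
  \<comment> \<open>Shifting the exponents so that the least one is 0 divides each relation by the
    nonzero number \<open>expo \<theta> x0 * expo \<theta> (1 / p) ^ b\<close> and secures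
    \<open>0 \<in> A\<close>.\<close>
  define b where "b = Min B"
  have b: "b \<in> B" "\<And>n. n \<in> B \<Longrightarrow> b \<le> n" using fB \<open>B \<noteq> {}\<close> by (auto simp: b_def)
  have inj: "inj_on (\<lambda>n. n - b) B" using b(2) by (rule inj_on_diff_nat)
  show thesis
  proof
    show "finite ((\<lambda>n. n - b) ` B)" using fB by simp
    show "0 \<in> (\<lambda>n. n - b) ` B" using b(1) by force
    show "real (card ((\<lambda>n. n - b) ` B)) = p" using inj cB by (simp add: card_image)
    fix \<theta> assume "\<theta> \<in> T"
    have "expo \<theta> x0 * expo \<theta> (1 / p) ^ b * (\<Sum>n\<in>(\<lambda>n. n - b) ` B. expo \<theta> (1 / p) ^ n) = (\<Sum>n\<in>B. expo \<theta> x0 * expo \<theta> (1 / p) ^ n)"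
      using b(2) by (subst sum.reindex[OF inj]) (auto simp: sum_distrib_left mult.assoc power_add[symmetric] intro!: sum.cong)
    also have "\<dots> = fibre_sum p m \<theta> x" unfolding fs by (simp only: expo_simps(4)[of \<theta> x0] expo_power)
    also have "\<dots> = 0" using x(2) \<open>\<theta> \<in> T\<close> by simp
    finally show "(\<Sum>n\<in>(\<lambda>n. n - b) ` B. expo \<theta> (1 / p) ^ n) = 0" by (simp add: expo_simps(7))
  qed
qed

lemma spectrum_rational:
  assumes sp: "is_spectrum \<Omega> \<Lambda>" and "0 \<in> \<Lambda>"
  shows "\<Lambda> \<subseteq> \<rat>"
proof -
  have eb: "exp_basis \<Lambda>" using sp by (rule spectrum_exp_basis)
  obtain p where p: "p > 0" and per: "\<And>y. y + p \<in> \<Lambda> \<longleftrightarrow> y \<in> \<Lambda>" using exp_basis_periodic[OF eb] by blast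
  have per_int: "y + of_int k * p \<in> \<Lambda> \<longleftrightarrow> y \<in> \<Lambda>" for y and k :: int
  proof (induction k rule: int_induct[of _ 0])
    case (step1 k)
    then show ?case using per[of "y + of_int k * p"] by (simp add: algebra_simps)
  next
    case (step2 k)
    then show ?case using per[of "y + of_int (k - 1) * p"] by (simp add: algebra_simps)
  qed simp
  define R where "R = {l \<in> \<Lambda>. 0 \<le> l \<and> l < p}"
  define r where "r = (\<lambda>l. l - of_int \<lfloor>l / p\<rfloor> * p)"
  have "R \<subseteq> \<Lambda> \<inter> {0..p}" by (auto simp: R_def)
  then have fR: "finite R" using exp_basis_locally_finite[OF eb] finite_subset by blast
  have r: "r l \<in> R" "(l - r l) / p \<in> \<int>" if "l \<in> \<Lambda>" for l
  proof -
    have "of_int \<lfloor>l / p\<rfloor> * p \<le> l / p * p" using p by (intro mult_right_mono of_int_floor_le) simp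
    moreover have "l / p * p < (of_int \<lfloor>l / p\<rfloor> + 1) * p" using p by (intro mult_strict_right_mono) linarith+
    moreover have "r l \<in> \<Lambda>" using per_int[of l "- \<lfloor>l / p\<rfloor>"] that by (simp add: r_def)
    ultimately show "r l \<in> R" using p by (simp add: R_def r_def algebra_simps)
    show "(l - r l) / p \<in> \<int>" using p by (simp add: r_def)
  qed
  have small: "k = 0" if "l \<in> R" "l' \<in> R" "of_int k * p = l' - l" for k :: int and l l'
  proof -
    have "\<bar>of_int k * p\<bar> < 1 * p" using that by (auto simp: R_def)
    then have "\<bar>real_of_int k\<bar> < 1" using p by (simp add: abs_mult)
    then show ?thesis by linarith
  qed
  define T where "T = {l - l' | l l'. l \<in> R \<and> l' \<in> R \<and> l \<noteq> l'}"
  have "T \<subseteq> (\<lambda>(l, l'). l - l') ` (R \<times> R)" by (auto simp: T_def)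
  then have fT: "finite T" using fR by (meson finite_SigmaI finite_imageI finite_subset)
  obtain A where A: "finite A" "0 \<in> A" "real (card A) = p" "\<And>\<theta>. \<theta> \<in> T \<Longrightarrow> (\<Sum>n\<in>A. expo \<theta> (1 / p) ^ n) = 0"
  proof (rule common_fibre[OF p _ fT])
    fix k :: int assume "k \<noteq> 0"
    then show "U (of_int k * p) = 0" using exp_basis_orth[OF eb, of "of_int k * p" 0] per_int[of 0 k] \<open>0 \<in> \<Lambda>\<close> p by simp
  next
    fix \<theta> and k :: int assume "\<theta> \<in> T"
    then obtain l l' where l: "l \<in> R" "l' \<in> R" "l \<noteq> l'" "\<theta> = l - l'" by (auto simp: T_def)
    have "l + of_int k * p \<noteq> l'" using small[OF l(1,2), of k] l(3) by auto
    then have "U (l + of_int k * p - l') = 0"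
      using exp_basis_orth[OF eb, of "l + of_int k * p" l'] per_int[of l k] l by (simp add: R_def)
    moreover have "of_int k * p + \<theta> = l + of_int k * p - l'" using l(4) by simp
    ultimately show "U (of_int k * p + \<theta>) = 0" by (simp only:)
  qed blast
  define z where "z = (\<lambda>l. expo l (1 / p))"
  \<comment> \<open>Distinct representatives give distinct numbers, so the lower bound for the
    number of classes becomes a lower bound for the number of values of \<open>z\<close>.\<close>
  have zinj: "inj_on z R"
  proof (rule inj_onI)
    fix l l' assume l: "l \<in> R" "l' \<in> R" "z l = z l'"
    then obtain k :: int where "(l - l') * (1 / p) = of_int k" unfolding z_def expo_eq_iff by (auto elim: Ints_cases)
    then have k: "of_int k * p = l - l'" using p by (simp add: field_simps)
    then show "l = l'" using small[OF l(2,1) k] by simp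
  qed
  have root: "\<exists>n>0. z l ^ n = 1" if "l \<in> R" for l
  proof (rule finite_spectrum_roots_of_unity[OF A(1,2), of "z ` R"])
    have "real (card A) \<le> real (card R)" using period_le_card_residues[OF sp p fR, of r] r A(3) by simp
    then show "card A \<le> card (z ` R)" using card_image[OF zinj] by simp
    have "0 \<in> R" using \<open>0 \<in> \<Lambda>\<close> p by (simp add: R_def)
    moreover have "z 0 = 1" by (simp add: z_def expo_simps(1))
    ultimately show "1 \<in> z ` R" by (metis imageI)
    show "0 \<notin> z ` R" by (auto simp: z_def expo_simps(7))
    fix x y assume "x \<in> z ` R" "y \<in> z ` R" "x \<noteq> y"
    then obtain l l' where l: "l \<in> R" "l' \<in> R" "x = z l" "y = z l'" "l \<noteq> l'" by auto
    have "expo (l - l') (1 / p) * y = x" unfolding l z_def expo_simps(3)[symmetric] by simp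
    moreover have "y \<noteq> 0" by (simp add: l z_def expo_simps(7))
    ultimately have "x / y = expo (l - l') (1 / p)" by (metis nonzero_mult_div_cancel_right)
    then show "(\<Sum>a\<in>A. (x / y) ^ a) = 0" using A(4)[of "l - l'"] l by (auto simp: T_def)
  qed (use fR that in auto)
  \<comment> \<open>The period is rational because it counts the points of a fibre; the roots of
    unity alone would only make \<open>l / p\<close> rational.\<close>
  have ratp: "p \<in> \<rat>" using A(3) by (metis Rats_of_nat)
  have ratR: "l \<in> \<rat>" if lR: "l \<in> R" for l
  proof -
    obtain n where n: "n > 0" "z l ^ n = 1" using root[OF lR] by blast
    then have "l * (real n * (1 / p)) \<in> \<int>" unfolding z_def expo_power[symmetric] expo_eq_1_iff by blast
    then obtain k :: int where "l * (real n * (1 / p)) = of_int k" by (auto elim: Ints_cases)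
    then have "l = of_int k * p / real n" using n(1) p by (simp add: field_simps)
    then show ?thesis using ratp by simp
  qed
  show ?thesis
  proof
    fix l assume "l \<in> \<Lambda>"
    obtain k :: int where "(l - r l) / p = of_int k" using r(2)[OF \<open>l \<in> \<Lambda>\<close>] by (auto elim: Ints_cases)
    then have "l = r l + of_int k * p" using p by (simp add: field_simps)
    then show "l \<in> \<rat>" using ratR[OF r(1)[OF \<open>l \<in> \<Lambda>\<close>]] ratp by (metis Rats_add Rats_mult Rats_of_int)
  qed
qed

end

theorem theorem1p3:
  fixes \<Omega> \<Lambda> :: "real set"
  assumes "spectral_set \<Omega>"
    and "emeasure lebesgue \<Omega> = 1"
    and "is_spectrum \<Omega> \<Lambda>"
    and "0 \<in> \<Lambda>"
  shows "\<Lambda> \<subseteq> \<rat>"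
proof -
  interpret unit_domain \<Omega>
    using assms(1,2) by unfold_locales (simp_all add: spectral_set_def)
  show ?thesis using assms(3,4) by (rule spectrum_rational)
qed

end
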